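(* Let $\mathcal{P}$ be a partially ordered set of cardinality at most $2^{\aleph_0}$. Then there exist a collection $(\mathcal{A}_t)_{t\in\mathcal{P}}$ of uncountable, almost disjoint families $\mathcal{A}_t\subseteq[\mathbb{N}]^{\omega}$ and a collection of isometric algebra homomorphisms $\iota_{s,t}\colon C_0(K_{\mathcal{A}_s})\to C_0(K_{\mathcal{A}_t})$, for $s,t\in\mathcal{P}$ with $s\le t$, such that: (1) $\iota_{s,s}$ is the identity on $C_0(K_{\mathcal{A}_s})$ for every $s \in \mathcal{P}$, and $\iota_{s,t}\iota_{r,s}=\iota_{r,t}$ for all $r\le s\le t$ in $\mathcal{P}$. (2) Let $s,t\in\mathcal{P}$ and let $T\colon C_0(K_{\mathcal{A}_s})\to C_0(K_{\mathcal{A}_t})$ be an operator. If $s\le t$, then $T=\lambda\iota_{s,t}+S$, where $\lambda\in\mathbb{K}$ and $S$ is an operator that factors through $c_0$. If $s\not\le t$, then $T$ factors through $c_0$.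
   Context: The scalar field $\mathbb{K}$ is $\mathbb{R}$ or $\mathbb{C}$. "Operator" means bounded linear map. $[\mathbb{N}]^{\omega}$ is the set of infinite subsets of $\mathbb{N}$; a family $\mathcal{A}\subseteq[\mathbb{N}]^{\omega}$ is almost disjoint if $A\cap B$ is finite for all distinct $A,B\in\mathcal{A}$. For an almost disjoint family $\mathcal{A}$, $K_{\mathcal{A}}$ is the locally compact Hausdorff space consisting of distinct points $\{x_n:n\in\mathbb{N}\}\cup\{y_A:A\in\mathcal{A}\}$, where each $x_n$ is isolated and, for each $A\in\mathcal{A}$, the sets $\{x_n:n\in A\setminus F\}\cup\{y_A\}$ with $F\subseteq\mathbb{N}$ finite form a neighbourhood basis at $y_A$. $C_0(K)$ is the Banach algebra (pointwise operations, sup norm) of continuous functions $K\to\mathbb{K}$ vanishing at infinity. An operator $S\colon X\to Y$ factors through $c_0$ if $S=UV$ for some operators $V\colon X\to c_0$ and $U\colon c_0\to Y$. *)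

theory Defs
  imports "HOL-Analysis.Analysis"
begin

definition almost_disjoint :: "nat set set \<Rightarrow> bool" where
  "almost_disjoint \<A> \<longleftrightarrow>
     (\<forall>A\<in>\<A>. infinite A) \<and> pairwise (\<lambda>A B. finite (A \<inter> B)) \<A>"

text \<open>The space \<open>K\<^sub>\<A>\<close>: the point \<open>x\<^sub>n\<close> is encoded as \<open>Inl n\<close> and \<open>y\<^sub>A\<close> as \<open>Inr A\<close>.
  A set is open iff it contains a basic neighbourhood of each of its points.\<close>

definition K_space :: "nat set set \<Rightarrow> (nat + nat set) topology" where
  "K_space \<A> = topology (\<lambda>U. U \<subseteq> range Inl \<union> Inr ` \<A> \<and>
     (\<forall>A\<in>\<A>. Inr A \<in> U \<longrightarrow> (\<exists>F. finite F \<and> Inl ` (A - F) \<subseteq> U)))"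

lemma openin_K_space:
  "openin (K_space \<A>) U \<longleftrightarrow> U \<subseteq> range Inl \<union> Inr ` \<A> \<and>
     (\<forall>A\<in>\<A>. Inr A \<in> U \<longrightarrow> (\<exists>F. finite F \<and> Inl ` (A - F) \<subseteq> U))"
proof -
  have "istopology (\<lambda>U. U \<subseteq> range Inl \<union> Inr ` \<A> \<and>
     (\<forall>A\<in>\<A>. Inr A \<in> U \<longrightarrow> (\<exists>F. finite F \<and> Inl ` (A - F) \<subseteq> U)))"
    (is "istopology ?P")
  proof -
    have "?P (S \<inter> T)" if S: "?P S" and T: "?P T" for S T
    proof -
      have "\<exists>F. finite F \<and> Inl ` (A - F) \<subseteq> S \<inter> T" if A: "A \<in> \<A>" "Inr A \<in> S \<inter> T" for A
      proof -
        obtain F G where "finite F" "Inl ` (A - F) \<subseteq> S" "finite G" "Inl ` (A - G) \<subseteq> T"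
          using S T A by (meson IntD1 IntD2)
        then show ?thesis
          by (intro exI[of _ "F \<union> G"]) auto
      qed
      then show ?thesis
        using S by auto
    qed
    moreover have "?P (\<Union>\<K>)" if \<K>: "\<forall>K\<in>\<K>. ?P K" for \<K>
    proof -
      have "\<exists>F. finite F \<and> Inl ` (A - F) \<subseteq> \<Union>\<K>" if A: "A \<in> \<A>" "Inr A \<in> \<Union>\<K>" for A
      proof -
        obtain K where "K \<in> \<K>" "Inr A \<in> K"
          using A by blast
        then obtain F where "finite F" "Inl ` (A - F) \<subseteq> K"
          using \<K> A by meson
        then show ?thesis
          using \<open>K \<in> \<K>\<close> by blast
      qed
      moreover have "\<Union>\<K> \<subseteq> range Inl \<union> Inr ` \<A>"
        using \<K> by blast
      ultimately show ?thesis
        by blast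
    qed
    ultimately show ?thesis
      unfolding istopology_def by presburger
  qed
  then show ?thesis
    by (simp add: K_space_def)
qed

lemma topspace_K_space: "topspace (K_space \<A>) = range Inl \<union> Inr ` \<A>"
proof
  show "topspace (K_space \<A>) \<subseteq> range Inl \<union> Inr ` \<A>"
    using openin_K_space openin_topspace by blast
  have "openin (K_space \<A>) (range Inl \<union> Inr ` \<A>)"
    unfolding openin_K_space by auto
  then show "range Inl \<union> Inr ` \<A> \<subseteq> topspace (K_space \<A>)"
    by (rule openin_subset)
qed

lemma openin_K_space_isolated: "openin (K_space \<A>) {Inl n}"
  by (auto simp: openin_K_space)

lemma openin_K_space_basic:
  assumes "A \<in> \<A>" "finite F"
  shows "openin (K_space \<A>) (insert (Inr A) (Inl ` (A - F)))"
  using assms by (auto simp: openin_K_space)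

lemma Hausdorff_K_space:
  assumes "almost_disjoint \<A>"
  shows "Hausdorff_space (K_space \<A>)"
  unfolding Hausdorff_space_def
proof (intro allI impI, elim conjE)
  fix p q
  assume p: "p \<in> topspace (K_space \<A>)" and q: "q \<in> topspace (K_space \<A>)" and "p \<noteq> q"
  have nA: "openin (K_space \<A>) (insert (Inr A) (Inl ` (A - {n})))" if "A \<in> \<A>" for A n
    using openin_K_space_basic[OF that] by blast
  consider m n where "p = Inl m" "q = Inl n"
    | m B where "p = Inl m" "q = Inr B" "B \<in> \<A>"
    | A n where "p = Inr A" "q = Inl n" "A \<in> \<A>"
    | A B where "p = Inr A" "q = Inr B" "A \<in> \<A>" "B \<in> \<A>"
    using p q unfolding topspace_K_space by blast
  then show "\<exists>U V. openin (K_space \<A>) U \<and> openin (K_space \<A>) V \<and> p \<in> U \<and> q \<in> V \<and> disjnt U V"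
  proof cases
    case 1
    then show ?thesis
      using \<open>p \<noteq> q\<close>
      by (intro exI[of _ "{p}"] exI[of _ "{q}"]) (auto simp: openin_K_space_isolated)
  next
    case 2
    then show ?thesis
      by (intro exI[of _ "{Inl m}"] exI[of _ "insert (Inr B) (Inl ` (B - {m}))"])
        (auto simp: openin_K_space_isolated nA disjnt_iff)
  next
    case 3
    then show ?thesis
      by (intro exI[of _ "insert (Inr A) (Inl ` (A - {n}))"] exI[of _ "{Inl n}"])
        (auto simp: openin_K_space_isolated nA disjnt_iff)
  next
    case 4
    then have "finite (A \<inter> B)"
      using assms \<open>p \<noteq> q\<close> unfolding almost_disjoint_def pairwise_def by auto
    moreover have "disjnt (insert (Inr A) (Inl ` (A - (A \<inter> B))))
        (insert (Inr B) (Inl ` (B - (A \<inter> B))))"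
      using 4 \<open>p \<noteq> q\<close> by (auto simp: disjnt_iff)
    ultimately show ?thesis
      using 4 openin_K_space_basic[of A \<A> "A \<inter> B"] openin_K_space_basic[of B \<A> "A \<inter> B"]
      by (metis insertI1)
  qed
qed

text \<open>Functions on a space are represented as functions on the ambient type that are \<open>0\<close> off
  the space, so that distinct representatives are distinct elements of \<open>C\<^sub>0\<close>, and pointwise
  operations on the whole type are the pointwise operations of \<open>C\<^sub>0\<close>.\<close>

definition C_0 :: "'a topology \<Rightarrow> ('a \<Rightarrow> 'k::real_normed_field) set" where
  "C_0 X = {f. continuous_map X euclidean f
      \<and> (\<forall>\<epsilon>>0. compactin X {x \<in> topspace X. norm (f x) \<ge> \<epsilon>})
      \<and> (\<forall>x. x \<notin> topspace X \<longrightarrow> f x = 0)}"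

definition c_0 :: "(nat \<Rightarrow> 'k::real_normed_field) set" where
  "c_0 = {x. x \<longlonglongrightarrow> 0}"

text \<open>The norm of both \<open>C_0 X\<close> and \<open>c_0\<close>, whose elements are all bounded.
  Values off the space are \<open>0\<close> and hence do not affect the supremum.\<close>

definition sup_norm :: "('a \<Rightarrow> 'k::real_normed_field) \<Rightarrow> real" where
  "sup_norm f = (SUP x. norm (f x))"

text \<open>Linear maps between spaces of scalar functions, linear over the scalar field \<open>'k\<close>.
  Only the values on the carrier \<open>X\<close> are relevant.\<close>

definition linear_map ::
  "('a \<Rightarrow> 'k::real_normed_field) set \<Rightarrow> ('b \<Rightarrow> 'k) set \<Rightarrow> (('a \<Rightarrow> 'k) \<Rightarrow> ('b \<Rightarrow> 'k)) \<Rightarrow> bool" where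
  "linear_map X Y T \<longleftrightarrow> T \<in> X \<rightarrow> Y
     \<and> (\<forall>f\<in>X. \<forall>g\<in>X. T (\<lambda>x. f x + g x) = (\<lambda>y. T f y + T g y))
     \<and> (\<forall>c. \<forall>f\<in>X. T (\<lambda>x. c * f x) = (\<lambda>y. c * T f y))"

definition bounded_operator ::
  "('a \<Rightarrow> 'k::real_normed_field) set \<Rightarrow> ('b \<Rightarrow> 'k) set \<Rightarrow> (('a \<Rightarrow> 'k) \<Rightarrow> ('b \<Rightarrow> 'k)) \<Rightarrow> bool" where
  "bounded_operator X Y T \<longleftrightarrow> linear_map X Y T
     \<and> (\<exists>B. \<forall>f\<in>X. sup_norm (T f) \<le> B * sup_norm f)"

definition isometric_algebra_hom ::
  "('a \<Rightarrow> 'k::real_normed_field) set \<Rightarrow> ('b \<Rightarrow> 'k) set \<Rightarrow> (('a \<Rightarrow> 'k) \<Rightarrow> ('b \<Rightarrow> 'k)) \<Rightarrow> bool" where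
  "isometric_algebra_hom X Y T \<longleftrightarrow> linear_map X Y T
     \<and> (\<forall>f\<in>X. \<forall>g\<in>X. T (\<lambda>x. f x * g x) = (\<lambda>y. T f y * T g y))
     \<and> (\<forall>f\<in>X. sup_norm (T f) = sup_norm f)"

definition factors_through_c_0 ::
  "('a \<Rightarrow> 'k::real_normed_field) set \<Rightarrow> ('b \<Rightarrow> 'k) set \<Rightarrow> (('a \<Rightarrow> 'k) \<Rightarrow> ('b \<Rightarrow> 'k)) \<Rightarrow> bool" where
  "factors_through_c_0 X Y S \<longleftrightarrow>
     (\<exists>V U. bounded_operator X c_0 V \<and> bounded_operator c_0 Y U \<and> (\<forall>f\<in>X. S f = U (V f)))"

end

theory Submission
  imports Defs
begin

text \<open>
  Attach to every natural number \<open>n\<close> a point \<open>rho n\<close> of the unit interval, densely and with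
  repetitions. Subsets of \<open>\<nat>\<close> whose sets of cluster points are disjoint are almost disjoint,
  so one family \<open>\<D>\<close> is built by transfinite recursion of length \<open>2\<^sup>\<aleph>\<^sub>0\<close>, each new member having
  one or two cluster points, all of them fresh. It is split into uncountable classes \<open>\<C>\<^sub>u\<close>,
  \<open>u \<in> P\<close>; then \<open>\<A>\<^sub>t\<close> is the union of the \<open>\<C>\<^sub>u\<close> with \<open>u \<le> t\<close>, and \<open>\<iota>\<^sub>s\<^sub>,\<^sub>t\<close> is extension by zero.

  An operator \<open>T\<close> is determined on all but countably many of the indicator functions of members of the
  family by the matrix \<open>M\<close> of its restriction to \<open>c\<^sub>0\<close>, whose rows are in \<open>\<ell>\<^sub>1\<close>. There are
  \<open>2\<^sup>\<aleph>\<^sub>0\<close> such matrices, and the recursion handles each of them uncountably often in each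
  class. If at some stage a fresh set \<open>A\<close> exists for which the transform \<open>M 1\<^sub>A\<close> fails to converge in a
  way that no continuation of the family can repair, such an \<open>A\<close> is added, and \<open>M\<close> is the matrix of no
  operator. Otherwise the sets of points near which \<open>M\<close> differs from a fixed multiple \<open>\<lambda>\<close> of the
  identity are \<open>F\<^sub>\<sigma>\<close> sets of cardinality less than \<open>2\<^sup>\<aleph>\<^sub>0\<close>, hence countable. So
  \<open>T - \<lambda> \<iota>\<close> takes its values in \<open>C\<^sub>0(K\<^sub>\<W>)\<close> for a countable \<open>\<W>\<close>, and this space is
  isomorphic to \<open>c\<^sub>0\<close>.
\<close>

text \<open>The obstacle is that a stage of the recursion may face uncountably many earlier members,
  so they cannot be listed and treated one at a time. Cluster points turn almost disjointness into
  the avoidance of fewer than continuum many reals. New points are always taken from uncountable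
  closed sets, which have the cardinality of the continuum; this is why each obstruction to being a
  multiple of the identity is phrased as a countable union of closed sets. A second cluster point is
  needed because divergence may only show when two places are compared: columns near one point with
  rows near another, or two limits of the diagonal. Since an operator agrees with its matrix on the
  indicators of all but countably many members, a single stage for the matrix might fall among the
  exceptions; this is the reason for the repetitions. Finally, divergence has to exclude every
  target space at once. A function in \<open>C0K\<close> of any subfamily converges along subsets of
  members and along sets almost disjoint from all members, and these are the two kinds of set on
  which \<open>kills\<close> asks for divergence.\<close>

unbundle cardinal_syntax

section \<open>Points of the unit interval attached to sequences of natural numbers\<close>

text \<open>The condensation points of an uncountable closed set form a nonempty perfect subset.\<close>

lemma uncountable_closed_lepoll:
  fixes C :: "real set"
  assumes "closed C" "uncountable C"
  shows "(UNIV :: nat set set) \<lesssim> C"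
proof -
  define P where "P = {x. \<forall>U. open U \<longrightarrow> x \<in> U \<longrightarrow> uncountable (C \<inter> U)}"
  define \<U> where "\<U> = {U. open U \<and> countable (C \<inter> U)}"
  \<comment> \<open>The open sets that meet \<open>C\<close> in a countable set have a countable
    subfamily with the same union, so only countably many points of \<open>C\<close> fail to be
    condensation points.\<close>
  obtain \<V> where \<V>: "\<V> \<subseteq> \<U>" "countable \<V>" "\<Union>\<V> = \<Union>\<U>"
    using Lindelof[of \<U>] by (auto simp: \<U>_def)
  have "C - P \<subseteq> (\<Union>U\<in>\<V>. C \<inter> U)"
  proof
    fix x assume "x \<in> C - P"
    then obtain U where "open U" "x \<in> U" "countable (C \<inter> U)" by (auto simp: P_def)
    then have "x \<in> \<Union>\<U>" by (auto simp: \<U>_def)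
    with \<open>x \<in> C - P\<close> \<V>(3) show "x \<in> (\<Union>U\<in>\<V>. C \<inter> U)" by blast
  qed
  moreover have "countable (\<Union>U\<in>\<V>. C \<inter> U)"
    using \<V> by (intro countable_UN) (auto simp: \<U>_def)
  ultimately have CP: "countable (C - P)" by (rule countable_subset)
  have "P \<subseteq> C"
  proof
    fix x assume x: "x \<in> P"
    show "x \<in> C"
    proof (rule ccontr)
      assume "x \<notin> C"
      with x assms(1) have "uncountable (C \<inter> - C)" unfolding P_def
        by (metis (no_types, lifting) ComplI mem_Collect_eq open_Compl)
      then show False by simp
    qed
  qed
  \<comment> \<open>Only the countable set \<open>C - P\<close> has been discarded, so every
    neighbourhood of a point of \<open>P\<close> still meets \<open>P\<close> in an uncountable set;
    hence \<open>P\<close> has no isolated points.\<close>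
  have unc: "uncountable (P \<inter> U)" if "open U" "x \<in> U" "x \<in> P" for x U
  proof
    assume "countable (P \<inter> U)"
    then have "countable ((P \<inter> U) \<union> (C - P))" using CP by simp
    moreover have "C \<inter> U \<subseteq> (P \<inter> U) \<union> (C - P)" by blast
    ultimately have "countable (C \<inter> U)" by (meson countable_subset)
    with that show False by (auto simp: P_def)
  qed
  have "euclidean derived_set_of P = P"
  proof (intro set_eqI iffI)
    fix x assume x: "x \<in> euclidean derived_set_of P"
    show "x \<in> P" unfolding P_def
    proof (intro CollectI allI impI)
      fix U :: "real set" assume U: "open U" "x \<in> U"
      then obtain y where "y \<in> P" "y \<in> U" using x by (auto simp: in_derived_set_of)
      then show "uncountable (C \<inter> U)" using U by (auto simp: P_def)
    qed
  next
    fix x assume x: "x \<in> P"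
    show "x \<in> euclidean derived_set_of P" unfolding in_derived_set_of
    proof (intro conjI allI impI)
      fix T assume T: "x \<in> T \<and> openin euclidean T"
      then have "uncountable (P \<inter> T)" using unc x by auto
      then have "\<not> P \<inter> T \<subseteq> {x}" by (meson countable_empty countable_insert countable_subset)
      then show "\<exists>y. y \<noteq> x \<and> y \<in> P \<and> y \<in> T" by blast
    qed simp
  qed
  moreover have "P \<noteq> {}" using CP assms(2) by (metis Diff_empty)
  moreover have "completely_metrizable_space (euclidean :: real topology)"
    by (simp add: completely_metrizable_space_euclidean)
  ultimately have "(UNIV :: real set) \<lesssim> P" by (intro lepoll_perfect_set) auto
  then have "(UNIV :: nat set set) \<lesssim> P"
    using nat_sets_eqpoll_reals lepoll_trans2 eqpoll_sym lepoll_trans1 by blast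
  then show ?thesis using \<open>P \<subseteq> C\<close> lepoll_trans subset_imp_lepoll by blast
qed

text \<open>Here \<open>from_nat\<close> enumerates the rationals. Clamping keeps all values in a
  compact interval, so that every infinite set of indices has a cluster point.\<close>

definition rho :: "nat \<Rightarrow> real" where
  "rho n = max 0 (min 1 (of_rat (from_nat n)))"

lemma rho_mem: "rho n \<in> {0..1}"
  by (auto simp: rho_def)

lemma infinite_rho_near:
  assumes "x \<in> {0..1}" "\<delta> > 0"
  shows "infinite {n. dist (rho n) x < \<delta>}"
proof
  assume fin: "finite {n. dist (rho n) x < \<delta>}"
  define a where "a = max 0 (x - \<delta>)"
  define b where "b = min 1 (x + \<delta>)"
  have ab: "a < b" using assms by (auto simp: a_def b_def)
  define S where "S = {q \<in> \<rat>. a < q \<and> q < b}"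
  have "S \<subseteq> rho ` {n. dist (rho n) x < \<delta>}"
  proof
    fix q assume "q \<in> S"
    then obtain r where r: "q = of_rat r" "a < q" "q < b" by (auto simp: S_def elim: Rats_cases)
    obtain n where "r = from_nat n" by (metis surj_def surj_from_nat)
    with r have "rho n = q" by (auto simp: rho_def a_def b_def)
    moreover have "dist q x < \<delta>" using r by (auto simp: a_def b_def dist_real_def)
    ultimately show "q \<in> rho ` {n. dist (rho n) x < \<delta>}" by auto
  qed
  then have "finite S" using fin by (meson finite_imageI finite_subset)
  \<comment> \<open>A rational between \<open>a\<close> and the least element of the supposedly
    finite \<open>S\<close> contradicts minimality; \<open>b\<close> is inserted to cover empty
    \<open>S\<close>.\<close>
  obtain q where q: "q \<in> \<rat>" "a < q" "q < Min (insert b S)"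
    using Rats_dense_in_real[of a "Min (insert b S)"] ab \<open>finite S\<close> by (auto simp: S_def)
  then have "q \<in> S" using \<open>finite S\<close> by (auto simp: S_def)
  with q \<open>finite S\<close> show False by auto
qed

section \<open>Limits along a set of natural numbers\<close>

text \<open>For finite \<open>H\<close> this filter is \<open>bot\<close> and everything converges
  along it. So the absence of a limit along \<open>E\<close> entails that \<open>E\<close> is
  infinite.\<close>

abbreviation along :: "nat set \<Rightarrow> nat filter" where
  "along H \<equiv> inf sequentially (principal H)"

lemma eventually_along: "eventually P (along H) \<longleftrightarrow> finite {n\<in>H. \<not> P n}"
proof -
  have "eventually P (along H) \<longleftrightarrow> finite {n. \<not> (n \<in> H \<longrightarrow> P n)}"
    unfolding eventually_inf_principal cofinite_eq_sequentially[symmetric] eventually_cofinite ..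
  also have "{n. \<not> (n \<in> H \<longrightarrow> P n)} = {n\<in>H. \<not> P n}" by auto
  finally show ?thesis .
qed

lemma along_mono: "H \<subseteq> H' \<Longrightarrow> along H \<le> along H'"
  by (intro inf_mono) auto

lemma along_eq_bot_iff: "along H = bot \<longleftrightarrow> finite H"
  by (simp add: trivial_limit_def eventually_along)

lemma tendsto_along_mono: "(f \<longlongrightarrow> l) (along H') \<Longrightarrow> H \<subseteq> H' \<Longrightarrow> (f \<longlongrightarrow> l) (along H)"
  using along_mono tendsto_mono by blast

lemma tendsto_along_dist:
  fixes f :: "nat \<Rightarrow> 'a::metric_space"
  shows "(f \<longlongrightarrow> l) (along H) \<longleftrightarrow> (\<forall>e>0. finite {n\<in>H. dist (f n) l \<ge> e})"
  by (simp add: tendsto_iff eventually_along not_less)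

lemma along_range:
  assumes "inj r"
  shows "along (range r) = filtermap r sequentially"
proof (rule filter_eqI)
  fix P :: "nat \<Rightarrow> bool"
  have "{n\<in>range r. \<not> P n} = r ` {k. \<not> P (r k)}" by auto
  then have "finite {n\<in>range r. \<not> P n} \<longleftrightarrow> finite {k. \<not> P (r k)}"
    using assms by (metis finite_imageD finite_imageI inj_on_subset subset_UNIV)
  then show "eventually P (along (range r)) \<longleftrightarrow> eventually P (filtermap r sequentially)"
    unfolding eventually_along eventually_filtermap
    by (simp add: cofinite_eq_sequentially[symmetric] eventually_cofinite)
qed

lemma tendsto_along_range:
  assumes "inj r"
  shows "(f \<longlongrightarrow> l) (along (range r)) \<longleftrightarrow> (\<lambda>k. f (r k)) \<longlonglongrightarrow> l"
  by (simp add: along_range[OF assms] tendsto_compose_filtermap filterlim_filtermap)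

lemma bounded_convergent_along:
  fixes f :: "nat \<Rightarrow> 'a::heine_borel"
  assumes "infinite H" "bounded (f ` H)"
  obtains H' l where "infinite H'" "H' \<subseteq> H" "(f \<longlongrightarrow> l) (along H')"
proof -
  define e where "e = enumerate H"
  have e: "strict_mono e" "range e = H"
    using assms(1) by (auto simp: e_def strict_mono_enumerate range_enumerate)
  have "bounded (range (f \<circ> e))" using assms(2) e(2) by (metis image_comp)
  then obtain l r where r: "strict_mono r" "((f \<circ> e) \<circ> r) \<longlonglongrightarrow> l"
    using bounded_imp_convergent_subsequence by blast
  have sm: "strict_mono (e \<circ> r)" using e(1) r(1) by (rule strict_mono_o)
  have "(f \<longlongrightarrow> l) (along (range (e \<circ> r)))"
    using r(2) unfolding tendsto_along_range[OF strict_mono_imp_inj_on[OF sm]] by (simp add: o_def)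
  moreover have "infinite (range (e \<circ> r))"
    by (intro range_inj_infinite strict_mono_imp_inj_on sm)
  moreover have "range (e \<circ> r) \<subseteq> H" using e(2) by auto
  ultimately show ?thesis using that by blast
qed

section \<open>Cluster points of sets of indices\<close>

definition clusters :: "nat set \<Rightarrow> real set" where
  "clusters H = {x. \<forall>\<delta>>0. infinite {n\<in>H. dist (rho n) x < \<delta>}}"

lemma closed_clusters: "closed (clusters H)"
  unfolding closed_sequential_limits
proof (intro allI impI, elim conjE)
  fix x l assume x: "\<forall>n. x n \<in> clusters H" "x \<longlonglongrightarrow> l"
  show "l \<in> clusters H" unfolding clusters_def
  proof (intro CollectI allI impI)
    fix \<delta> :: real assume "\<delta> > 0"
    then obtain n where "dist (x n) l < \<delta>/2"
      using x(2) by (metis half_gt_zero lim_sequentially order_refl)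
    have "dist (rho m) l < \<delta>" if "dist (rho m) (x n) < \<delta>/2" for m
      using dist_triangle[of "rho m" l "x n"] that \<open>dist (x n) l < \<delta>/2\<close> by linarith
    then have "{m\<in>H. dist (rho m) (x n) < \<delta>/2} \<subseteq> {m\<in>H. dist (rho m) l < \<delta>}"
      by blast
    moreover have "infinite {m\<in>H. dist (rho m) (x n) < \<delta>/2}"
      using x(1) half_gt_zero[OF \<open>\<delta> > 0\<close>] unfolding clusters_def by blast
    ultimately show "infinite {m\<in>H. dist (rho m) l < \<delta>}" using infinite_super by blast
  qed
qed

lemma clusters_along:
  assumes "x \<in> clusters H"
  obtains H' where "infinite H'" "H' \<subseteq> H" "(rho \<longlongrightarrow> x) (along H')"
proof -
  have "\<exists>r. \<forall>n. (r n \<in> H \<and> dist (rho (r n)) x < inverse (real (Suc n))) \<and> r n < r (Suc n)"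
  proof (rule dependent_nat_choice)
    have inf: "infinite {m\<in>H. dist (rho m) x < inverse (real (Suc n))}" for n
      using assms by (auto simp: clusters_def)
    show "\<exists>m. m \<in> H \<and> dist (rho m) x < inverse (real (Suc 0))"
      using inf[of 0] by (metis (mono_tags, lifting) Collect_empty_eq finite.emptyI)
    show "\<exists>y. (y \<in> H \<and> dist (rho y) x < inverse (real (Suc (Suc n)))) \<and> m < y" for m n
      using inf[of "Suc n"] unfolding infinite_nat_iff_unbounded by blast
  qed
  then obtain r where r: "\<And>n. r n \<in> H" "\<And>n. dist (rho (r n)) x < inverse (real (Suc n))" "\<And>n. r n < r (Suc n)"
    by blast
  then have sm: "strict_mono r" by (simp add: strict_mono_Suc_iff)
  have "(\<lambda>n. dist (rho (r n)) x) \<longlonglongrightarrow> 0"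
    using r(2) by (intro tendsto_sandwich[OF _ _ tendsto_const LIMSEQ_inverse_real_of_nat])
      (auto intro!: always_eventually less_imp_le)
  then have "(rho \<longlongrightarrow> x) (along (range r))"
    unfolding tendsto_along_range[OF strict_mono_imp_inj_on[OF sm]] by (subst tendsto_dist_iff)
  moreover have "infinite (range r)"
    by (intro range_inj_infinite strict_mono_imp_inj_on sm)
  ultimately show ?thesis using that r(1) by blast
qed

lemma clusters_tendsto:
  assumes "infinite H" "(rho \<longlongrightarrow> x) (along H)"
  shows "x \<in> clusters H"
  unfolding clusters_def
proof (intro CollectI allI impI notI)
  fix \<delta> :: real assume "\<delta> > 0" "finite {n \<in> H. dist (rho n) x < \<delta>}"
  moreover have "finite {n\<in>H. dist (rho n) x \<ge> \<delta>}"
    using assms(2) \<open>\<delta> > 0\<close> by (auto simp: tendsto_along_dist)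
  ultimately have "finite ({n \<in> H. dist (rho n) x < \<delta>} \<union> {n\<in>H. dist (rho n) x \<ge> \<delta>})"
    by simp
  moreover have "{n \<in> H. dist (rho n) x < \<delta>} \<union> {n\<in>H. dist (rho n) x \<ge> \<delta>} = H" by auto
  ultimately show False using assms(1) by simp
qed

lemma clusters_eq_empty: "finite H \<Longrightarrow> clusters H = {}"
  unfolding clusters_def using gt_ex[of "0::real"] by (auto intro: finite_subset)

lemma clusters_tendsto_subset:
  assumes "(rho \<longlongrightarrow> x) (along H)"
  shows "clusters H \<subseteq> {x}"
proof
  fix y assume "y \<in> clusters H"
  then obtain H' where "infinite H'" "H' \<subseteq> H" "(rho \<longlongrightarrow> y) (along H')" using clusters_along by blast
  moreover have "(rho \<longlongrightarrow> x) (along H')" using assms \<open>H' \<subseteq> H\<close> tendsto_along_mono by blast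
  ultimately show "y \<in> {x}" by (metis along_eq_bot_iff insertI1 tendsto_unique)
qed

lemma clusters_mono:
  assumes "A \<subseteq> B"
  shows "clusters A \<subseteq> clusters B"
proof -
  have "{n \<in> A. dist (rho n) x < \<delta>} \<subseteq> {n \<in> B. dist (rho n) x < \<delta>}" for x \<delta>
    using assms by blast
  then show ?thesis by (auto simp: clusters_def dest: finite_subset)
qed

lemma clusters_Un: "clusters (A \<union> B) = clusters A \<union> clusters B"
proof -
  have "x \<in> clusters A \<union> clusters B" if x: "x \<in> clusters (A \<union> B)" for x
  proof -
    obtain H where H: "infinite H" "H \<subseteq> A \<union> B" "(rho \<longlongrightarrow> x) (along H)"
      by (rule clusters_along[OF x])
    have "infinite (H \<inter> A) \<or> infinite (H \<inter> B)"
      using H(1,2) finite_subset[of H "(H \<inter> A) \<union> (H \<inter> B)"] by blast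
    then have "x \<in> clusters (H \<inter> A) \<or> x \<in> clusters (H \<inter> B)"
      using clusters_tendsto[OF _ tendsto_along_mono[OF H(3) Int_lower1]] by blast
    moreover have "clusters (H \<inter> A) \<subseteq> clusters A" "clusters (H \<inter> B) \<subseteq> clusters B"
      by (simp_all add: clusters_mono)
    ultimately show ?thesis by blast
  qed
  moreover have "clusters A \<union> clusters B \<subseteq> clusters (A \<union> B)"
    by (simp add: clusters_mono)
  ultimately show ?thesis by blast
qed

lemma infinite_along_rho:
  assumes "infinite H"
  obtains H' z where "infinite H'" "H' \<subseteq> H" "(rho \<longlongrightarrow> z) (along H')" "z \<in> {0..1}"
proof -
  have b: "bounded (rho ` H)" 
    using bounded_subset[OF bounded_closed_interval[of 0 1], of "rho ` H"] rho_mem by blast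
  obtain H' z where H': "infinite H'" "H' \<subseteq> H" "(rho \<longlongrightarrow> z) (along H')"
    by (rule bounded_convergent_along[OF assms b])
  have "z \<in> {0..1}"
    using Lim_in_closed_set[of "{0..1::real}" rho "along H'" z] H' rho_mem
    by (simp add: along_eq_bot_iff)
  then show ?thesis by (rule that[OF H'])
qed

lemma clusters_UNIV: "clusters UNIV = {0..1}"
proof (intro equalityI subsetI)
  fix x assume "x \<in> clusters UNIV"
  then obtain H where "infinite H" "(rho \<longlongrightarrow> x) (along H)" by (rule clusters_along)
  then show "x \<in> {0..1}" using Lim_in_closed_set[of "{0..1::real}" rho "along H" x] rho_mem
    by (simp add: along_eq_bot_iff)
next
  fix x :: real assume "x \<in> {0..1}"
  then show "x \<in> clusters UNIV" using infinite_rho_near by (simp add: clusters_def)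
qed

section \<open>Oscillation of matrix transforms\<close>

lemma infsum_tail_small:
  fixes f :: "nat \<Rightarrow> 'a::banach"
  assumes "f abs_summable_on UNIV" "e > 0"
  obtains L where "\<And>A. A \<inter> {..<L} = {} \<Longrightarrow> norm (infsum f A) < e"
proof -
  let ?g = "\<lambda>n. norm (f n)"
  have gs: "?g summable_on A" for A
    using assms(1) summable_on_subset_banach by blast
  have "(?g has_sum infsum ?g UNIV) UNIV" using assms(1) by (simp add: has_sum_infsum)
  then have "\<forall>\<^sub>F X in finite_subsets_at_top UNIV. dist (sum ?g X) (infsum ?g UNIV) < e"
    using assms(2) by (simp add: has_sum_def tendsto_iff)
  then obtain X where X: "finite X" "dist (sum ?g X) (infsum ?g UNIV) < e"
    by (auto simp: eventually_finite_subsets_at_top)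
  obtain L where L: "X \<subseteq> {..<L}" using X(1) finite_nat_iff_bounded by blast
  show ?thesis
  proof (rule that)
    fix A assume A: "A \<inter> {..<L} = {}"
    have "sum ?g X + infsum ?g A = infsum ?g (X \<union> A)"
      using A L X(1) gs by (subst infsum_Un_disjoint) auto
    also have "\<dots> \<le> infsum ?g UNIV"
      by (rule infsum_mono_neutral) (use gs in auto)
    finally have "infsum ?g A < e" using X(2) by (auto simp: dist_real_def)
    moreover have "norm (infsum f A) \<le> infsum ?g A"
      using gs by (intro norm_infsum_bound) auto
    ultimately show "norm (infsum f A) < e" by linarith
  qed
qed

lemma infsum_Un_Diff:
  fixes f :: "nat \<Rightarrow> 'a::banach"
  assumes "f abs_summable_on UNIV"
  shows "infsum f (A \<union> B) = infsum f A + infsum f (B - A)"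
proof -
  have "f summable_on C" for C
    using abs_summable_summable[OF assms] summable_on_subset_banach by blast
  then have "infsum f (A \<union> (B - A)) = infsum f A + infsum f (B - A)"
    by (intro infsum_Un_disjoint) auto
  then show ?thesis by simp
qed

text \<open>Adding \<open>F k\<close> to the set changes the value of row \<open>k\<close> by at least \<open>e\<close> but, for large \<open>k\<close>, that of
  row \<open>N\<close> by less than \<open>e / 4\<close>. So rows \<open>k\<close> and \<open>N\<close> are \<open>e / 4\<close> apart either with or without \<open>F k\<close>.\<close>

lemma oscillation_step:
  fixes a :: "nat \<Rightarrow> nat \<Rightarrow> 'a::banach"
  assumes sm: "\<And>k. a k abs_summable_on UNIV"
    and F: "\<And>k. finite (F k)" "\<And>k. F k \<inter> B = {}" "\<And>L. \<exists>K. \<forall>k\<ge>K. F k \<inter> {..<L} = {}"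
    and big: "\<And>k. norm (sum (a k) (F k)) \<ge> e" "e > 0"
    and W: "W \<subseteq> {..<L}" "W \<subseteq> \<Union>(range F)"
  shows "\<exists>W' L'. (W' \<subseteq> {..<L'} \<and> W' \<subseteq> \<Union>(range F)) \<and> W \<subseteq> W' \<and> L \<le> L' \<and> (W' - W) \<inter> {..<L} = {}
     \<and> (\<exists>k l. N \<le> k \<and> N \<le> l \<and> (\<forall>X. X \<inter> {..<L'} = {} \<longrightarrow>
        e / 8 \<le> dist (infsum (a k) (B \<union> (W' \<union> X))) (infsum (a l) (B \<union> (W' \<union> X)))))"
proof -
  let ?f = "\<lambda>k Y. infsum (a k) (B \<union> Y)"
  obtain L0 where L0: "\<And>A. A \<inter> {..<L0} = {} \<Longrightarrow> norm (infsum (a N) A) < e / 4"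
    using infsum_tail_small[OF sm[of N], of "e/4"] big(2) by (metis divide_pos_pos zero_less_numeral)
  \<comment> \<open>Beyond \<open>L\<close> the set \<open>F k\<close> is disjoint from
    \<open>W\<close>; beyond \<open>L0\<close> its contribution to row \<open>N\<close> is below
    \<open>e / 4\<close>.\<close>
  obtain K where K: "\<forall>k\<ge>K. F k \<inter> {..<max L L0} = {}" using F(3) by blast
  define k where "k = max K N"
  have Fk: "F k \<inter> {..<max L L0} = {}" using K by (simp add: k_def)
  have dis: "F k - (B \<union> W) = F k" using Fk W(1) F(2)[of k] by fastforce
  have add: "?f i (W \<union> F k) = ?f i W + sum (a i) (F k)" for i
    using infsum_Un_Diff[OF sm[of i], of "B \<union> W" "F k"] F(1) by (simp add: dis Un_assoc)
  have "norm (infsum (a N) (F k)) < e / 4" using Fk by (intro L0) auto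
  then have small: "norm (sum (a N) (F k)) < e / 4" using F(1) by simp
  have "\<exists>W'. (W' = W \<or> W' = W \<union> F k) \<and> e / 4 \<le> dist (?f k W') (?f N W')"
  proof (rule ccontr)
    assume "\<not> ?thesis"
    then have 1: "norm (?f k W - ?f N W) < e / 4" and 2: "norm (?f k (W \<union> F k) - ?f N (W \<union> F k)) < e / 4"
      by (auto simp: dist_norm not_le)
    have "sum (a k) (F k) = (?f k (W \<union> F k) - ?f N (W \<union> F k)) - (?f k W - ?f N W) + sum (a N) (F k)"
      by (simp add: add)
    also have "norm \<dots> \<le> norm (?f k (W \<union> F k) - ?f N (W \<union> F k)) + norm (?f k W - ?f N W) + norm (sum (a N) (F k))"
      by (meson add_right_mono norm_triangle_ineq norm_triangle_ineq4 order_trans)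
    finally show False using 1 2 small big(1)[of k] big(2) by linarith
  qed
  then obtain W' where W': "W' = W \<or> W' = W \<union> F k" "e / 4 \<le> dist (?f k W') (?f N W')" by blast
  \<comment> \<open>Later additions may move each of the two rows by less than
    \<open>e / 16\<close>, so of the distance \<open>e / 4\<close> at least \<open>e / 8\<close>
    survives.\<close>
  have e16: "e / 16 > 0" using big(2) by simp
  obtain Lk where Lk: "\<And>A. A \<inter> {..<Lk} = {} \<Longrightarrow> norm (infsum (a k) A) < e / 16"
    using infsum_tail_small[OF sm e16] by blast
  obtain LN where LN: "\<And>A. A \<inter> {..<LN} = {} \<Longrightarrow> norm (infsum (a N) A) < e / 16"
    using infsum_tail_small[OF sm e16] by blast
  have "finite W'" using W'(1) F(1) W(1) finite_subset[OF W(1)] by auto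
  then obtain LW where LW: "W' \<subseteq> {..<LW}" using finite_nat_iff_bounded by blast
  define L' where "L' = Max {L, Lk, LN, LW}"
  have L': "L \<le> L'" "Lk \<le> L'" "LN \<le> L'" "LW \<le> L'" by (auto simp: L'_def)
  have tail: "e / 8 \<le> dist (?f k (W' \<union> X)) (?f N (W' \<union> X))" if X: "X \<inter> {..<L'} = {}" for X
  proof -
    have "norm (infsum (a k) (X - (B \<union> W'))) < e / 16" using X L' by (intro Lk) fastforce
    moreover have "norm (infsum (a N) (X - (B \<union> W'))) < e / 16" using X L' by (intro LN) fastforce
    moreover have "?f i (W' \<union> X) = ?f i W' + infsum (a i) (X - (B \<union> W'))" for i
      using infsum_Un_Diff[OF sm[of i], of "B \<union> W'" X] by (simp add: Un_assoc)
    ultimately have "dist (?f k (W' \<union> X)) (?f k W') < e / 16" "dist (?f N (W' \<union> X)) (?f N W') < e / 16"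
      by (simp_all add: dist_norm)
    then show "e / 8 \<le> dist (?f k (W' \<union> X)) (?f N (W' \<union> X))"
      using W'(2) dist_triangle[of "?f k W'" "?f N W'" "?f k (W' \<union> X)"]
        dist_triangle[of "?f k (W' \<union> X)" "?f N W'" "?f N (W' \<union> X)"]
      by (simp add: dist_commute)
  qed
  show ?thesis
  proof (rule exI[of _ W'], rule exI[of _ L'], intro conjI)
    show "W' \<subseteq> {..<L'}" using LW L'(4) by auto
    show "W' \<subseteq> \<Union>(range F)" using W' W by auto
    show "(W' - W) \<inter> {..<L} = {}" using W'(1) Fk by auto
    show "\<exists>k l. N \<le> k \<and> N \<le> l \<and> (\<forall>X. X \<inter> {..<L'} = {} \<longrightarrow> e / 8 \<le> dist (?f k (W' \<union> X)) (?f l (W' \<union> X)))"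
      using tail by (intro exI[of _ k] exI[of _ N]) (simp add: k_def)
  qed (use W'(1) L'(1) in auto)
qed

text \<open>A gliding hump. Stage \<open>n\<close> fixes a finite set and a bound beyond which all
  later additions lie, and leaves two rows with index at least \<open>n\<close> that stay
  \<open>e / 8\<close> apart whatever is added beyond the bound. For the union of the stages the row
  values are therefore not Cauchy. The background \<open>B\<close> is present from the
  start.\<close>

lemma oscillation:
  fixes a :: "nat \<Rightarrow> nat \<Rightarrow> 'a::banach"
  assumes sm: "\<And>k. a k abs_summable_on UNIV"
    and F: "\<And>k. finite (F k)" "\<And>k. F k \<inter> B = {}" "\<And>L. \<exists>K. \<forall>k\<ge>K. F k \<inter> {..<L} = {}"
    and big: "\<And>k. norm (sum (a k) (F k)) \<ge> e" "e > 0"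
  obtains A where "A \<subseteq> \<Union>(range F)" "\<not> convergent (\<lambda>k. infsum (a k) (B \<union> A))"
proof -
  define P where "P = (\<lambda>(n::nat) (W, L). W \<subseteq> {..<L} \<and> W \<subseteq> \<Union>(range F))"
  define Q where "Q = (\<lambda>N (W, L) (W', L'). W \<subseteq> W' \<and> L \<le> L' \<and> (W' - W) \<inter> {..<L::nat} = {}
     \<and> (\<exists>k l. N \<le> k \<and> N \<le> l \<and> (\<forall>X. X \<inter> {..<L'} = {} \<longrightarrow>
        e / 8 \<le> dist (infsum (a k) (B \<union> (W' \<union> X))) (infsum (a l) (B \<union> (W' \<union> X))))))"
  have "\<exists>s. \<forall>n. P n (s n) \<and> Q n (s n) (s (Suc n))"
  proof (rule dependent_nat_choice)
    show "\<exists>x. P 0 x" by (intro exI[of _ "({}, 0)"]) (simp add: P_def)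
    show "\<exists>y. P (Suc n) y \<and> Q n x y" if x: "P n x" for x n
    proof -
      obtain W L where WL: "x = (W, L)" by force
      with x have "W \<subseteq> {..<L}" "W \<subseteq> \<Union>(range F)" by (auto simp: P_def)
      then have "\<exists>W' L'. P (Suc n) (W', L') \<and> Q n x (W', L')"
        unfolding P_def Q_def WL split by (rule oscillation_step[of a F B e W L n, OF sm F big])
      then show ?thesis by blast
    qed
  qed
  then obtain s where s: "\<And>n. P n (s n)" "\<And>n. Q n (s n) (s (Suc n))" by blast
  define W where "W n = fst (s n)" for n
  define L where "L n = snd (s n)" for n
  have sW: "s n = (W n, L n)" for n by (simp add: W_def L_def)
  have P: "W n \<subseteq> \<Union>(range F)" for n using s(1)[of n] unfolding sW P_def by blast
  have Q: "W n \<subseteq> W (Suc n)" "L n \<le> L (Suc n)" "(W (Suc n) - W n) \<inter> {..<L n} = {}"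
    "\<exists>k l. n \<le> k \<and> n \<le> l \<and> (\<forall>X. X \<inter> {..<L (Suc n)} = {} \<longrightarrow>
        e / 8 \<le> dist (infsum (a k) (B \<union> (W (Suc n) \<union> X))) (infsum (a l) (B \<union> (W (Suc n) \<union> X))))" for n
    using s(2)[of n] unfolding sW Q_def split by blast+
  have tail: "(W (n + m) - W n) \<inter> {..<L n} = {} \<and> L n \<le> L (n + m) \<and> W n \<subseteq> W (n + m)" for n m
  proof (induction m)
    case (Suc m)
    then show ?case using Q(1-3)[of "n + m"] by fastforce
  qed simp
  define A where "A = (\<Union>n. W n)"
  have Aeq: "A = W n \<union> (A - W n)" for n by (auto simp: A_def)
  have Atail: "(A - W n) \<inter> {..<L n} = {}" for n
  proof -
    have "m \<notin> {..<L n}" if "m \<in> W i" "m \<notin> W n" for m i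
    proof (cases "n \<le> i")
      case True
      then show ?thesis using tail[of n "i - n"] that by auto
    next
      case False
      then show ?thesis using tail[of i "n - i"] that by auto
    qed
    then show ?thesis by (auto simp: A_def)
  qed
  have "\<not> convergent (\<lambda>k. infsum (a k) (B \<union> A))"
  proof
    assume "convergent (\<lambda>k. infsum (a k) (B \<union> A))"
    then have "Cauchy (\<lambda>k. infsum (a k) (B \<union> A))" by (rule convergent_Cauchy)
    then obtain N where N: "\<And>k l. k \<ge> N \<Longrightarrow> l \<ge> N \<Longrightarrow> dist (infsum (a k) (B \<union> A)) (infsum (a l) (B \<union> A)) < e / 8"
      using big(2) unfolding Cauchy_def by (metis divide_pos_pos zero_less_numeral)
    obtain k l where "N \<le> k" "N \<le> l" "e / 8 \<le> dist (infsum (a k) (B \<union> (W (Suc N) \<union> (A - W (Suc N)))))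
        (infsum (a l) (B \<union> (W (Suc N) \<union> (A - W (Suc N)))))"
      using Q(4)[of N] Atail[of "Suc N"] by blast
    then show False using N[of k l] Aeq[of "Suc N"] by simp
  qed
  moreover have "A \<subseteq> \<Union>(range F)" using P by (auto simp: A_def)
  ultimately show ?thesis using that by blast
qed

section \<open>Exceptional points of a matrix and sets that kill it\<close>

text \<open>The condition on \<open>n\<close> leaves out the diagonal entry, and \<open>G\<close>
  stands for the rows and columns already spent in a recursive choice. Only the columns are required
  to be near \<open>x\<close>; the rows may cluster anywhere.\<close>

definition offdiag_points :: "(nat \<Rightarrow> nat \<Rightarrow> 'k::real_normed_vector) \<Rightarrow> real \<Rightarrow> real set" where
  "offdiag_points M e = {x. \<forall>\<delta>>0. \<forall>G. finite G \<longrightarrow> (\<exists>F n. finite F \<and> F \<subseteq> {m. dist (rho m) x < \<delta>} \<and>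
     F \<inter> G = {} \<and> n \<notin> F \<union> G \<and> e \<le> norm (sum (M n) F))}"

text \<open>In this and the next two definitions the thresholds
  \<open>inverse (real (Suc j))\<close> make the set a countable union of closed sets. If it is
  uncountable, then so is one of the closed pieces, and \<open>exists_fresh\<close> applies to that
  piece.\<close>

definition column_clusters :: "(nat \<Rightarrow> nat \<Rightarrow> 'k::real_normed_vector) \<Rightarrow> real set" where
  "column_clusters M = (\<Union>m j. clusters {n. inverse (real (Suc j)) \<le> norm (M n m)})"

definition offdiag_set :: "(nat \<Rightarrow> nat \<Rightarrow> 'k::real_normed_vector) \<Rightarrow> real set" where
  "offdiag_set M = (\<Union>j. offdiag_points M (inverse (real (Suc j))))"

definition diag_clusters :: "(nat \<Rightarrow> nat \<Rightarrow> 'k::real_normed_vector) \<Rightarrow> 'k \<Rightarrow> real set" where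
  "diag_clusters M l = (\<Union>j. clusters {n. inverse (real (Suc j)) \<le> dist (M n n) l})"

text \<open>Here \<open>U\<close> is the set of points already used and \<open>\<U>\<close> the family already built. Divergence along
  \<open>E\<close> is final in both cases: functions in \<open>C0K\<close> of the family converge along subsets of its members,
  and a set \<open>E\<close> that converges to a used point is almost disjoint from every later member as well.\<close>

definition kills :: "(nat \<Rightarrow> nat \<Rightarrow> 'k::banach) \<Rightarrow> real set \<Rightarrow> nat set set \<Rightarrow> nat set \<Rightarrow> bool" where
  "kills M U \<U> A \<longleftrightarrow> (\<exists>E. (\<nexists>l. ((\<lambda>n. infsum (M n) A) \<longlongrightarrow> l) (along E)) \<and>
     ((\<exists>B\<in>insert A \<U>. E \<subseteq> B) \<or>
      (\<exists>y\<in>U. (rho \<longlongrightarrow> y) (along E)) \<and> (\<forall>B\<in>insert A \<U>. finite (E \<inter> B))))"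

lemma closed_offdiag_points: "closed (offdiag_points M e)"
  unfolding closed_sequential_limits
proof (intro allI impI, elim conjE)
  fix x l assume x: "\<forall>n. x n \<in> offdiag_points M e" "x \<longlonglongrightarrow> l"
  show "l \<in> offdiag_points M e" unfolding offdiag_points_def
  proof (intro CollectI allI impI)
    fix \<delta> :: real and G :: "nat set" assume d: "\<delta> > 0" and G: "finite G"
    then obtain n where n: "dist (x n) l < \<delta>/2"
      using x(2) by (metis half_gt_zero lim_sequentially order_refl)
    have "x n \<in> offdiag_points M e" using x(1) by blast
    then obtain F k where Fk: "finite F" "F \<subseteq> {m. dist (rho m) (x n) < \<delta>/2}" "F \<inter> G = {}" "k \<notin> F \<union> G"
      "e \<le> norm (sum (M k) F)"
      using half_gt_zero[OF d] G unfolding offdiag_points_def by blast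
    have "dist (rho m) l < \<delta>" if "dist (rho m) (x n) < \<delta>/2" for m
      using dist_triangle[of "rho m" l "x n"] that n by linarith
    then have "F \<subseteq> {m. dist (rho m) l < \<delta>}" using Fk(2) by blast
    with Fk show "\<exists>F n. finite F \<and> F \<subseteq> {m. dist (rho m) l < \<delta>} \<and>
     F \<inter> G = {} \<and> n \<notin> F \<union> G \<and> e \<le> norm (sum (M n) F)" by blast
  qed
qed

text \<open>The closed set has the cardinality of the continuum, while \<open>U\<close> and the
  countable \<open>Z\<close> together have a smaller one. In the recursion \<open>U\<close> holds
  the points already used and \<open>Z\<close> the exceptional points of a matrix.\<close>

lemma exists_fresh:
  fixes C :: "real set"
  assumes "closed C" "uncountable C" "|U| <o |UNIV :: nat set set|" "countable Z"
  obtains x where "x \<in> C" "x \<notin> U" "x \<notin> Z"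
proof -
  have "(UNIV :: nat set set) \<lesssim> C" by (rule uncountable_closed_lepoll[OF assms(1,2)])
  then have C: "|UNIV :: nat set set| \<le>o |C|" unfolding lepoll_def using card_of_ordLeq by blast
  have inf: "infinite (UNIV :: nat set set)" by (simp add: Finite_Set.finite_set)
  have "|Z| \<le>o |UNIV :: nat set|"
    using assms(4) card_of_ordLeq[of Z "UNIV :: nat set"] by (auto simp: countable_def)
  then have "|Z| <o |UNIV :: nat set set|"
    by (rule ordLeq_ordLess_trans) (use card_of_Pow[of "UNIV :: nat set"] in simp)
  then have "|U \<union> Z| <o |UNIV :: nat set set|"
    by (rule card_of_Un_ordLess_infinite[OF inf assms(3)])
  then have "|U \<union> Z| <o |C|" by (rule ordLess_ordLeq_trans[OF _ C])
  then have "\<not> C \<subseteq> U \<union> Z" using card_of_mono1[of C "U \<union> Z"] not_ordLess_ordLeq by auto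
  then show ?thesis using that by blast
qed

lemma offdiag_points_sequence:
  assumes "x \<in> offdiag_points M e"
  obtains F :: "nat \<Rightarrow> nat set" and \<nu> :: "nat \<Rightarrow> nat" where
    "\<And>k. finite (F k)" "\<And>k. F k \<subseteq> {m. dist (rho m) x < inverse (real (Suc k))}"
    "\<And>k. e \<le> norm (sum (M (\<nu> k)) (F k))" "inj \<nu>" "\<And>i j. \<nu> i \<notin> F j"
    "\<And>i j. i \<noteq> j \<Longrightarrow> F i \<inter> F j = {}"
proof -
  \<comment> \<open>The third component collects every row and column index used so far. Choosing
    the next row and columns outside it yields injectivity of \<open>\<nu>\<close>, disjointness of
    the \<open>F k\<close>, and \<open>\<nu> i \<notin> F j\<close> in both orders of
    \<open>i\<close> and \<open>j\<close>.\<close>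
  define P where "P = (\<lambda>k (F, n, G). finite F \<and> finite G \<and> F \<subseteq> {m. dist (rho m) x < inverse (real (Suc k))}
     \<and> e \<le> norm (sum (M n) F) \<and> n \<notin> F \<and> insert n F \<subseteq> G)"
  define Q where "Q = (\<lambda>(k::nat) (F::nat set, n::nat, G::nat set) (F'::nat set, n'::nat, G'). F' \<inter> G = {} \<and> n' \<notin> G \<and> G \<subseteq> G')"
  have ex: "\<exists>s. P k s \<and> Q k (F, n, G) s" if G: "finite G" for F :: "nat set" and n :: nat and G k
  proof -
    obtain F' n' where "finite F'" "F' \<subseteq> {m. dist (rho m) x < inverse (real (Suc k))}" "F' \<inter> G = {}"
      "n' \<notin> F' \<union> G" "e \<le> norm (sum (M n') F')"
      using assms[unfolded offdiag_points_def, simplified, rule_format, OF _ G, of "inverse (real (Suc k))"] by auto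
    with G have "P k (F', n', insert n' (F' \<union> G)) \<and> Q k (F, n, G) (F', n', insert n' (F' \<union> G))"
      unfolding P_def Q_def split by blast
    then show ?thesis ..
  qed
  have "\<exists>s. \<forall>n. P n (s n) \<and> Q (Suc n) (s n) (s (Suc n))"
  proof (rule dependent_nat_choice)
    show "\<exists>s. P 0 s" using ex[of "{}" 0] by blast
    show "\<exists>y. P (Suc n) y \<and> Q (Suc n) s y" if "P n s" for s n
      using that ex[of "snd (snd s)" "Suc n" "fst s" "fst (snd s)"] by (cases s) (auto simp: P_def)
  qed
  then obtain s where s: "\<And>n. P n (s n)" "\<And>n. Q (Suc n) (s n) (s (Suc n))" by blast
  define F where "F n = fst (s n)" for n
  define \<nu> where "\<nu> n = fst (snd (s n))" for n
  define G where "G n = snd (snd (s n))" for n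
  have ss: "s n = (F n, \<nu> n, G n)" for n by (simp add: F_def \<nu>_def G_def)
  have P: "finite (F k)" "F k \<subseteq> {m. dist (rho m) x < inverse (real (Suc k))}"
    "e \<le> norm (sum (M (\<nu> k)) (F k))" "\<nu> k \<notin> F k" "insert (\<nu> k) (F k) \<subseteq> G k" for k
    using s(1)[of k] unfolding ss P_def split by blast+
  have Q: "F (Suc k) \<inter> G k = {}" "\<nu> (Suc k) \<notin> G k" "G k \<subseteq> G (Suc k)" for k
    using s(2)[of k] unfolding ss Q_def split by blast+
  have G: "G i \<subseteq> G j" if "i \<le> j" for i j using Q(3) that lift_Suc_mono_le by blast
  have lt: "F j \<inter> G i = {} \<and> \<nu> j \<notin> G i" if "i < j" for i j
  proof -
    obtain k where "j = Suc k" "i \<le> k" using \<open>i < j\<close> by (metis less_Suc_eq_le less_imp_Suc_add le_add1 less_eq_Suc_le Suc_le_D)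
    then show ?thesis using Q(1,2)[of k] G[of i k] by blast
  qed
  show ?thesis
  proof (rule that[of F \<nu>])
    show "inj \<nu>"
    proof (rule injI, rule ccontr)
      fix i j assume "\<nu> i = \<nu> j" "i \<noteq> j"
      then show False using lt[of i j] lt[of j i] P(5)[of i] P(5)[of j] by (metis insert_subset linorder_neqE_nat)
    qed
    show "\<nu> i \<notin> F j" for i j
      using lt[of i j] lt[of j i] P(4,5)[of i] P(5)[of j] by (cases i j rule: linorder_cases) blast+
    show "F i \<inter> F j = {}" if "i \<noteq> j" for i j
      using lt[of i j] lt[of j i] P(5)[of i] P(5)[of j] that by (cases i j rule: linorder_cases) blast+
  qed (use P in auto)
qed

lemma eventually_avoids:
  fixes F :: "nat \<Rightarrow> nat set"
  assumes "\<And>i j. i \<noteq> j \<Longrightarrow> F i \<inter> F j = {}"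
  shows "\<exists>K. \<forall>k\<ge>K. F k \<inter> {..<L} = {}"
proof -
  have fin: "finite {k. m \<in> F k}" for m
  proof (cases "\<exists>i. m \<in> F i")
    case True
    then obtain i where "m \<in> F i" by blast
    then have "{k. m \<in> F k} \<subseteq> {i}" using assms by blast
    then show ?thesis using finite_subset by blast
  qed auto
  then have "finite (\<Union>m<L. {k. m \<in> F k})" by blast
  then obtain K where "(\<Union>m<L. {k. m \<in> F k}) \<subseteq> {..<K}" using finite_nat_iff_bounded by blast
  then show ?thesis by (intro exI[of _ K]) fastforce
qed

text \<open>If the rows \<open>\<nu> k\<close> cluster at a fresh point \<open>y\<close>, then they are included in the new set, which thus
  accumulates at \<open>x\<close> and \<open>y\<close>. Otherwise no member may accumulate at \<open>y\<close> any more.\<close>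

lemma exists_kill_offdiag:
  fixes M :: "nat \<Rightarrow> nat \<Rightarrow> 'k::banach"
  assumes sm: "\<And>n. M n abs_summable_on UNIV" and x: "x \<in> offdiag_points M e" "x \<notin> U" and e: "e > 0"
  shows "\<exists>A p q. p \<notin> U \<and> q \<notin> U \<and> infinite A \<and> clusters A \<subseteq> {p, q} \<and> kills M U \<U> A"
proof -
  obtain F \<nu> where F: "\<And>k. finite (F k)" "\<And>k. F k \<subseteq> {m. dist (rho m) x < inverse (real (Suc k))}"
    "\<And>k. e \<le> norm (sum (M (\<nu> k)) (F k))" "inj \<nu>" "\<And>i j. \<nu> i \<notin> F j" "\<And>i j. i \<noteq> j \<Longrightarrow> F i \<inter> F j = {}"
    using offdiag_points_sequence[OF x(1)] by blast
  define D where "D = \<Union>(range F)"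
  have "infinite (range \<nu>)" using F(4) by (rule range_inj_infinite)
  then obtain E0 y where E0: "infinite E0" "E0 \<subseteq> range \<nu>" "(rho \<longlongrightarrow> y) (along E0)"
    by (rule infinite_along_rho)
  \<comment> \<open>This settles the position of the rows relative to the earlier members. For
    \<open>y \<in> U\<close>, the set \<open>E \<subseteq> E1\<close> is of the first kind in
    \<open>kills\<close> if \<open>E1\<close> lies in a member, and of the second kind
    otherwise.\<close>
  obtain E1 where E1: "infinite E1" "E1 \<subseteq> E0" "(\<exists>B\<in>\<U>. E1 \<subseteq> B) \<or> (\<forall>B\<in>\<U>. finite (E1 \<inter> B))"
  proof (cases "\<exists>B\<in>\<U>. infinite (E0 \<inter> B)")
    case True
    then show ?thesis using that by (metis Int_lower1 Int_lower2)
  next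
    case False
    then show ?thesis using that E0 by blast
  qed
  define I where "I = {k. \<nu> k \<in> E1}"
  have "E1 = \<nu> ` I" using E1 E0 by (auto simp: I_def)
  then have "infinite I" using E1(1) by auto
  define r where "r = enumerate I"
  have r: "strict_mono r" "\<And>k. \<nu> (r k) \<in> E1"
    using \<open>infinite I\<close> enumerate_in_set[of I] by (auto simp: r_def strict_mono_enumerate I_def)
  \<comment> \<open>The pieces with even number drive the oscillation. Those with odd number form
    \<open>B0\<close>, which is put into the new set when the rows are not: the part
    \<open>A'\<close> obtained from the oscillation might be finite, and the new set has to be
    infinite.\<close>
  define \<mu> where "\<mu> k = \<nu> (r (2 * k))" for k
  define F1 where "F1 k = F (r (2 * k))" for k
  define E where "E = range \<mu>"
  have inj: "inj \<mu>" 
    by (auto simp: inj_def \<mu>_def inj_eq[OF F(4)] strict_mono_eq[OF r(1)])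
  have EE1: "E \<subseteq> E1" using r(2) by (auto simp: E_def \<mu>_def)
  have rhoE: "(rho \<longlongrightarrow> y) (along E)" using E0(3) EE1 E1(2) tendsto_along_mono by blast
  define B0 where "B0 = (\<Union>k. F (r (2 * k + 1)))"
  define B where "B = (if y \<in> U then B0 else E)"
  have F1: "\<And>k. finite (F1 k)" "\<And>i j. i \<noteq> j \<Longrightarrow> F1 i \<inter> F1 j = {}"
    using F(1,6) r(1) by (auto simp: F1_def strict_mono_eq)
  have "r (2 * k) \<noteq> r (2 * j + 1)" for k j unfolding strict_mono_eq[OF r(1)] by presburger
  then have "F (r (2 * k)) \<inter> F (r (2 * j + 1)) = {}" for k j using F(6) by blast
  then have F1B: "F1 k \<inter> B = {}" for k
    using F(5) unfolding F1_def B_def B0_def E_def \<mu>_def by (cases "y \<in> U") fastforce+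
  obtain A' where A': "A' \<subseteq> \<Union>(range F1)" "\<not> convergent (\<lambda>k. infsum (M (\<mu> k)) (B \<union> A'))"
  proof (rule oscillation[of "\<lambda>k. M (\<mu> k)" F1 B e])
    show "\<exists>K. \<forall>k\<ge>K. F1 k \<inter> {..<L} = {}" for L using eventually_avoids[of F1] F1(2) by blast
  qed (use sm F1 F1B F(3) e in \<open>auto simp: \<mu>_def F1_def\<close>)
  define A where "A = B \<union> A'"
  have nc: "\<nexists>l. ((\<lambda>n. infsum (M n) A) \<longlongrightarrow> l) (along E)"
    using A'(2) unfolding E_def tendsto_along_range[OF inj] A_def convergent_def by blast
  have "A' \<subseteq> D" using A'(1) by (auto simp: D_def F1_def)
  have rhoD: "(rho \<longlongrightarrow> x) (along D)"
    unfolding tendsto_along_dist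
  proof (intro allI impI)
    fix d :: real assume "d > 0"
    then obtain N where N: "inverse (real (Suc N)) < d" using reals_Archimedean by blast
    have "m \<in> (\<Union>k<N. F k)" if m: "m \<in> D" "d \<le> dist (rho m) x" for m
    proof -
      obtain k where k: "m \<in> F k" using m(1) by (auto simp: D_def)
      have "k < N"
      proof (rule ccontr)
        assume "\<not> k < N"
        then have "inverse (real (Suc k)) \<le> inverse (real (Suc N))" by (simp add: field_simps)
        moreover have "dist (rho m) x < inverse (real (Suc k))" using F(2) k by blast
        ultimately show False using N m(2) by linarith
      qed
      then show ?thesis using k by blast
    qed
    then have "{n\<in>D. d \<le> dist (rho n) x} \<subseteq> (\<Union>k<N. F k)" by blast
    then show "finite {n\<in>D. d \<le> dist (rho n) x}" using F(1) by (auto intro: finite_subset)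
  qed
  have clD: "clusters D \<subseteq> {x}" using clusters_tendsto_subset rhoD by blast
  have ED: "E \<inter> D = {}" using F(5) by (auto simp: E_def \<mu>_def D_def)
  show ?thesis
  proof (cases "y \<in> U")
    case False
    then have "B = E" by (simp add: B_def)
    have "clusters A \<subseteq> {x, y}"
      using clusters_tendsto_subset[OF rhoE] clD clusters_mono[OF \<open>A' \<subseteq> D\<close>] 
      unfolding A_def \<open>B = E\<close> clusters_Un by blast
    moreover have "infinite A" using inj by (auto simp: A_def \<open>B = E\<close> E_def range_inj_infinite)
    moreover have "kills M U \<U> A" unfolding kills_def using nc \<open>B = E\<close> A_def by blast
    ultimately show ?thesis using x(2) False by blast
  next
    case True
    then have "B = B0" by (simp add: B_def)
    have "A \<subseteq> D" using \<open>A' \<subseteq> D\<close> by (auto simp: A_def \<open>B = B0\<close> B0_def D_def)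
    have "clusters A \<subseteq> {x, x}" using clD clusters_mono[OF \<open>A \<subseteq> D\<close>] by blast
    moreover have "infinite B0"
    proof -
      have "F k \<noteq> {}" for k using F(3)[of k] e by auto
      moreover have "disjoint_family (\<lambda>k. F (r (2 * k + 1)))"
        using F(6) r(1) by (auto simp: disjoint_family_on_def strict_mono_eq)
      ultimately show ?thesis unfolding B0_def
        using infinite_disjoint_family_imp_infinite_UNION[of UNIV "\<lambda>k. F (r (2 * k + 1))"] by simp
    qed
    moreover have "kills M U \<U> A"
    proof -
      have "finite (E \<inter> A)" using ED \<open>A \<subseteq> D\<close> by (metis disjoint_iff finite.emptyI subset_iff)
      moreover have "finite (E \<inter> C)" if "finite (E1 \<inter> C)" for C
        using that EE1 by (metis Int_mono finite_subset order_refl)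
      ultimately show ?thesis unfolding kills_def using nc E1(3) EE1 rhoE True by blast
    qed
    ultimately show ?thesis using x(2) by (metis A_def \<open>B = B0\<close> infinite_Un)
  qed
qed

text \<open>By compactness of the interval an infinite intersection would have a cluster point,
  common to both sets. All almost disjointness in the construction comes from here.\<close>

lemma finite_Int_if_clusters_disjoint:
  assumes "clusters H \<inter> clusters B = {}"
  shows "finite (H \<inter> B)"
proof (rule ccontr)
  assume "infinite (H \<inter> B)"
  then obtain H' z where H': "infinite H'" "H' \<subseteq> H \<inter> B" "(rho \<longlongrightarrow> z) (along H')"
    by (rule infinite_along_rho)
  have "z \<in> clusters H'" using clusters_tendsto[OF H'(1,3)] .
  moreover have "clusters H' \<subseteq> clusters H" "clusters H' \<subseteq> clusters B"
    using H'(2) by (auto intro!: clusters_mono)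
  ultimately show False using assms by blast
qed

lemma column_tendsto:
  assumes "clusters H \<inter> column_clusters M = {}"
  shows "((\<lambda>n. M n m) \<longlongrightarrow> 0) (along H)"
  unfolding tendsto_along_dist
proof (intro allI impI)
  fix e :: real assume "e > 0"
  then obtain j where j: "inverse (real (Suc j)) < e" using reals_Archimedean by blast
  have "finite (H \<inter> {n. inverse (real (Suc j)) \<le> norm (M n m)})"
    using assms by (intro finite_Int_if_clusters_disjoint) (auto simp: column_clusters_def)
  then show "finite {n \<in> H. e \<le> dist (M n m) 0}"
    by (rule rev_finite_subset) (use j in auto)
qed

lemma diag_tendsto:
  assumes "clusters H \<inter> diag_clusters M l = {}"
  shows "((\<lambda>n. M n n) \<longlongrightarrow> l) (along H)"
  unfolding tendsto_along_dist
proof (intro allI impI)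
  fix e :: real assume "e > 0"
  then obtain j where j: "inverse (real (Suc j)) < e" using reals_Archimedean by blast
  have "finite (H \<inter> {n. inverse (real (Suc j)) \<le> dist (M n n) l})"
    using assms by (intro finite_Int_if_clusters_disjoint) (auto simp: diag_clusters_def)
  then show "finite {n \<in> H. e \<le> dist (M n n) l}"
    by (rule rev_finite_subset) (use j in auto)
qed

lemma finite_away_from_clusters:
  assumes "clusters A \<subseteq> S" "\<delta> > 0"
  shows "finite {m \<in> A. \<forall>p\<in>S. \<delta> \<le> dist (rho m) p}"
proof (rule ccontr)
  assume "infinite {m \<in> A. \<forall>p\<in>S. \<delta> \<le> dist (rho m) p}"
  then obtain H z where H: "infinite H" "H \<subseteq> {m \<in> A. \<forall>p\<in>S. \<delta> \<le> dist (rho m) p}" "(rho \<longlongrightarrow> z) (along H)"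
    by (rule infinite_along_rho)
  have "z \<in> clusters H" using clusters_tendsto[OF H(1,3)] .
  moreover have "clusters H \<subseteq> clusters A" using H(2) by (intro clusters_mono) blast
  ultimately have "z \<in> S" using assms(1) by blast
  have "infinite {n\<in>H. dist (rho n) z < \<delta>}" using \<open>z \<in> clusters H\<close> assms(2) by (auto simp: clusters_def)
  then obtain n where "n \<in> H" "dist (rho n) z < \<delta>" by (metis (mono_tags, lifting) Collect_empty_eq finite.emptyI)
  then show False using H(2) \<open>z \<in> S\<close> by fastforce
qed

lemma infsum_finite_approx:
  fixes f :: "nat \<Rightarrow> 'a::banach"
  assumes "f abs_summable_on UNIV" "e > 0"
  obtains F where "finite F" "F \<subseteq> A" "norm (infsum f A - sum f F) < e"
proof -
  obtain L where L: "\<And>B. B \<inter> {..<L} = {} \<Longrightarrow> norm (infsum f B) < e"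
    using infsum_tail_small[OF assms] by blast
  have "infsum f ((A \<inter> {..<L}) \<union> (A - {..<L})) = infsum f (A \<inter> {..<L}) + infsum f ((A - {..<L}) - A \<inter> {..<L})"
    by (rule infsum_Un_Diff[OF assms(1)])
  moreover have "(A \<inter> {..<L}) \<union> (A - {..<L}) = A" "(A - {..<L}) - A \<inter> {..<L} = A - {..<L}" by auto
  ultimately have "infsum f A - sum f (A \<inter> {..<L}) = infsum f (A - {..<L})" by simp
  moreover have "norm (infsum f (A - {..<L})) < e" by (rule L) auto
  ultimately show ?thesis using that[of "A \<inter> {..<L}"] by simp
qed

lemma not_offdiag_pointsE:
  assumes "x \<notin> offdiag_points M c"
  obtains \<delta> G where "\<delta> > 0" "finite G"
    "\<And>F n. finite F \<Longrightarrow> F \<subseteq> {m. dist (rho m) x < \<delta>} \<Longrightarrow> F \<inter> G = {} \<Longrightarrow> n \<notin> F \<union> G \<Longrightarrow> norm (sum (M n) F) < c"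
proof -
  from assms obtain \<delta> where "\<delta> > 0" and *: "\<not> (\<forall>G. finite G \<longrightarrow> (\<exists>F n. finite F \<and> F \<subseteq> {m. dist (rho m) x < \<delta>} \<and>
        F \<inter> G = {} \<and> n \<notin> F \<union> G \<and> c \<le> norm (sum (M n) F)))"
    unfolding offdiag_points_def by blast
  from * obtain G where "finite G" and **: "\<not> (\<exists>F n. finite F \<and> F \<subseteq> {m. dist (rho m) x < \<delta>} \<and>
        F \<inter> G = {} \<and> n \<notin> F \<union> G \<and> c \<le> norm (sum (M n) F))"
    by blast
  show ?thesis
  proof (rule that[OF \<open>\<delta> > 0\<close> \<open>finite G\<close>], rule ccontr)
    fix F n assume F: "finite F" "F \<subseteq> {m. dist (rho m) x < \<delta>}" "F \<inter> G = {}" "n \<notin> F \<union> G"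
      and "\<not> norm (sum (M n) F) < c"
    then have "c \<le> norm (sum (M n) F)" by simp
    with F ** show False by blast
  qed
qed

text \<open>Each column tends to 0 along \<open>H\<close>, so a finite set \<open>G\<close> of
  columns is negligible. If \<open>G\<close> contains the elements of \<open>A\<close> far from both
  points and the exceptions attached to each point, the rest of \<open>A\<close> splits into a part
  near \<open>p\<close> and a part near \<open>q\<close> with finite sums below \<open>c\<close>.
  The budget is \<open>e / 4\<close> for \<open>G\<close>, \<open>e / 4\<close> for the passage to
  finite sums, and \<open>e / 4\<close> for each point.\<close>

lemma offdiag_tendsto:
  fixes M :: "nat \<Rightarrow> nat \<Rightarrow> 'k::banach"
  assumes sm: "\<And>n. M n abs_summable_on UNIV"
    and A: "clusters A \<subseteq> {p, q}" "p \<notin> offdiag_set M" "q \<notin> offdiag_set M"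
    and H: "clusters H \<inter> column_clusters M = {}"
  shows "((\<lambda>n. infsum (M n) (A - {n})) \<longlongrightarrow> 0) (along H)"
  unfolding tendsto_along_dist
proof (intro allI impI, rule ccontr)
  fix e :: real assume e: "e > 0" and inf: "infinite {n \<in> H. e \<le> dist (infsum (M n) (A - {n})) 0}"
  have "e / 4 > 0" using e by simp
  then obtain j where j: "inverse (real (Suc j)) < e / 4" using reals_Archimedean by blast
  define c where "c = inverse (real (Suc j))"
  have "p \<notin> offdiag_points M c" "q \<notin> offdiag_points M c" using A by (auto simp: offdiag_set_def c_def)
  obtain \<delta>1 G1 where 1: "\<delta>1 > 0" "finite G1"
    "\<And>F n. finite F \<Longrightarrow> F \<subseteq> {m. dist (rho m) p < \<delta>1} \<Longrightarrow> F \<inter> G1 = {} \<Longrightarrow> n \<notin> F \<union> G1 \<Longrightarrow> norm (sum (M n) F) < c"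
    by (rule not_offdiag_pointsE[OF \<open>p \<notin> offdiag_points M c\<close>]) blast
  obtain \<delta>2 G2 where 2: "\<delta>2 > 0" "finite G2"
    "\<And>F n. finite F \<Longrightarrow> F \<subseteq> {m. dist (rho m) q < \<delta>2} \<Longrightarrow> F \<inter> G2 = {} \<Longrightarrow> n \<notin> F \<union> G2 \<Longrightarrow> norm (sum (M n) F) < c"
    by (rule not_offdiag_pointsE[OF \<open>q \<notin> offdiag_points M c\<close>]) blast
  define \<delta> where "\<delta> = min \<delta>1 \<delta>2"
  define G where "G = G1 \<union> G2 \<union> {m \<in> A. \<forall>x\<in>{p, q}. \<delta> \<le> dist (rho m) x}"
  have "finite G" using 1 2 finite_away_from_clusters[OF A(1), of \<delta>] by (simp add: G_def \<delta>_def)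
  have "((\<lambda>n. \<Sum>m\<in>G. norm (M n m)) \<longlongrightarrow> 0) (along H)"
    using column_tendsto[OF H] by (intro tendsto_null_sum tendsto_norm_zero)
  then have "\<forall>\<^sub>F n in along H. (\<Sum>m\<in>G. norm (M n m)) < e / 4"
    using \<open>e / 4 > 0\<close> by (rule order_tendstoD(2))
  then have "finite {n\<in>H. \<not> (\<Sum>m\<in>G. norm (M n m)) < e / 4}" by (simp add: eventually_along)
  \<comment> \<open>Rows in \<open>G\<close> are discarded as well, because the bounds near
    \<open>p\<close> and \<open>q\<close> hold only for rows outside the exceptional sets
    \<open>G1\<close> and \<open>G2\<close>.\<close>
  then have inf': "infinite ({n \<in> H. e \<le> dist (infsum (M n) (A - {n})) 0} - {n\<in>H. \<not> (\<Sum>m\<in>G. norm (M n m)) < e / 4} - G)"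
    using inf \<open>finite G\<close> by simp
  obtain n where n: "n \<in> H" "e \<le> norm (infsum (M n) (A - {n}))" "(\<Sum>m\<in>G. norm (M n m)) < e / 4" "n \<notin> G"
  proof -
    assume *: "\<And>n. n \<in> H \<Longrightarrow> e \<le> norm (infsum (M n) (A - {n})) \<Longrightarrow> (\<Sum>m\<in>G. norm (M n m)) < e / 4 \<Longrightarrow> n \<notin> G \<Longrightarrow> thesis"
    obtain n where "n \<in> {n \<in> H. e \<le> dist (infsum (M n) (A - {n})) 0} - {n\<in>H. \<not> (\<Sum>m\<in>G. norm (M n m)) < e / 4} - G"
      using infinite_imp_nonempty[OF inf'] by blast
    then show thesis by (intro *[of n]) auto
  qed
  define A' where "A' = A - {n} - G"
  have "(A - {n}) \<inter> G \<union> A' = A - {n}" "A' - (A - {n}) \<inter> G = A'" by (auto simp: A'_def)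
  then have "infsum (M n) (A - {n}) = infsum (M n) ((A - {n}) \<inter> G) + infsum (M n) A'"
    using infsum_Un_Diff[OF sm[of n], of "(A - {n}) \<inter> G" A'] by simp
  moreover have "norm (infsum (M n) ((A - {n}) \<inter> G)) < e / 4"
  proof -
    have "norm (infsum (M n) ((A - {n}) \<inter> G)) \<le> (\<Sum>m\<in>(A - {n}) \<inter> G. norm (M n m))"
      using \<open>finite G\<close> by (simp add: norm_sum)
    also have "\<dots> \<le> (\<Sum>m\<in>G. norm (M n m))" using \<open>finite G\<close> by (intro sum_mono2) auto
    finally show ?thesis using n(3) by linarith
  qed
  moreover from calculation(1) have "e \<le> norm (infsum (M n) ((A - {n}) \<inter> G) + infsum (M n) A')"
    using n(2) by simp
  ultimately have big: "norm (infsum (M n) A') > 3 * e / 4"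
    using norm_triangle_ineq[of "infsum (M n) ((A - {n}) \<inter> G)" "infsum (M n) A'"] by linarith
  \<comment> \<open>\<open>offdiag_points\<close> speaks of finite sets of columns only, so the
    infinite sum is replaced by a finite one.\<close>
  obtain F where F: "finite F" "F \<subseteq> A'" "norm (infsum (M n) A' - sum (M n) F) < e / 4"
    by (rule infsum_finite_approx[OF sm \<open>e / 4 > 0\<close>])
  define Fp where "Fp = {m\<in>F. dist (rho m) p < \<delta>}"
  define Fq where "Fq = F - Fp"
  have Fq: "Fq \<subseteq> {m. dist (rho m) q < \<delta>}"
    using F(2) by (auto simp: Fq_def Fp_def A'_def G_def not_le)
  have "norm (sum (M n) Fp) < c"
    using F n(4) by (intro 1) (auto simp: Fp_def \<delta>_def A'_def G_def)
  moreover have "norm (sum (M n) Fq) < c"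
    using F Fq n(4) by (intro 2) (auto simp: Fq_def \<delta>_def A'_def G_def)
  moreover have "sum (M n) F = sum (M n) Fp + sum (M n) Fq"
    using sum.subset_diff[of Fp F "M n"] F(1) by (auto simp: Fq_def Fp_def add.commute)
  ultimately have "norm (sum (M n) F) < e / 2"
    using norm_triangle_ineq[of "sum (M n) Fp" "sum (M n) Fq"] j by (simp add: c_def)
  then show False using big F(3) norm_triangle_sub[of "infsum (M n) A'" "sum (M n) F"] by linarith
qed

lemma infsum_remove_diag:
  fixes M :: "nat \<Rightarrow> nat \<Rightarrow> 'k::banach"
  assumes "M n abs_summable_on UNIV"
  shows "infsum (M n) A = infsum (M n) (A - {n}) + (if n \<in> A then M n n else 0)"
proof -
  have "(A - {n}) \<union> (A \<inter> {n}) = A" "(A \<inter> {n}) - (A - {n}) = (if n \<in> A then {n} else {})" by auto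
  then show ?thesis using infsum_Un_Diff[OF assms, of "A - {n}" "A \<inter> {n}"] by simp
qed

text \<open>Away from the exceptional points \<open>M\<close> acts on the indicator of
  \<open>A\<close> as multiplication by \<open>l\<close>, up to a null sequence. It is applied with
  \<open>H\<close> a member of the target family, and also with \<open>H = A\<close> to identify
  \<open>l\<close>.\<close>

lemma survivor_tendsto:
  fixes M :: "nat \<Rightarrow> nat \<Rightarrow> 'k::banach"
  assumes sm: "\<And>n. M n abs_summable_on UNIV"
    and A: "clusters A \<subseteq> {p, q}" "p \<notin> offdiag_set M" "q \<notin> offdiag_set M"
    and H: "clusters H \<inter> column_clusters M = {}" "clusters H \<inter> diag_clusters M l = {}"
  shows "((\<lambda>n. infsum (M n) A - (if n \<in> A then l else 0)) \<longlongrightarrow> 0) (along H)"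
proof -
  have "((\<lambda>n. M n n - l) \<longlongrightarrow> 0) (along H)"
    using diag_tendsto[OF H(2)] by (simp add: LIM_zero)
  then have "((\<lambda>n. if n \<in> A then M n n - l else 0) \<longlongrightarrow> 0) (along H)"
    by (rule Lim_null_comparison[rotated, OF tendsto_norm_zero]) (auto intro: always_eventually)
  from tendsto_add[OF offdiag_tendsto[OF sm A H(1)] this]
  have "((\<lambda>n. infsum (M n) (A - {n}) + (if n \<in> A then M n n - l else 0)) \<longlongrightarrow> 0) (along H)" by simp
  moreover have "infsum (M n) (A - {n}) + (if n \<in> A then M n n - l else 0) = infsum (M n) A - (if n \<in> A then l else 0)" for n
    using infsum_remove_diag[of M n A, OF sm] by simp
  ultimately show ?thesis by simp
qed

text \<open>Near a fresh point \<open>x\<close> the bounded diagonal has a limit \<open>l\<close>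
  along some sequence of indices. As \<open>diag_clusters M l\<close> is uncountable, there is a
  fresh \<open>y\<close> near which the diagonal stays away from \<open>l\<close>. On the union of
  two such sequences the off-diagonal part vanishes in the limit, so the transform cannot converge
  along the new set itself.\<close>

lemma exists_kill_diag:
  fixes M :: "nat \<Rightarrow> nat \<Rightarrow> 'k::{real_normed_field, banach, heine_borel}"
  assumes sm: "\<And>n. M n abs_summable_on UNIV" and bdd: "\<And>n. norm (M n n) \<le> R"
    and cc: "countable (column_clusters M)" and cb: "countable (offdiag_set M)"
    and unc: "\<And>l. uncountable (diag_clusters M l)"
    and U: "|U| <o |UNIV :: nat set set|"
  shows "\<exists>A p q. p \<notin> U \<and> q \<notin> U \<and> infinite A \<and> clusters A \<subseteq> {p, q} \<and> kills M U \<U> A"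
proof -
  define Z where "Z = column_clusters M \<union> offdiag_set M"
  have Z: "countable Z" using cc cb by (simp add: Z_def)
  have "uncountable {0..1::real}" by (simp add: uncountable_closed_interval)
  then obtain x where x: "x \<in> {0..1}" "x \<notin> U" "x \<notin> Z"
    using exists_fresh[OF _ _ U Z, of "{0..1}"] by blast
  then have "x \<in> clusters UNIV" by (simp add: clusters_UNIV)
  then obtain H0 where H0: "infinite H0" "(rho \<longlongrightarrow> x) (along H0)" by (rule clusters_along)
  have "bounded ((\<lambda>n. M n n) ` H0)" using bdd by (auto simp: bounded_iff)
  then obtain H1 l where H1: "infinite H1" "H1 \<subseteq> H0" "((\<lambda>n. M n n) \<longlongrightarrow> l) (along H1)"
    by (rule bounded_convergent_along[OF H0(1)])
  have "\<exists>j. uncountable (clusters {n. inverse (real (Suc j)) \<le> dist (M n n) l})"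
    using unc[of l] unfolding diag_clusters_def by (blast intro: countable_UN)
  then obtain j where j: "uncountable (clusters {n. inverse (real (Suc j)) \<le> dist (M n n) l})" ..
  obtain y where y: "y \<in> clusters {n. inverse (real (Suc j)) \<le> dist (M n n) l}" "y \<notin> U" "y \<notin> Z"
    by (rule exists_fresh[OF closed_clusters j U Z])
  from y(1) obtain H2 where H2: "infinite H2" "H2 \<subseteq> {n. inverse (real (Suc j)) \<le> dist (M n n) l}" "(rho \<longlongrightarrow> y) (along H2)"
    by (rule clusters_along)
  define A where "A = H1 \<union> H2"
  have cl: "clusters A \<subseteq> {x, y}"
    using clusters_tendsto_subset[OF H2(3)] clusters_tendsto_subset[OF tendsto_along_mono[OF H0(2) H1(2)]]
    unfolding A_def clusters_Un by blast
  have "clusters A \<inter> column_clusters M = {}" using cl x y by (auto simp: Z_def)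
  moreover have "x \<notin> offdiag_set M" "y \<notin> offdiag_set M" using x y by (auto simp: Z_def)
  ultimately have off: "((\<lambda>n. infsum (M n) (A - {n})) \<longlongrightarrow> 0) (along A)"
    by (intro offdiag_tendsto[of M A x y A] sm cl)
  have nc: "\<nexists>l'. ((\<lambda>n. infsum (M n) A) \<longlongrightarrow> l') (along A)"
  proof
    assume "\<exists>l'. ((\<lambda>n. infsum (M n) A) \<longlongrightarrow> l') (along A)"
    then obtain l' where "((\<lambda>n. infsum (M n) A) \<longlongrightarrow> l') (along A)" ..
    from tendsto_diff[OF this off] have "((\<lambda>n. infsum (M n) A - infsum (M n) (A - {n})) \<longlongrightarrow> l') (along A)" by simp
    moreover have "\<forall>\<^sub>F n in along A. infsum (M n) A - infsum (M n) (A - {n}) = M n n"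
    proof -
      have "infsum (M n) A - infsum (M n) (A - {n}) = M n n" if "n \<in> A" for n
        using infsum_remove_diag[of M n A, OF sm] that by simp
      then have "{n \<in> A. infsum (M n) A - infsum (M n) (A - {n}) \<noteq> M n n} = {}" by blast
      then show ?thesis by (simp only: eventually_along finite.emptyI)
    qed
    ultimately have lim: "((\<lambda>n. M n n) \<longlongrightarrow> l') (along A)" by (rule Lim_transform_eventually)
    then have "((\<lambda>n. M n n) \<longlongrightarrow> l') (along H1)" by (rule tendsto_along_mono) (simp add: A_def)
    then have "l' = l" using H1 by (metis along_eq_bot_iff tendsto_unique)
    moreover have "((\<lambda>n. M n n) \<longlongrightarrow> l') (along H2)" using lim by (rule tendsto_along_mono) (simp add: A_def)
    ultimately have "finite {n\<in>H2. inverse (real (Suc j)) \<le> dist (M n n) l}"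
      unfolding tendsto_along_dist by simp
    moreover have "{n\<in>H2. inverse (real (Suc j)) \<le> dist (M n n) l} = H2" using H2(2) by blast
    ultimately show False using H2(1) by simp
  qed
  have "kills M U \<U> A" unfolding kills_def using nc by blast
  moreover have "infinite A" using H1 by (simp add: A_def)
  ultimately show ?thesis using cl x(2) y(2) by blast
qed

definition survivor :: "(nat \<Rightarrow> nat \<Rightarrow> 'k::real_normed_vector) \<Rightarrow> 'k \<Rightarrow> bool" where
  "survivor M l \<longleftrightarrow> countable (offdiag_set M) \<and> countable (diag_clusters M l)"

lemma exists_kill:
  fixes M :: "nat \<Rightarrow> nat \<Rightarrow> 'k::{real_normed_field, banach, heine_borel}"
  assumes sm: "\<And>n. M n abs_summable_on UNIV" and bdd: "\<And>n. norm (M n n) \<le> R"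
    and cc: "countable (column_clusters M)" and ns: "\<nexists>l. survivor M l"
    and U: "|U| <o |UNIV :: nat set set|"
  shows "\<exists>A p q. p \<notin> U \<and> q \<notin> U \<and> infinite A \<and> clusters A \<subseteq> {p, q} \<and> kills M U \<U> A"
proof (cases "countable (offdiag_set M)")
  case True
  then show ?thesis using exists_kill_diag[OF sm bdd cc True _ U] ns by (auto simp: survivor_def)
next
  case False
  then have "\<exists>j. uncountable (offdiag_points M (inverse (real (Suc j))))"
    unfolding offdiag_set_def by (blast intro: countable_UN)
  then obtain j where j: "uncountable (offdiag_points M (inverse (real (Suc j))))" ..
  obtain x where "x \<in> offdiag_points M (inverse (real (Suc j)))" "x \<notin> U"
    using exists_fresh[OF closed_offdiag_points j U, of "{}"] by auto
  then show ?thesis using exists_kill_offdiag[OF sm] by simp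
qed

lemma exists_fresh_set:
  assumes "|U| <o |UNIV :: nat set set|"
  shows "\<exists>A p q. p \<notin> U \<and> q \<notin> U \<and> infinite A \<and> clusters A \<subseteq> {p, q}"
proof -
  have "uncountable {0..1::real}" by (simp add: uncountable_closed_interval)
  then obtain x where x: "x \<in> {0..1}" "x \<notin> U"
    using exists_fresh[OF _ _ assms, of "{0..1}" "{}"] by auto
  then have "x \<in> clusters UNIV" by (simp add: clusters_UNIV)
  then obtain H0 where "infinite H0" "(rho \<longlongrightarrow> x) (along H0)" by (rule clusters_along)
  then show ?thesis using clusters_tendsto_subset[of x H0] x by blast
qed

section \<open>The transfinite construction\<close>

text \<open>These conditions hold for the matrix of every bounded operator whose target comes from a
  \<open>two_point_family\<close>: the image of \<open>unit_at m\<close> is small off finitely many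
  members and finitely many further indices.\<close>

definition admissible :: "(nat \<Rightarrow> nat \<Rightarrow> 'k::real_normed_vector) \<Rightarrow> bool" where
  "admissible M \<longleftrightarrow> (\<forall>n. M n abs_summable_on UNIV) \<and> (\<exists>R. \<forall>n. norm (M n n) \<le> R)
     \<and> countable (column_clusters M)"

lemma card_of_image_underS:
  "|f ` underS |UNIV :: nat set set| i| <o |UNIV :: nat set set|"
proof (rule ordLeq_ordLess_trans[OF card_of_image])
  show "|underS |UNIV :: nat set set| i| <o |UNIV :: nat set set|"
    by (rule card_of_underS[OF card_of_Card_order]) (simp add: Field_card_of)
qed

text \<open>Stages are indexed by \<open>nat set\<close>, well-ordered as a cardinal, so every stage
  has fewer than continuum many predecessors. The points recorded as used are \<open>p i\<close> and
  \<open>q i\<close>, whether or not both are cluster points of \<open>A i\<close>. Disjointness of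
  these pairs is what makes divergence near a used point persist through the later stages.\<close>

lemma rigid_family:
  fixes task :: "nat set \<Rightarrow> nat \<Rightarrow> nat \<Rightarrow> 'k::{real_normed_field, banach, heine_borel}"
  obtains A :: "nat set \<Rightarrow> nat set" and p q :: "nat set \<Rightarrow> real" where
    "\<And>i. infinite (A i)" "\<And>i. clusters (A i) \<subseteq> {p i, q i}"
    "\<And>i j. i \<noteq> j \<Longrightarrow> {p i, q i} \<inter> {p j, q j} = {}"
    "\<And>i. admissible (task i) \<Longrightarrow> \<nexists>l. survivor (task i) l \<Longrightarrow>
      \<exists>E. (\<nexists>l. ((\<lambda>n. infsum (task i n) (A i)) \<longlongrightarrow> l) (along E)) \<and> ((\<exists>j. E \<subseteq> A j) \<or> (\<forall>j. finite (E \<inter> A j)))"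
proof -
  define W where "W = |UNIV :: nat set set|"
  have wo: "well_order_on UNIV W" unfolding W_def by (rule card_of_well_order_on)
  define U :: "(nat set \<Rightarrow> nat set \<times> real \<times> real) \<Rightarrow> nat set \<Rightarrow> real set"
    where "U f i = (\<lambda>j. fst (snd (f j))) ` underS W i \<union> (\<lambda>j. snd (snd (f j))) ` underS W i" for f i
  define \<U> :: "(nat set \<Rightarrow> nat set \<times> real \<times> real) \<Rightarrow> nat set \<Rightarrow> nat set set"
    where "\<U> f i = (\<lambda>j. fst (f j)) ` underS W i" for f i
  define P where "P f i s = (case s of (A, p, q) \<Rightarrow> p \<notin> U f i \<and> q \<notin> U f i \<and> infinite A \<and> clusters A \<subseteq> {p, q} \<and>
     (admissible (task i) \<longrightarrow> (\<nexists>l. survivor (task i) l) \<longrightarrow> kills (task i) (U f i) (\<U> f i) A))" for f i s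
  have "\<exists>f. \<forall>i. P f i (f i)"
  proof (rule dependent_wf_choice[of "W - Id"])
    show "wf (W - Id)" using wo by (simp add: well_order_on_def)
    show "P f i s = P g i s" if "\<And>z. (z, i) \<in> W - Id \<Longrightarrow> f z = g z" for f g i s
    proof -
      have fg: "f z = g z" if "z \<in> underS W i" for z
        using that \<open>\<And>z. (z, i) \<in> W - Id \<Longrightarrow> f z = g z\<close> by (auto simp: underS_def)
      have "U f i = U g i" "\<U> f i = \<U> g i" unfolding U_def \<U>_def by (simp_all add: fg cong: image_cong)
      then show ?thesis by (simp add: P_def)
    qed
    show "\<exists>s. P f i s" for f i
    proof -
      have "infinite (UNIV :: nat set set)" by (simp add: Finite_Set.finite_set)
      then have small: "|U f i| <o |UNIV :: nat set set|"
        unfolding U_def W_def by (intro card_of_Un_ordLess_infinite card_of_image_underS)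
      show ?thesis
      proof (cases "admissible (task i) \<and> (\<nexists>l. survivor (task i) l)")
        case True
        then obtain R where "\<And>n. task i n abs_summable_on UNIV" "\<And>n. norm (task i n n) \<le> R"
          "countable (column_clusters (task i))" by (auto simp: admissible_def)
        from exists_kill[OF this conjunct2[OF True] small, of "\<U> f i"] obtain A p q where
          "p \<notin> U f i \<and> q \<notin> U f i \<and> infinite A \<and> clusters A \<subseteq> {p, q} \<and> kills (task i) (U f i) (\<U> f i) A" by blast
        then have "P f i (A, p, q)" by (simp add: P_def)
        then show ?thesis ..
      next
        case False
        from exists_fresh_set[OF small] obtain A p q where
          "p \<notin> U f i \<and> q \<notin> U f i \<and> infinite A \<and> clusters A \<subseteq> {p, q}" by blast
        with False have "P f i (A, p, q)" by (auto simp: P_def)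
        then show ?thesis ..
      qed
    qed
  qed
  then obtain f where f: "\<And>i. P f i (f i)" by blast
  define A where "A i = fst (f i)" for i
  define p where "p i = fst (snd (f i))" for i
  define q where "q i = snd (snd (f i))" for i
  have f_eq: "f i = (A i, p i, q i)" for i by (simp add: A_def p_def q_def)
  have U: "U f i = p ` underS W i \<union> q ` underS W i" and \<U>: "\<U> f i = A ` underS W i" for i
    by (simp_all add: U_def \<U>_def f_eq)
  have props: "p i \<notin> U f i" "q i \<notin> U f i" "infinite (A i)" "clusters (A i) \<subseteq> {p i, q i}"
    "admissible (task i) \<Longrightarrow> (\<nexists>l. survivor (task i) l) \<Longrightarrow> kills (task i) (U f i) (\<U> f i) (A i)" for i
    using f[of i] unfolding P_def f_eq split by blast+
  have total: "i \<in> underS W j \<or> j \<in> underS W i" if "i \<noteq> j" for i j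
    using wo that by (auto simp: well_order_on_def linear_order_on_def total_on_def underS_def)
  have lt: "{p i, q i} \<inter> {p j, q j} = {}" if "i \<in> underS W j" for i j
    using props(1,2)[of j] that unfolding U by auto
  have disj: "{p i, q i} \<inter> {p j, q j} = {}" if "i \<noteq> j" for i j
    using total[OF that] lt[of i j] lt[of j i] by blast
  show ?thesis
  proof (rule that[of A p q])
    show "infinite (A i)" for i by (rule props(3))
    show "clusters (A i) \<subseteq> {p i, q i}" for i by (rule props(4))
    show "{p i, q i} \<inter> {p j, q j} = {}" if "i \<noteq> j" for i j by (rule disj[OF that])
    show "\<exists>E. (\<nexists>l. ((\<lambda>n. infsum (task i n) (A i)) \<longlongrightarrow> l) (along E)) \<and> ((\<exists>j. E \<subseteq> A j) \<or> (\<forall>j. finite (E \<inter> A j)))"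
      if adm: "admissible (task i)" "\<nexists>l. survivor (task i) l" for i
    proof -
      obtain E where nc: "\<nexists>l. ((\<lambda>n. infsum (task i n) (A i)) \<longlongrightarrow> l) (along E)"
        and E: "(\<exists>B\<in>insert (A i) (\<U> f i). E \<subseteq> B) \<or>
          (\<exists>y\<in>U f i. (rho \<longlongrightarrow> y) (along E)) \<and> (\<forall>B\<in>insert (A i) (\<U> f i). finite (E \<inter> B))"
        using props(5)[OF adm] unfolding kills_def by blast
      have "(\<exists>j. E \<subseteq> A j) \<or> (\<forall>j. finite (E \<inter> A j))"
      proof (cases "\<exists>B\<in>insert (A i) (\<U> f i). E \<subseteq> B")
        case True
        then show ?thesis unfolding \<U> by auto
      next
        case False
        then obtain y where y: "y \<in> U f i" "(rho \<longlongrightarrow> y) (along E)"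
          and fin: "\<And>B. B \<in> insert (A i) (\<U> f i) \<Longrightarrow> finite (E \<inter> B)" using E by blast
        obtain k where k: "k \<in> underS W i" "y \<in> {p k, q k}" using y(1) unfolding U by blast
        \<comment> \<open>The point \<open>y\<close> belongs to the pair of stage \<open>k\<close>
          alone. Hence \<open>E\<close> is almost disjoint from every \<open>A j\<close> with
          \<open>j \<noteq> k\<close>, while \<open>A k\<close> is an earlier member and is covered
          by \<open>kills\<close>.\<close>
        have "finite (E \<inter> A j)" for j
        proof (cases "j = k")
          case True
          then show ?thesis using fin k(1) by (simp add: \<U>)
        next
          case False
          then have "y \<notin> {p j, q j}" using disj[OF False] k(2) by blast
          then show ?thesis
            using clusters_tendsto_subset[OF y(2)] props(4)[of j] by (intro finite_Int_if_clusters_disjoint) blast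
        qed
        then show ?thesis by blast
      qed
      with nc show ?thesis by blast
    qed
  qed
qed

section \<open>The spaces \<open>C\<^sub>0(K\<^sub>\<A>)\<close>\<close>

lemma almost_disjointD:
  assumes "almost_disjoint \<A>"
  shows "A \<in> \<A> \<Longrightarrow> infinite A" "A \<in> \<A> \<Longrightarrow> B \<in> \<A> \<Longrightarrow> A \<noteq> B \<Longrightarrow> finite (A \<inter> B)"
  using assms by (auto simp: almost_disjoint_def pairwise_def)

lemma compactin_K_space_basic:
  assumes "A \<in> \<A>"
  shows "compactin (K_space \<A>) (insert (Inr A) (Inl ` A))"
  unfolding compactin_def
proof (intro conjI allI impI)
  show "insert (Inr A) (Inl ` A) \<subseteq> topspace (K_space \<A>)"
    using assms by (auto simp: topspace_K_space)
  fix \<V> assume V: "(\<forall>V\<in>\<V>. openin (K_space \<A>) V) \<and> insert (Inr A) (Inl ` A) \<subseteq> \<Union>\<V>"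
  then obtain V0 where V0: "V0 \<in> \<V>" "Inr A \<in> V0" by blast
  then obtain F where F: "finite F" "Inl ` (A - F) \<subseteq> V0"
    using V assms unfolding openin_K_space by meson
  have "\<forall>n\<in>A. \<exists>V\<in>\<V>. Inl n \<in> V" using V by blast
  then obtain W where W: "\<And>n. n \<in> A \<Longrightarrow> W n \<in> \<V> \<and> Inl n \<in> W n" by metis
  show "\<exists>\<F>. finite \<F> \<and> \<F> \<subseteq> \<V> \<and> insert (Inr A) (Inl ` A) \<subseteq> \<Union>\<F>"
  proof (intro exI[of _ "insert V0 (W ` (A \<inter> F))"] conjI)
    show "insert (Inr A) (Inl ` A) \<subseteq> \<Union>(insert V0 (W ` (A \<inter> F)))"
    proof
      fix x :: "nat + nat set" assume "x \<in> insert (Inr A) (Inl ` A)"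
      then consider "x = Inr A" | n where "x = Inl n" "n \<in> A - F" | n where "x = Inl n" "n \<in> A \<inter> F" by blast
      then show "x \<in> \<Union>(insert V0 (W ` (A \<inter> F)))"
        using V0 F(2) W by cases blast+
    qed
  qed (use V0 F W in auto)
qed

text \<open>A description of \<open>C_0 (K_space \<A>)\<close> by limits and finite sets. Continuity
  at \<open>Inr A\<close> becomes convergence along \<open>A\<close>; vanishing at infinity says
  that the large values occur on finitely many compact basic sets together with finitely many
  isolated points.\<close>

definition C0K :: "nat set set \<Rightarrow> (nat + nat set \<Rightarrow> 'k::real_normed_field) set" where
  "C0K \<A> = {f. (\<forall>A\<in>\<A>. ((\<lambda>n. f (Inl n)) \<longlongrightarrow> f (Inr A)) (along A)) \<and>
     (\<forall>e>0. \<exists>\<G>. finite \<G> \<and> \<G> \<subseteq> \<A> \<and> (\<forall>A\<in>\<A>-\<G>. norm (f (Inr A)) < e) \<and> finite {n. e \<le> norm (f (Inl n)) \<and> n \<notin> \<Union>\<G>}) \<and>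
     (\<forall>A. A \<notin> \<A> \<longrightarrow> f (Inr A) = 0)}"

lemma continuous_map_K_space_iff:
  fixes f :: "nat + nat set \<Rightarrow> 'k::real_normed_field"
  shows "continuous_map (K_space \<A>) euclidean f \<longleftrightarrow> (\<forall>A\<in>\<A>. ((\<lambda>n. f (Inl n)) \<longlongrightarrow> f (Inr A)) (along A))"
proof (intro iffI ballI)
  fix A assume f: "continuous_map (K_space \<A>) euclidean f" and A: "A \<in> \<A>"
  show "((\<lambda>n. f (Inl n)) \<longlongrightarrow> f (Inr A)) (along A)"
    unfolding tendsto_along_dist
  proof (intro allI impI)
    fix e :: real assume "e > 0"
    have "openin (K_space \<A>) {x \<in> topspace (K_space \<A>). f x \<in> ball (f (Inr A)) e}"
      by (rule openin_continuous_map_preimage[OF f]) simp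
    moreover have "Inr A \<in> {x \<in> topspace (K_space \<A>). f x \<in> ball (f (Inr A)) e}"
      using A \<open>e > 0\<close> by (simp add: topspace_K_space)
    ultimately obtain F where F: "finite F" "Inl ` (A - F) \<subseteq> {x \<in> topspace (K_space \<A>). f x \<in> ball (f (Inr A)) e}"
      using A unfolding openin_K_space by blast
    have "{n \<in> A. e \<le> dist (f (Inl n)) (f (Inr A))} \<subseteq> F"
      using F(2) by (auto simp: dist_commute)
    then show "finite {n \<in> A. e \<le> dist (f (Inl n)) (f (Inr A))}" using F(1) finite_subset by blast
  qed
next
  assume f: "\<forall>A\<in>\<A>. ((\<lambda>n. f (Inl n)) \<longlongrightarrow> f (Inr A)) (along A)"
  show "continuous_map (K_space \<A>) euclidean f"
    unfolding continuous_map_def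
  proof (intro conjI allI impI)
    fix U :: "'k set" assume "openin euclidean U"
    then have U: "open U" by simp
    show "openin (K_space \<A>) {x \<in> topspace (K_space \<A>). f x \<in> U}"
      unfolding openin_K_space
    proof (intro conjI ballI impI)
      fix A assume A: "A \<in> \<A>" "Inr A \<in> {x \<in> topspace (K_space \<A>). f x \<in> U}"
      then have "\<forall>\<^sub>F n in along A. f (Inl n) \<in> U" using f U by (auto intro: topological_tendstoD)
      then have "finite {n\<in>A. f (Inl n) \<notin> U}" by (simp add: eventually_along)
      then show "\<exists>F. finite F \<and> Inl ` (A - F) \<subseteq> {x \<in> topspace (K_space \<A>). f x \<in> U}"
        by (intro exI[of _ "{n\<in>A. f (Inl n) \<notin> U}"]) (auto simp: topspace_K_space)
    qed (auto simp: topspace_K_space)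
  qed simp
qed

lemma C_0_K_space: "C_0 (K_space \<A>) = (C0K \<A> :: (nat + nat set \<Rightarrow> 'k::real_normed_field) set)"
proof (intro set_eqI iffI)
  fix f :: "nat + nat set \<Rightarrow> 'k" assume "f \<in> C_0 (K_space \<A>)"
  then have cont: "continuous_map (K_space \<A>) euclidean f"
    and cpt: "\<And>e. e > 0 \<Longrightarrow> compactin (K_space \<A>) {x \<in> topspace (K_space \<A>). e \<le> norm (f x)}"
    and off: "\<And>x. x \<notin> topspace (K_space \<A>) \<Longrightarrow> f x = 0" by (auto simp: C_0_def)
  have "\<exists>\<G>. finite \<G> \<and> \<G> \<subseteq> \<A> \<and> (\<forall>A\<in>\<A>-\<G>. norm (f (Inr A)) < e) \<and> finite {n. e \<le> norm (f (Inl n)) \<and> n \<notin> \<Union>\<G>}"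
    if e: "e > 0" for e
  proof -
    define L where "L = {x \<in> topspace (K_space \<A>). e \<le> norm (f x)}"
    \<comment> \<open>An open cover by basic neighbourhoods, each containing at most one point of
      the form \<open>Inr A\<close>. The indices of these points in a finite subcover form the
      required \<open>\<G>\<close>.\<close>
    define g :: "nat + nat set \<Rightarrow> (nat + nat set) set"
      where "g x = (case x of Inl n \<Rightarrow> {Inl n} | Inr A \<Rightarrow> insert (Inr A) (Inl ` A))" for x
    have "openin (K_space \<A>) (g x)" if "x \<in> L" for x
    proof (cases x)
      case (Inl n)
      then show ?thesis by (simp add: g_def openin_K_space_isolated)
    next
      case (Inr A)
      then have "A \<in> \<A>" using that by (auto simp: L_def topspace_K_space)
      then show ?thesis using openin_K_space_basic[of A \<A> "{}"] by (simp add: g_def Inr)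
    qed
    moreover have "L \<subseteq> \<Union>(g ` L)" by (force simp: g_def split: sum.splits)
    ultimately have "\<exists>\<F>. finite \<F> \<and> \<F> \<subseteq> g ` L \<and> L \<subseteq> \<Union>\<F>"
      using cpt[OF e, folded L_def, unfolded compactin_def, THEN conjunct2, rule_format, of "g ` L"] by simp
    then obtain \<F> where "finite \<F>" "\<F> \<subseteq> g ` L" "L \<subseteq> \<Union>\<F>" by (elim exE conjE)
    then obtain T where T: "finite T" "T \<subseteq> L" "L \<subseteq> \<Union>(g ` T)" by (metis finite_subset_image)
    show ?thesis
    proof (intro exI[of _ "Inr -` T"] conjI ballI)
      show "finite (Inr -` T :: nat set set)" using T(1) by (intro finite_vimageI) auto
      show "Inr -` T \<subseteq> \<A>" using T(2) by (auto simp: L_def topspace_K_space)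
      show "norm (f (Inr A)) < e" if "A \<in> \<A> - Inr -` T" for A
      proof (rule ccontr)
        assume "\<not> norm (f (Inr A)) < e"
        then have "Inr A \<in> L" using that by (simp add: L_def topspace_K_space)
        then obtain x where "x \<in> T" "Inr A \<in> g x" using T(3) by blast
        then show False using that by (auto simp: g_def split: sum.splits)
      qed
      have "{n. e \<le> norm (f (Inl n)) \<and> n \<notin> \<Union>(Inr -` T)} \<subseteq> Inl -` T"
      proof
        fix n assume n: "n \<in> {n. e \<le> norm (f (Inl n)) \<and> n \<notin> \<Union>(Inr -` T)}"
        then have "Inl n \<in> L" by (simp add: L_def topspace_K_space)
        then obtain x where x: "x \<in> T" "Inl n \<in> g x" using T(3) by blast
        then show "n \<in> Inl -` T" using n by (auto simp: g_def split: sum.splits)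
      qed
      moreover have "finite (Inl -` T :: nat set)" using T(1) by (intro finite_vimageI) auto
      ultimately show "finite {n. e \<le> norm (f (Inl n)) \<and> n \<notin> \<Union>(Inr -` T)}" by (rule finite_subset)
    qed
  qed
  moreover have "f (Inr A) = 0" if "A \<notin> \<A>" for A using off[of "Inr A"] that by (auto simp: topspace_K_space)
  ultimately show "f \<in> C0K \<A>"
    using cont unfolding continuous_map_K_space_iff C0K_def by blast
next
  fix f :: "nat + nat set \<Rightarrow> 'k" assume f: "f \<in> C0K \<A>"
  then have cont: "continuous_map (K_space \<A>) euclidean f"
    unfolding continuous_map_K_space_iff by (simp add: C0K_def)
  have "compactin (K_space \<A>) {x \<in> topspace (K_space \<A>). e \<le> norm (f x)}" if "e > 0" for e
  proof -
    obtain \<G> where G: "finite \<G>" "\<G> \<subseteq> \<A>" "\<forall>A\<in>\<A>-\<G>. norm (f (Inr A)) < e"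
      "finite {n. e \<le> norm (f (Inl n)) \<and> n \<notin> \<Union>\<G>}" (is "finite ?S")
      using f \<open>e > 0\<close> unfolding C0K_def by blast
    have "compactin (K_space \<A>) (\<Union>((\<lambda>A. insert (Inr A) (Inl ` A)) ` \<G>))"
      using G(1,2) compactin_K_space_basic by (intro compactin_Union) blast+
    moreover have "compactin (K_space \<A>) (Inl ` ?S)"
      using G(4) by (intro finite_imp_compactin) (auto simp: topspace_K_space)
    ultimately have cK: "compactin (K_space \<A>) (\<Union>((\<lambda>A. insert (Inr A) (Inl ` A)) ` \<G>) \<union> Inl ` ?S)"
      by (rule compactin_Un)
    have cl: "closedin (K_space \<A>) {x \<in> topspace (K_space \<A>). e \<le> norm (f x)}"
    proof -
      have "closed {z :: 'k. e \<le> norm z}" by (intro closed_Collect_le continuous_intros)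
      then show ?thesis using closedin_continuous_map_preimage[OF cont, of "{z. e \<le> norm z}"] by simp
    qed
    have sub: "{x \<in> topspace (K_space \<A>). e \<le> norm (f x)} \<subseteq> \<Union>((\<lambda>A. insert (Inr A) (Inl ` A)) ` \<G>) \<union> Inl ` ?S"
    proof
      fix x assume x: "x \<in> {x \<in> topspace (K_space \<A>). e \<le> norm (f x)}"
      show "x \<in> \<Union>((\<lambda>A. insert (Inr A) (Inl ` A)) ` \<G>) \<union> Inl ` ?S"
      proof (cases x)
        case (Inl n)
        then show ?thesis using x by blast
      next
        case (Inr A)
        then have "A \<in> \<A>" "\<not> norm (f (Inr A)) < e" using x by (auto simp: topspace_K_space)
        then have "A \<in> \<G>" using G(3) by blast
        then show ?thesis using Inr by blast
      qed
    qed
    show ?thesis by (rule closed_compactin[OF cK sub cl])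
  qed
  moreover have "f x = 0" if "x \<notin> topspace (K_space \<A>)" for x
    using that f by (cases x) (auto simp: topspace_K_space C0K_def)
  ultimately show "f \<in> C_0 (K_space \<A>)" using cont by (simp add: C_0_def)
qed

lemma C0K_D:
  assumes "f \<in> C0K \<A>"
  shows "A \<in> \<A> \<Longrightarrow> ((\<lambda>n. f (Inl n)) \<longlongrightarrow> f (Inr A)) (along A)" "A \<notin> \<A> \<Longrightarrow> f (Inr A) = 0"
  using assms by (auto simp: C0K_def)

lemma C0K_finite:
  assumes "f \<in> C0K \<A>" "e > 0"
  obtains \<G> where "finite \<G>" "\<G> \<subseteq> \<A>" "\<And>A. A \<notin> \<G> \<Longrightarrow> norm (f (Inr A)) < e"
    "finite {n. e \<le> norm (f (Inl n)) \<and> n \<notin> \<Union>\<G>}"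
proof -
  obtain \<G> where G: "finite \<G>" "\<G> \<subseteq> \<A>" "\<forall>A\<in>\<A>-\<G>. norm (f (Inr A)) < e"
      "finite {n. e \<le> norm (f (Inl n)) \<and> n \<notin> \<Union>\<G>}"
    using assms unfolding C0K_def by blast
  have "norm (f (Inr A)) < e" if "A \<notin> \<G>" for A
    using G(3) that C0K_D(2)[OF assms(1)] assms(2) by (cases "A \<in> \<A>") auto
  then show ?thesis using that[OF G(1,2) _ G(4)] by blast
qed

text \<open>Values of size at least \<open>e\<close> occur, up to finitely many indices, inside
  finitely many members, and each of these meets \<open>H\<close> in a finite set.\<close>

lemma C0K_tendsto_zero:
  assumes "f \<in> C0K \<A>" "\<And>A. A \<in> \<A> \<Longrightarrow> finite (H \<inter> A)"
  shows "((\<lambda>n. f (Inl n)) \<longlongrightarrow> 0) (along H)"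
  unfolding tendsto_along_dist
proof (intro allI impI)
  fix e :: real assume e: "e > 0"
  obtain \<G> where G: "finite \<G>" "\<G> \<subseteq> \<A>" "\<And>A. A \<notin> \<G> \<Longrightarrow> norm (f (Inr A)) < e"
    "finite {n. e \<le> norm (f (Inl n)) \<and> n \<notin> \<Union>\<G>}" (is "finite ?S")
    by (rule C0K_finite[OF assms(1) e]) blast
  have "finite (\<Union>A\<in>\<G>. H \<inter> A)" using G(1,2) assms(2) by (intro finite_UN_I) auto
  then have "finite (?S \<union> (\<Union>A\<in>\<G>. H \<inter> A))" using G(4) by simp
  then show "finite {n \<in> H. e \<le> dist (f (Inl n)) 0}"
    by (rule rev_finite_subset) auto
qed

lemma C0K_bounded:
  assumes "f \<in> C0K \<A>"
  shows "bdd_above (range (\<lambda>x. norm (f x)))"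
proof -
  have f: "f \<in> C_0 (K_space \<A>)" using assms by (simp add: C_0_K_space)
  then have "compactin euclidean (f ` {x \<in> topspace (K_space \<A>). 1 \<le> norm (f x)})"
    by (intro image_compactin[of "K_space \<A>"]) (auto simp: C_0_def)
  then have "bounded (f ` {x \<in> topspace (K_space \<A>). 1 \<le> norm (f x)})"
    using compact_imp_bounded by auto
  then obtain B where B: "\<And>x. x \<in> topspace (K_space \<A>) \<Longrightarrow> 1 \<le> norm (f x) \<Longrightarrow> norm (f x) \<le> B"
    by (auto simp: bounded_iff)
  have "norm (f x) \<le> max 1 B" for x
    using B[of x] f by (cases "x \<in> topspace (K_space \<A>)"; cases "1 \<le> norm (f x)") (auto simp: C_0_def)
  then show ?thesis by (auto simp: bdd_above_def)
qed

lemma norm_le_sup_norm: "f \<in> C0K \<A> \<Longrightarrow> norm (f x) \<le> sup_norm f"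
  unfolding sup_norm_def by (rule cSUP_upper[OF UNIV_I C0K_bounded])

lemma sup_norm_le: "(\<And>x. norm (f x) \<le> B) \<Longrightarrow> sup_norm f \<le> B"
  unfolding sup_norm_def by (rule cSUP_least) auto

lemma sup_norm_nonneg: "f \<in> C0K \<A> \<Longrightarrow> 0 \<le> sup_norm f"
  by (rule order_trans[OF norm_ge_zero norm_le_sup_norm])

lemma C0K_add:
  assumes f: "f \<in> C0K \<A>" and g: "g \<in> C0K \<A>"
  shows "(\<lambda>x. f x + g x) \<in> C0K \<A>"
  unfolding C0K_def
proof (intro CollectI conjI ballI allI impI)
  fix e :: real assume "e > 0"
  then have e2: "e / 2 > 0" by simp
  obtain \<G> where G: "finite \<G>" "\<G> \<subseteq> \<A>" "\<And>A. A \<notin> \<G> \<Longrightarrow> norm (f (Inr A)) < e / 2"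
    "finite {n. e / 2 \<le> norm (f (Inl n)) \<and> n \<notin> \<Union>\<G>}" by (rule C0K_finite[OF f e2]) blast
  obtain \<H> where H: "finite \<H>" "\<H> \<subseteq> \<A>" "\<And>A. A \<notin> \<H> \<Longrightarrow> norm (g (Inr A)) < e / 2"
    "finite {n. e / 2 \<le> norm (g (Inl n)) \<and> n \<notin> \<Union>\<H>}" by (rule C0K_finite[OF g e2]) blast
  have le: "norm (f x + g x) < e" if "norm (f x) < e / 2" "norm (g x) < e / 2" for x
    using norm_triangle_ineq[of "f x" "g x"] that by linarith
  have "{n. e \<le> norm (f (Inl n) + g (Inl n)) \<and> n \<notin> \<Union>(\<G> \<union> \<H>)} \<subseteq>
      {n. e / 2 \<le> norm (f (Inl n)) \<and> n \<notin> \<Union>\<G>} \<union> {n. e / 2 \<le> norm (g (Inl n)) \<and> n \<notin> \<Union>\<H>}"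
    using le[of "Inl _"] by (auto simp: not_le[symmetric])
  then have "finite {n. e \<le> norm (f (Inl n) + g (Inl n)) \<and> n \<notin> \<Union>(\<G> \<union> \<H>)}"
    using G(4) H(4) by (meson finite_UnI finite_subset)
  then show "\<exists>\<G>. finite \<G> \<and> \<G> \<subseteq> \<A> \<and> (\<forall>A\<in>\<A>-\<G>. norm (f (Inr A) + g (Inr A)) < e) \<and>
      finite {n. e \<le> norm (f (Inl n) + g (Inl n)) \<and> n \<notin> \<Union>\<G>}"
    using G H le by (intro exI[of _ "\<G> \<union> \<H>"]) auto
qed (use C0K_D[OF f] C0K_D[OF g] in \<open>auto intro: tendsto_add\<close>)

lemma C0K_scale:
  assumes f: "f \<in> C0K \<A>"
  shows "(\<lambda>x. c * f x) \<in> C0K \<A>"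
proof (cases "c = 0")
  case False
  show ?thesis unfolding C0K_def
  proof (intro CollectI conjI ballI allI impI)
    fix e :: real assume "e > 0"
    then have ec: "e / norm c > 0" using False by simp
    obtain \<G> where G: "finite \<G>" "\<G> \<subseteq> \<A>" "\<And>A. A \<notin> \<G> \<Longrightarrow> norm (f (Inr A)) < e / norm c"
      "finite {n. e / norm c \<le> norm (f (Inl n)) \<and> n \<notin> \<Union>\<G>}" by (rule C0K_finite[OF f ec]) blast
    have le: "norm (c * z) < e \<longleftrightarrow> norm z < e / norm c" for z
      using False by (simp add: norm_mult field_simps)
    have le': "e \<le> norm (c * z) \<longleftrightarrow> e / norm c \<le> norm z" for z
      using le[of z] by linarith
    show "\<exists>\<G>. finite \<G> \<and> \<G> \<subseteq> \<A> \<and> (\<forall>A\<in>\<A>-\<G>. norm (c * f (Inr A)) < e) \<and>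
        finite {n. e \<le> norm (c * f (Inl n)) \<and> n \<notin> \<Union>\<G>}"
      unfolding le le' using G by (intro exI[of _ \<G>]) auto
  qed (use C0K_D[OF f] in \<open>auto intro: tendsto_mult_left\<close>)
qed (auto simp: C0K_def intro: exI[of _ "{}"])

lemma C0K_zero: "(\<lambda>x. 0) \<in> C0K \<A>"
  by (auto simp: C0K_def intro: exI[of _ "{}"])

lemma C0K_sum: "finite S \<Longrightarrow> (\<And>i. i \<in> S \<Longrightarrow> f i \<in> C0K \<A>) \<Longrightarrow> (\<lambda>x. \<Sum>i\<in>S. f i x) \<in> C0K \<A>"
  by (induction S rule: finite_induct) (simp_all add: C0K_zero C0K_add)

definition unit_at :: "nat \<Rightarrow> nat + nat set \<Rightarrow> 'k::real_normed_field" where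
  "unit_at m x = (if x = Inl m then 1 else 0)"

text \<open>The indicator of the compact open set formed by \<open>A\<close> and its limit point.
  Together with the \<open>unit_at m\<close>, these functions for members \<open>A\<close> span a
  dense subspace, which is the content of \<open>functional_eq_zero\<close>.\<close>

definition chi :: "nat set \<Rightarrow> nat + nat set \<Rightarrow> 'k::real_normed_field" where
  "chi A x = (case x of Inl n \<Rightarrow> if n \<in> A then 1 else 0 | Inr B \<Rightarrow> if B = A then 1 else 0)"

lemma chi_simps [simp]: "chi A (Inl n) = (if n \<in> A then 1 else 0)" "chi A (Inr B) = (if B = A then 1 else 0)"
  by (simp_all add: chi_def)

lemma unit_at_simps [simp]: "unit_at m (Inl n) = (if n = m then 1 else 0)" "unit_at m (Inr B) = 0"
  by (auto simp: unit_at_def)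

lemma unit_at_C0K: "unit_at m \<in> C0K \<A>"
  unfolding C0K_def
proof (intro CollectI conjI ballI allI impI)
  fix A show "((\<lambda>n. unit_at m (Inl n)) \<longlongrightarrow> (unit_at m (Inr A) :: 'a)) (along A)"
    by (rule tendsto_eventually) (auto simp: eventually_along)
  fix e :: real assume "e > 0"
  then have "finite {n. e \<le> norm (unit_at m (Inl n) :: 'a)}"
    by (intro finite_subset[OF _ finite.insertI[OF finite.emptyI, of m]]) (auto split: if_splits)
  then show "\<exists>\<G>. finite \<G> \<and> \<G> \<subseteq> \<A> \<and> (\<forall>A\<in>\<A>-\<G>. norm (unit_at m (Inr A) :: 'a) < e) \<and> finite {n. e \<le> norm (unit_at m (Inl n) :: 'a) \<and> n \<notin> \<Union>\<G>}"
    using \<open>e > 0\<close> by (intro exI[of _ "{}"]) simp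
qed simp

lemma chi_C0K:
  assumes "almost_disjoint \<A>" "A \<in> \<A>"
  shows "chi A \<in> C0K \<A>"
  unfolding C0K_def
proof (intro CollectI conjI ballI allI impI)
  fix B assume B: "B \<in> \<A>"
  have "finite {n \<in> B. chi A (Inl n) \<noteq> (chi A (Inr B) :: 'a)}"
  proof (cases "B = A")
    case False
    then have "finite (B \<inter> A)" by (rule almost_disjointD(2)[OF assms(1) B assms(2)])
    then show ?thesis by (rule rev_finite_subset) (use False in auto)
  qed simp
  then have "\<forall>\<^sub>F n in along B. chi A (Inl n) = (chi A (Inr B) :: 'a)"
    by (simp only: eventually_along)
  then show "((\<lambda>n. chi A (Inl n)) \<longlongrightarrow> (chi A (Inr B) :: 'a)) (along B)"
    by (rule tendsto_eventually)
next
  fix e :: real assume "e > 0"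
  then have "{n. e \<le> norm (chi A (Inl n) :: 'a) \<and> n \<notin> \<Union>{A}} = {}" by auto
  then show "\<exists>\<G>. finite \<G> \<and> \<G> \<subseteq> \<A> \<and> (\<forall>B\<in>\<A>-\<G>. norm (chi A (Inr B) :: 'a) < e) \<and> finite {n. e \<le> norm (chi A (Inl n) :: 'a) \<and> n \<notin> \<Union>\<G>}"
    using \<open>e > 0\<close> assms(2) by (intro exI[of _ "{A}"]) (simp only: finite.emptyI, simp)
qed (use assms in auto)

text \<open>Representatives vanish off their space, so extension by zero does not change the
  function. Continuity at a new point holds because the new set is almost disjoint from all members
  of \<open>\<A>\<close>.\<close>

lemma C0K_mono:
  assumes "almost_disjoint \<B>" "\<A> \<subseteq> \<B>" "f \<in> C0K \<A>"
  shows "f \<in> C0K \<B>"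
  unfolding C0K_def
proof (intro CollectI conjI ballI allI impI)
  fix B assume B: "B \<in> \<B>"
  show "((\<lambda>n. f (Inl n)) \<longlongrightarrow> f (Inr B)) (along B)"
  proof (cases "B \<in> \<A>")
    case False
    then have "finite (B \<inter> A)" if "A \<in> \<A>" for A
      using almost_disjointD(2)[OF assms(1) B] that assms(2) by blast
    then show ?thesis using C0K_tendsto_zero[OF assms(3)] C0K_D(2)[OF assms(3) False] by simp
  qed (rule C0K_D(1)[OF assms(3)])
next
  fix e :: real assume "e > 0"
  then obtain \<G> where "finite \<G>" "\<G> \<subseteq> \<A>" "\<And>A. A \<notin> \<G> \<Longrightarrow> norm (f (Inr A)) < e"
    "finite {n. e \<le> norm (f (Inl n)) \<and> n \<notin> \<Union>\<G>}" by (rule C0K_finite[OF assms(3)]) blast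
  then show "\<exists>\<G>. finite \<G> \<and> \<G> \<subseteq> \<B> \<and> (\<forall>A\<in>\<B>-\<G>. norm (f (Inr A)) < e) \<and> finite {n. e \<le> norm (f (Inl n)) \<and> n \<notin> \<Union>\<G>}"
    using assms(2) by blast
next
  fix A assume "A \<notin> \<B>"
  then show "f (Inr A) = 0" using C0K_D(2)[OF assms(3)] assms(2) by blast
qed

section \<open>Bounded functionals and their values on indicator functions\<close>

definition bounded_functional :: "nat set set \<Rightarrow> real \<Rightarrow> ((nat + nat set \<Rightarrow> 'k) \<Rightarrow> 'k::real_normed_field) \<Rightarrow> bool" where
  "bounded_functional \<A> C \<phi> \<longleftrightarrow> 0 \<le> C \<and>
     (\<forall>f\<in>C0K \<A>. \<forall>g\<in>C0K \<A>. \<phi> (\<lambda>x. f x + g x) = \<phi> f + \<phi> g) \<and>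
     (\<forall>c. \<forall>f\<in>C0K \<A>. \<phi> (\<lambda>x. c * f x) = c * \<phi> f) \<and>
     (\<forall>f\<in>C0K \<A>. norm (\<phi> f) \<le> C * sup_norm f)"

lemma bounded_functionalD:
  assumes "bounded_functional \<A> C \<phi>"
  shows "0 \<le> C"
    "f \<in> C0K \<A> \<Longrightarrow> g \<in> C0K \<A> \<Longrightarrow> \<phi> (\<lambda>x. f x + g x) = \<phi> f + \<phi> g"
    "f \<in> C0K \<A> \<Longrightarrow> \<phi> (\<lambda>x. c * f x) = c * \<phi> f"
    "f \<in> C0K \<A> \<Longrightarrow> norm (\<phi> f) \<le> C * sup_norm f"
  using assms by (simp_all add: bounded_functional_def)

lemma functional_sum:
  assumes \<phi>: "bounded_functional \<A> C \<phi>" and "finite S" "\<And>i. i \<in> S \<Longrightarrow> f i \<in> C0K \<A>"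
  shows "\<phi> (\<lambda>x. \<Sum>i\<in>S. c i * f i x) = (\<Sum>i\<in>S. c i * \<phi> (f i))"
  using assms(2,3)
proof (induction S rule: finite_induct)
  case empty
  show ?case using bounded_functionalD(3)[OF \<phi> C0K_zero, of 0] by simp
next
  case (insert j S)
  have "(\<lambda>x. \<Sum>i\<in>S. c i * f i x) \<in> C0K \<A>"
    using insert by (intro C0K_sum C0K_scale) auto
  moreover have "(\<lambda>x. c j * f j x) \<in> C0K \<A>" using insert by (intro C0K_scale) auto
  ultimately have "\<phi> (\<lambda>x. c j * f j x + (\<Sum>i\<in>S. c i * f i x)) = \<phi> (\<lambda>x. c j * f j x) + \<phi> (\<lambda>x. \<Sum>i\<in>S. c i * f i x)"
    by (intro bounded_functionalD(2)[OF \<phi>])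
  also have "\<phi> (\<lambda>x. c j * f j x) = c j * \<phi> (f j)"
    using insert by (intro bounded_functionalD(3)[OF \<phi>]) auto
  finally show ?case using insert by simp
qed

text \<open>Multiplying each \<open>f i\<close> by a scalar of norm at most 1 turns
  \<open>\<phi> (f i)\<close> into its norm, and the sum of the multiplied functions still has sup
  norm at most 1.\<close>

lemma functional_sum_norm_le:
  assumes \<phi>: "bounded_functional \<A> C \<phi>" and S: "finite S" "\<And>i. i \<in> S \<Longrightarrow> f i \<in> C0K \<A>"
    and le: "\<And>x. (\<Sum>i\<in>S. norm (f i x)) \<le> 1"
  shows "(\<Sum>i\<in>S. norm (\<phi> (f i))) \<le> C"
proof -
  define c where "c i = (if \<phi> (f i) = 0 then 0 else of_real (norm (\<phi> (f i))) / \<phi> (f i))" for i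
  have c: "norm (c i) \<le> 1" "c i * \<phi> (f i) = of_real (norm (\<phi> (f i)))" for i
    by (auto simp: c_def norm_divide)
  define h where "h = (\<lambda>x. \<Sum>i\<in>S. c i * f i x)"
  have h: "h \<in> C0K \<A>" unfolding h_def using S by (intro C0K_sum C0K_scale) auto
  have "norm (h x) \<le> 1" for x
  proof -
    have "norm (h x) \<le> (\<Sum>i\<in>S. norm (c i * f i x))" unfolding h_def by (rule norm_sum)
    also have "\<dots> \<le> (\<Sum>i\<in>S. norm (f i x))"
      by (intro sum_mono) (simp add: norm_mult mult_left_le_one_le c(1))
    finally show ?thesis using le[of x] by linarith
  qed
  then have "sup_norm h \<le> 1" by (rule sup_norm_le)
  have "\<phi> h = (\<Sum>i\<in>S. c i * \<phi> (f i))" unfolding h_def by (rule functional_sum[OF \<phi> S])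
  then have "\<phi> h = of_real (\<Sum>i\<in>S. norm (\<phi> (f i)))" by (simp add: c(2))
  then have "(\<Sum>i\<in>S. norm (\<phi> (f i))) = norm (\<phi> h)"
    by (simp only: norm_of_real) (simp add: sum_nonneg)
  also have "\<dots> \<le> C * sup_norm h" by (rule bounded_functionalD(4)[OF \<phi> h])
  also have "\<dots> \<le> C * 1" by (rule mult_left_mono[OF \<open>sup_norm h \<le> 1\<close> bounded_functionalD(1)[OF \<phi>]])
  finally show ?thesis by simp
qed

lemma functional_units_summable:
  fixes \<phi> :: "(nat + nat set \<Rightarrow> 'k) \<Rightarrow> 'k::{real_normed_field, banach}"
  assumes \<phi>: "bounded_functional \<A> C \<phi>"
  shows "(\<lambda>m. \<phi> (unit_at m)) abs_summable_on UNIV"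
proof (rule nonneg_bdd_above_summable_on)
  have "(\<Sum>m\<in>F. norm (\<phi> (unit_at m))) \<le> C" if F: "finite F" for F
  proof (rule functional_sum_norm_le[OF \<phi> F unit_at_C0K])
    show "(\<Sum>m\<in>F. norm (unit_at m x :: 'k)) \<le> 1" for x
    proof (cases x)
      case (Inl n)
      then have "(\<Sum>m\<in>F. norm (unit_at m x :: 'k)) = (\<Sum>m\<in>F. if n = m then 1 else 0)"
        by (intro sum.cong) auto
      then show ?thesis using F by simp
    qed simp
  qed
  then show "bdd_above (sum (\<lambda>m. norm (\<phi> (unit_at m))) ` {F. F \<subseteq> UNIV \<and> finite F})"
    by (auto simp: bdd_above_def)
qed simp

text \<open>After removing initial segments, finitely many members of the family become disjoint, so the
  defects \<open>\<phi> (chi A) - (\<Sum>m\<in>A. \<phi> (unit_at m))\<close> form an absolutely summable family.\<close>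

lemma functional_chi:
  fixes \<phi> :: "(nat + nat set \<Rightarrow> 'k) \<Rightarrow> 'k::{real_normed_field, banach}"
  assumes ad: "almost_disjoint \<A>" and \<phi>: "bounded_functional \<A> C \<phi>"
  shows "countable {A \<in> \<A>. \<phi> (chi A) \<noteq> infsum (\<lambda>m. \<phi> (unit_at m)) A}"
proof -
  define a where "a m = \<phi> (unit_at m)" for m
  have a: "a abs_summable_on UNIV" unfolding a_def by (rule functional_units_summable[OF \<phi>])
  define g where "g A = \<phi> (chi A) - infsum a A" for A
  have "(\<Sum>A\<in>\<G>. norm (g A)) \<le> C + 1" if G: "finite \<G>" "\<G> \<subseteq> \<A>" for \<G>
  proof -
    \<comment> \<open>One error \<open>e\<close> for each member of \<open>\<G>\<close> adds up to
      at most 1; the summand 1 in the denominator covers empty \<open>\<G>\<close>.\<close>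
    define e where "e = 1 / (1 + real (card \<G>))"
    have "e > 0" by (simp add: e_def)
    then obtain L1 where L1: "\<And>X. X \<inter> {..<L1} = {} \<Longrightarrow> norm (infsum a X) < e"
      using infsum_tail_small[OF a] by blast
    have "finite (\<Union>(A, B)\<in>{(A, B). A \<in> \<G> \<and> B \<in> \<G> \<and> A \<noteq> B}. A \<inter> B)"
    proof (rule finite_UN_I)
      show "finite {(A, B). A \<in> \<G> \<and> B \<in> \<G> \<and> A \<noteq> B}"
        by (rule finite_subset[OF _ finite_cartesian_product[OF G(1) G(1)]]) auto
    qed (use almost_disjointD(2)[OF ad] G(2) in auto)
    then obtain L2 where L2: "(\<Union>(A, B)\<in>{(A, B). A \<in> \<G> \<and> B \<in> \<G> \<and> A \<noteq> B}. A \<inter> B) \<subseteq> {..<L2}"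
      using finite_nat_iff_bounded by blast
    then have Int: "A \<inter> B \<subseteq> {..<L2}" if "A \<in> \<G>" "B \<in> \<G>" "A \<noteq> B" for A B using that by blast
    define L where "L = max L1 L2"
    \<comment> \<open>The indicator of \<open>A\<close> without its elements below \<open>L\<close>.
      Beyond \<open>L\<close> the members of \<open>\<G>\<close> are pairwise disjoint, so at each
      point at most one of these functions is nonzero.\<close>
    define h :: "nat set \<Rightarrow> nat + nat set \<Rightarrow> 'k"
      where "h A = (\<lambda>x. 1 * chi A x + (\<Sum>m\<in>A \<inter> {..<L}. (-1) * unit_at m x))" for A
    have hC: "h A \<in> C0K \<A>" if "A \<in> \<G>" for A
      unfolding h_def using that G(2)
      by (intro C0K_add C0K_scale C0K_sum chi_C0K[OF ad] unit_at_C0K) auto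
    have hInl: "h A (Inl n) = (if n \<in> A \<and> L \<le> n then 1 else 0)" for A n
    proof -
      have "(\<Sum>m\<in>A \<inter> {..<L}. (-1) * unit_at m (Inl n)) = (\<Sum>m\<in>A \<inter> {..<L}. if n = m then - 1 else (0::'k))"
        by (intro sum.cong) auto
      then show ?thesis by (simp add: h_def)
    qed
    have hInr: "h A (Inr B) = (if B = A then 1 else 0)" for A B by (simp add: h_def)
    have \<phi>h: "\<phi> (h A) = g A + infsum a (A - {..<L})" if "A \<in> \<G>" for A
    proof -
      have "\<phi> (h A) = \<phi> (\<lambda>x. 1 * chi A x) + \<phi> (\<lambda>x. \<Sum>m\<in>A \<inter> {..<L}. (-1) * unit_at m x)"
        unfolding h_def using that G(2)
        by (intro bounded_functionalD(2)[OF \<phi>] C0K_scale C0K_sum chi_C0K[OF ad] unit_at_C0K) auto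
      also have "\<phi> (\<lambda>x. \<Sum>m\<in>A \<inter> {..<L}. (-1) * unit_at m x) = (\<Sum>m\<in>A \<inter> {..<L}. (-1) * a m)"
        unfolding a_def by (rule functional_sum[OF \<phi>]) (auto simp: unit_at_C0K)
      also have "\<dots> = - infsum a (A \<inter> {..<L})" by (simp add: sum_negf)
      finally have "\<phi> (h A) = \<phi> (chi A) - infsum a (A \<inter> {..<L})" by simp
      moreover have "(A \<inter> {..<L}) \<union> (A - {..<L}) = A" "(A - {..<L}) - A \<inter> {..<L} = A - {..<L}" by auto
      then have "infsum a A = infsum a (A \<inter> {..<L}) + infsum a (A - {..<L})"
        using infsum_Un_Diff[OF a, of "A \<inter> {..<L}" "A - {..<L}"] by simp
      ultimately show ?thesis by (simp add: g_def)
    qed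
    have "(\<Sum>A\<in>\<G>. norm (\<phi> (h A))) \<le> C"
    proof (rule functional_sum_norm_le[OF \<phi> G(1) hC])
      show "(\<Sum>A\<in>\<G>. norm (h A x)) \<le> 1" for x
      proof (cases "\<exists>A0\<in>\<G>. h A0 x \<noteq> 0")
        case True
        then obtain A0 where A0: "A0 \<in> \<G>" "h A0 x \<noteq> 0" by blast
        have "h A x = 0" if A: "A \<in> \<G> - {A0}" for A
        proof (cases x)
          case (Inl n)
          then have n: "n \<in> A0" "L \<le> n" using A0(2) by (auto simp: hInl split: if_splits)
          have "n \<notin> A"
          proof
            assume "n \<in> A"
            then have "n < L2" using Int[of A A0] n(1) A A0(1) by blast
            then show False using n(2) by (simp add: L_def)
          qed
          then show ?thesis by (simp add: Inl hInl)
        next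
          case (Inr B)
          then show ?thesis using A0(2) A by (auto simp: hInr split: if_splits)
        qed
        then have "(\<Sum>A\<in>\<G> - {A0}. norm (h A x)) = 0" by simp
        then have "(\<Sum>A\<in>\<G>. norm (h A x)) = norm (h A0 x)"
          using sum.remove[OF G(1) A0(1), of "\<lambda>A. norm (h A x)"] by simp
        also have "\<dots> \<le> 1" by (cases x) (simp_all add: hInl hInr)
        finally show ?thesis .
      qed simp
    qed
    moreover have "norm (g A) \<le> norm (\<phi> (h A)) + e" if "A \<in> \<G>" for A
    proof -
      have "norm (infsum a (A - {..<L})) < e" by (rule L1) (auto simp: L_def)
      moreover have "g A = \<phi> (h A) - infsum a (A - {..<L})" using \<phi>h[OF that] by simp
      ultimately show ?thesis using norm_triangle_ineq4[of "\<phi> (h A)" "infsum a (A - {..<L})"] by simp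
    qed
    then have "(\<Sum>A\<in>\<G>. norm (g A)) \<le> (\<Sum>A\<in>\<G>. norm (\<phi> (h A)) + e)" by (rule sum_mono)
    moreover have "real (card \<G>) * e \<le> 1" by (simp add: e_def field_simps)
    ultimately show ?thesis by (simp add: sum.distrib)
  qed
  \<comment> \<open>The bound \<open>C + 1\<close> is the same for all finite \<open>\<G>\<close>,
    and an absolutely summable family has only countably many nonzero terms.\<close>
  then have "g abs_summable_on \<A>"
    by (intro nonneg_bdd_above_summable_on) (auto simp: bdd_above_def)
  then have "countable {A \<in> \<A>. g A \<noteq> 0}" by (rule abs_summable_countable)
  then show ?thesis by (simp add: g_def a_def[abs_def])
qed

text \<open>Every \<open>f\<close> is within any \<open>e > 0\<close> of a finite combination of
  functions \<open>chi A\<close> and \<open>unit_at n\<close>, on all of which the functional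
  vanishes.\<close>

lemma functional_eq_zero:
  fixes \<phi> :: "(nat + nat set \<Rightarrow> 'k) \<Rightarrow> 'k::real_normed_field"
  assumes ad: "almost_disjoint \<A>" and \<phi>: "bounded_functional \<A> C \<phi>"
    and u: "\<And>m. \<phi> (unit_at m) = 0" and c: "\<And>A. A \<in> \<A> \<Longrightarrow> \<phi> (chi A) = 0" and f: "f \<in> C0K \<A>"
  shows "\<phi> f = 0"
proof -
  have "norm (\<phi> f) \<le> C * e" if e: "e > 0" for e
  proof -
    obtain \<G> where G: "finite \<G>" "\<G> \<subseteq> \<A>" "\<And>A. A \<notin> \<G> \<Longrightarrow> norm (f (Inr A)) < e"
      "finite {n. e \<le> norm (f (Inl n)) \<and> n \<notin> \<Union>\<G>}" by (rule C0K_finite[OF f e]) blast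
    \<comment> \<open>Adding \<open>s\<close> cancels the values at the limit points of
      \<open>\<G>\<close>. Along these members the sum then tends to 0, which leaves only finitely
      many isolated points with values of size at least \<open>e\<close>.\<close>
    define s where "s = (\<lambda>x. \<Sum>A\<in>\<G>. (- f (Inr A)) * chi A x)"
    have s: "s \<in> C0K \<A>" unfolding s_def using G(1,2)
      by (intro C0K_sum C0K_scale chi_C0K[OF ad]) auto
    have "\<phi> s = (\<Sum>A\<in>\<G>. (- f (Inr A)) * \<phi> (chi A))" unfolding s_def
      using G(2) by (intro functional_sum[OF \<phi> G(1)] chi_C0K[OF ad]) auto
    also have "\<dots> = 0" using G(2) c by (intro sum.neutral) auto
    finally have \<phi>s: "\<phi> s = 0" .
    define g where "g = (\<lambda>x. f x + s x)"
    have g: "g \<in> C0K \<A>" unfolding g_def by (rule C0K_add[OF f s])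
    have gInr: "g (Inr B) = (if B \<in> \<G> then 0 else f (Inr B))" for B
    proof -
      have "s (Inr B) = (\<Sum>A\<in>\<G>. if B = A then - f (Inr A) else 0)"
        unfolding s_def by (intro sum.cong) auto
      then show ?thesis using G(1) by (simp add: g_def)
    qed
    define S where "S = {n. e \<le> norm (g (Inl n))}"
    have "finite S"
    proof -
      have "finite {n \<in> A. e \<le> norm (g (Inl n))}" if "A \<in> \<G>" for A
      proof -
        have "((\<lambda>n. g (Inl n)) \<longlongrightarrow> 0) (along A)" using C0K_D(1)[OF g, of A] that G(2) gInr[of A] by auto
        then show ?thesis using e by (simp add: tendsto_along_dist)
      qed
      then have "finite (\<Union>A\<in>\<G>. {n \<in> A. e \<le> norm (g (Inl n))})" using G(1) by (intro finite_UN_I)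
      then have fin: "finite ((\<Union>A\<in>\<G>. {n \<in> A. e \<le> norm (g (Inl n))}) \<union> {n. e \<le> norm (f (Inl n)) \<and> n \<notin> \<Union>\<G>})"
        using G(4) by simp
      have "g (Inl n) = f (Inl n)" if "n \<notin> \<Union>\<G>" for n
      proof -
        have "s (Inl n) = 0" unfolding s_def by (intro sum.neutral) (use that in auto)
        then show ?thesis by (simp add: g_def)
      qed
      then show ?thesis by (intro finite_subset[OF _ fin]) (auto simp: S_def)
    qed
    \<comment> \<open>\<open>t\<close> cancels the finitely many remaining large values; it vanishes
      at the limit points and so does not disturb the first correction.\<close>
    define t where "t = (\<lambda>x. \<Sum>n\<in>S. (- g (Inl n)) * unit_at n x)"
    have t: "t \<in> C0K \<A>" unfolding t_def using \<open>finite S\<close>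
      by (intro C0K_sum C0K_scale unit_at_C0K) auto
    have "\<phi> t = (\<Sum>n\<in>S. (- g (Inl n)) * \<phi> (unit_at n))" unfolding t_def
      by (rule functional_sum[OF \<phi> \<open>finite S\<close> unit_at_C0K])
    then have \<phi>t: "\<phi> t = 0" by (simp add: u)
    have tInl: "t (Inl n) = (if n \<in> S then - g (Inl n) else 0)" for n
    proof -
      have "t (Inl n) = (\<Sum>m\<in>S. if n = m then - g (Inl m) else 0)"
        unfolding t_def by (intro sum.cong) auto
      then show ?thesis using \<open>finite S\<close> by simp
    qed
    have tInr: "t (Inr B) = 0" for B by (simp add: t_def)
    have "norm (g x + t x) \<le> e" for x
    proof (cases x)
      case (Inl n)
      then show ?thesis using e by (auto simp: tInl S_def)
    next
      case (Inr B)
      then show ?thesis using e G(3)[of B] by (auto simp: tInr gInr)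
    qed
    then have "sup_norm (\<lambda>x. g x + t x) \<le> e" by (rule sup_norm_le)
    then have "C * sup_norm (\<lambda>x. g x + t x) \<le> C * e"
      by (rule mult_left_mono) (rule bounded_functionalD(1)[OF \<phi>])
    moreover have "\<phi> (\<lambda>x. g x + t x) = \<phi> f"
      using bounded_functionalD(2)[OF \<phi> g t] bounded_functionalD(2)[OF \<phi> f s]
      by (simp add: \<phi>s \<phi>t g_def)
    ultimately show ?thesis using bounded_functionalD(4)[OF \<phi> C0K_add[OF g t]] by simp
  qed
  note le = this
  \<comment> \<open>\<open>C\<close> may be 0, hence the denominator \<open>C + 1\<close>.\<close>
  have "norm (\<phi> f) \<le> 0 + d" if "d > 0" for d
  proof -
    have "0 \<le> C" by (rule bounded_functionalD(1)[OF \<phi>])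
    then have "norm (\<phi> f) \<le> C * (d / (C + 1))" using le[of "d / (C + 1)"] that by simp
    also have "\<dots> \<le> d" using \<open>0 \<le> C\<close> that by (simp add: field_simps)
    finally show ?thesis by simp
  qed
  then have "norm (\<phi> f) \<le> 0" by (rule field_le_epsilon)
  then show ?thesis by simp
qed

section \<open>Factorization through \<open>c_0\<close>\<close>

lemma c_0_norm_le: "x \<in> c_0 \<Longrightarrow> norm (x k) \<le> sup_norm x"
  unfolding sup_norm_def
proof (rule cSUP_upper[OF UNIV_I])
  assume "x \<in> c_0"
  then have "Bseq x" unfolding c_0_def by (auto intro: convergent_imp_Bseq convergentI)
  then show "bdd_above (range (\<lambda>k. norm (x k)))" by (auto simp: Bseq_def bdd_above_def)
qed

lemma c_0_iff: "x \<in> c_0 \<longleftrightarrow> (\<forall>e>0. finite {k. e \<le> norm (x k)})"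
proof -
  have "x \<in> c_0 \<longleftrightarrow> (x \<longlongrightarrow> 0) (along UNIV)" by (simp add: c_0_def)
  then show ?thesis unfolding tendsto_along_dist by simp
qed

text \<open>Enumerating \<open>\<W>\<close> by \<open>g\<close>, let \<open>b n\<close> be the first member that contains \<open>n\<close>. The even coordinates
  of an element of \<open>c\<^sub>0\<close> encode its limits along the members of \<open>\<W>\<close>, the odd ones the remainders after
  subtraction of the limit along \<open>b n\<close>. The empty set, which belongs to no almost disjoint family,
  stands for a missing member, where all functions in \<open>C0K \<B>\<close> vanish.\<close>

lemma c_0_factorization:
  fixes S :: "(nat + nat set \<Rightarrow> 'k) \<Rightarrow> (nat + nat set \<Rightarrow> 'k::real_normed_field)"
  assumes ad: "almost_disjoint \<B>" and W: "countable \<W>" "\<W> \<subseteq> \<B>"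
    and S: "bounded_operator (C0K \<A>) (C0K \<B>) S"
    and off: "\<And>f B. f \<in> C0K \<A> \<Longrightarrow> B \<in> \<B> - \<W> \<Longrightarrow> S f (Inr B) = 0"
  shows "factors_through_c_0 (C0K \<A>) (C0K \<B>) S"
proof -
  obtain g :: "nat set \<Rightarrow> nat" where g: "inj_on g \<W>" using W(1) by (auto simp: countable_def)
  have empty: "{} \<notin> \<B>" using almost_disjointD(1)[OF ad] by blast
  define b where "b n = (if \<exists>B\<in>\<W>. n \<in> B then arg_min g (\<lambda>B. B \<in> \<W> \<and> n \<in> B) else {})" for n
  have b: "b n \<in> \<W> \<and> n \<in> b n \<and> g (b n) \<le> g B" if "B \<in> \<W>" "n \<in> B" for n B
    using arg_min_nat_lemma[of "\<lambda>B. B \<in> \<W> \<and> n \<in> B" B g] that by (auto simp: b_def)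
  have b_in: "n \<in> b n" if "b n \<in> \<B>" for n
    using that empty b[of _ n] by (metis b_def)
  have b_notin: "b n \<in> \<W>" if "b n \<in> \<B>" for n
    using that empty b[of _ n] by (metis b_def)
  have fin_below: "finite {B \<in> \<W>. g B < k}" for k
  proof -
    have "finite (g -` {..<k} \<inter> \<W>)" by (rule finite_vimage_IntI[OF _ g]) simp
    then show ?thesis by (rule rev_finite_subset) auto
  qed
  \<comment> \<open>An element of \<open>B\<close> is assigned to another member only if it lies in
    one of the finitely many members enumerated before \<open>B\<close>, each of which meets
    \<open>B\<close> in a finite set.\<close>
  have b_fin1: "finite {n \<in> B. b n \<noteq> B}" if "B \<in> \<W>" for B
  proof (rule finite_subset)
    show "{n \<in> B. b n \<noteq> B} \<subseteq> (\<Union>B'\<in>{B' \<in> \<W>. g B' < g B}. B' \<inter> B)"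
    proof
      fix n assume n: "n \<in> {n \<in> B. b n \<noteq> B}"
      then have "b n \<in> \<W>" "n \<in> b n" "g (b n) \<le> g B" using b[OF that] by blast+
      moreover have "g (b n) \<noteq> g B" using n inj_onD[OF g] \<open>b n \<in> \<W>\<close> that by blast
      ultimately show "n \<in> (\<Union>B'\<in>{B' \<in> \<W>. g B' < g B}. B' \<inter> B)" using n by auto
    qed
    have "finite (B' \<inter> B)" if "B' \<in> {B' \<in> \<W>. g B' < g B}" for B'
      using almost_disjointD(2)[OF ad, of B' B] that \<open>B \<in> \<W>\<close> W(2) by auto
    then show "finite (\<Union>B'\<in>{B' \<in> \<W>. g B' < g B}. B' \<inter> B)" using fin_below by (intro finite_UN_I)
  qed
  have b_fin2: "finite {n \<in> A. b n \<in> \<G>}" if A: "A \<in> \<B>" "A \<notin> \<G>" and \<G>: "\<G> \<subseteq> \<B>" "finite \<G>" for A \<G>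
  proof (rule finite_subset)
    show "{n \<in> A. b n \<in> \<G>} \<subseteq> (\<Union>B\<in>\<G>. A \<inter> B)" using b_in \<G>(1) by blast
    have "finite (A \<inter> B)" if "B \<in> \<G>" for B
      by (rule almost_disjointD(2)[OF ad A(1)]) (use that A \<G> in auto)
    then show "finite (\<Union>B\<in>\<G>. A \<inter> B)" using \<G>(2) by (intro finite_UN_I)
  qed
  define w where "w k = (if k \<in> g ` \<W> then inv_into \<W> g k else {})" for k
  have w: "g (w k) = k \<and> w k \<in> \<W>" if "w k \<in> \<B>" for k
    using that empty by (cases "k \<in> g ` \<W>") (auto simp: w_def f_inv_into_f inv_into_into)
  have wg: "w (g B) = B" if "B \<in> \<W>" for B using that g by (simp add: w_def)
  \<comment> \<open>\<open>\<Phi>\<close> passes to coordinates and \<open>U\<close> rebuilds the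
    function. Both have norm at most 2, and \<open>U (\<Phi> h) = h\<close> for \<open>h\<close> in
    \<open>C0K \<B>\<close> that vanishes at the limit points of members outside
    \<open>\<W>\<close>. With \<open>V\<close> defined as \<open>\<Phi>\<close> after
    \<open>S\<close>, this gives the factorization.\<close>
  define \<Phi> :: "(nat + nat set \<Rightarrow> 'k) \<Rightarrow> nat \<Rightarrow> 'k" where
    "\<Phi> h k = (if even k then h (Inr (w (k div 2))) else h (Inl (k div 2)) - h (Inr (b (k div 2))))" for h k
  define y :: "(nat \<Rightarrow> 'k) \<Rightarrow> nat set \<Rightarrow> 'k" where "y x B = (if B \<in> \<W> then x (2 * g B) else 0)" for x B
  define U :: "(nat \<Rightarrow> 'k) \<Rightarrow> (nat + nat set \<Rightarrow> 'k)" where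
    "U x z = (case z of Inl n \<Rightarrow> x (2 * n + 1) + y x (b n) | Inr B \<Rightarrow> y x B)" for x z
  have \<Phi>_c_0: "\<Phi> h \<in> c_0" if h: "h \<in> C0K \<B>" and hW: "\<And>B. B \<in> \<B> - \<W> \<Longrightarrow> h (Inr B) = 0" for h
    unfolding c_0_iff
  proof (intro allI impI)
    fix e :: real assume e: "e > 0"
    then have e2: "e / 2 > 0" by simp
    obtain \<G> where G: "finite \<G>" "\<G> \<subseteq> \<B>" "\<And>A. A \<notin> \<G> \<Longrightarrow> norm (h (Inr A)) < e / 2"
      "finite {n. e / 2 \<le> norm (h (Inl n)) \<and> n \<notin> \<Union>\<G>}" by (rule C0K_finite[OF h e2]) blast
    define r where "r n = h (Inl n) - h (Inr (b n))" for n
    have r_lt: "norm (r n) < e" if "norm (h (Inl n)) < e / 2" "b n \<notin> \<G>" for n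
      using norm_triangle_ineq4[of "h (Inl n)" "h (Inr (b n))"] that G(3)[of "b n"] by (simp add: r_def)
    have "finite {k. e \<le> norm (h (Inr (w k)))}"
    proof (rule finite_subset)
      show "{k. e \<le> norm (h (Inr (w k)))} \<subseteq> g ` \<G>"
      proof
        fix k assume "k \<in> {k. e \<le> norm (h (Inr (w k)))}"
        then have "w k \<in> \<G>" using G(3)[of "w k"] e by fastforce
        then show "k \<in> g ` \<G>" using w[of k] G(2) by (metis image_eqI subsetD)
      qed
    qed (use G(1) in simp)
    then have even: "finite ((\<lambda>k. 2 * k) ` {k. e \<le> norm (h (Inr (w k)))})" by simp
    have "finite {n \<in> A. e \<le> norm (r n)}" if A: "A \<in> \<G>" for A
    proof (cases "A \<in> \<W>")
      case True
      have "finite {n \<in> A. e \<le> dist (h (Inl n)) (h (Inr A))}"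
        using C0K_D(1)[OF h, of A] A G(2) e by (auto simp: tendsto_along_dist)
      then have "finite ({n \<in> A. b n \<noteq> A} \<union> {n \<in> A. e \<le> dist (h (Inl n)) (h (Inr A))})"
        using b_fin1[OF True] by simp
      then show ?thesis by (rule rev_finite_subset) (auto simp: r_def dist_norm)
    next
      case False
      \<comment> \<open>Along such an \<open>A\<close> the first term of \<open>r n\<close> tends to
        0. The second is small unless \<open>b n\<close> is one of the finitely many sets in
        \<open>\<G> \<inter> \<W>\<close>, each almost disjoint from \<open>A\<close>.\<close>
      then have "A \<in> \<B> - \<W>" using A G(2) by blast
      then have "((\<lambda>n. h (Inl n)) \<longlongrightarrow> 0) (along A)" using C0K_D(1)[OF h, of A] hW[of A] by simp
      then have "finite {n \<in> A. e / 2 \<le> norm (h (Inl n))}" using e2 by (simp only: tendsto_along_dist dist_0_norm norm_conv_dist[symmetric])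
      moreover have "finite {n \<in> A. b n \<in> \<G> \<inter> \<W>}"
        by (rule b_fin2) (use \<open>A \<in> \<B> - \<W>\<close> G(1,2) in auto)
      ultimately have "finite ({n \<in> A. e / 2 \<le> norm (h (Inl n))} \<union> {n \<in> A. b n \<in> \<G> \<inter> \<W>})" by simp
      then show ?thesis
      proof (rule rev_finite_subset)
        show "{n \<in> A. e \<le> norm (r n)} \<subseteq> {n \<in> A. e / 2 \<le> norm (h (Inl n))} \<union> {n \<in> A. b n \<in> \<G> \<inter> \<W>}"
          using r_lt b_notin G(2) by (auto simp: not_le[symmetric])
      qed
    qed
    then have "finite (\<Union>A\<in>\<G>. {n \<in> A. e \<le> norm (r n)})" using G(1) by (intro finite_UN_I)
    then have "finite ((\<Union>A\<in>\<G>. {n \<in> A. e \<le> norm (r n)}) \<union> {n. e / 2 \<le> norm (h (Inl n)) \<and> n \<notin> \<Union>\<G>})"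
      using G(4) by simp
    then have "finite {n. e \<le> norm (r n)}"
    proof (rule rev_finite_subset)
      show "{n. e \<le> norm (r n)} \<subseteq> (\<Union>A\<in>\<G>. {n \<in> A. e \<le> norm (r n)}) \<union> {n. e / 2 \<le> norm (h (Inl n)) \<and> n \<notin> \<Union>\<G>}"
      proof
        fix n assume n: "n \<in> {n. e \<le> norm (r n)}"
        show "n \<in> (\<Union>A\<in>\<G>. {n \<in> A. e \<le> norm (r n)}) \<union> {n. e / 2 \<le> norm (h (Inl n)) \<and> n \<notin> \<Union>\<G>}"
        proof (cases "n \<in> \<Union>\<G>")
          case False
          then have "b n \<notin> \<G>" using b_in[of n] G(2) by blast
          then have "e / 2 \<le> norm (h (Inl n))" using r_lt[of n] n by force
          then show ?thesis using False by blast
        qed (use n in blast)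
      qed
    qed
    then have "finite ((\<lambda>k. 2 * k + 1) ` {n. e \<le> norm (r n)})" by simp
    with even have "finite ((\<lambda>k. 2 * k) ` {k. e \<le> norm (h (Inr (w k)))} \<union> (\<lambda>k. 2 * k + 1) ` {n. e \<le> norm (r n)})"
      by simp
    then show "finite {k. e \<le> norm (\<Phi> h k)}"
    proof (rule rev_finite_subset)
      show "{k. e \<le> norm (\<Phi> h k)} \<subseteq> (\<lambda>k. 2 * k) ` {k. e \<le> norm (h (Inr (w k)))} \<union> (\<lambda>k. 2 * k + 1) ` {n. e \<le> norm (r n)}"
      proof
        fix k assume k: "k \<in> {k. e \<le> norm (\<Phi> h k)}"
        show "k \<in> (\<lambda>k. 2 * k) ` {k. e \<le> norm (h (Inr (w k)))} \<union> (\<lambda>k. 2 * k + 1) ` {n. e \<le> norm (r n)}"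
        proof (cases "even k")
          case True
          then have "k = 2 * (k div 2)" "k div 2 \<in> {k. e \<le> norm (h (Inr (w k)))}" using k by (simp_all add: \<Phi>_def)
          then show ?thesis by blast
        next
          case False
          then have "k = 2 * (k div 2) + 1" "k div 2 \<in> {n. e \<le> norm (r n)}" using k by (simp_all add: \<Phi>_def r_def)
          then show ?thesis by blast
        qed
      qed
    qed
  qed
  have U_C0K: "U x \<in> C0K \<B>" if x: "x \<in> c_0" for x
  proof -
    define \<G> where "\<G> e = {B \<in> \<W>. e \<le> norm (x (2 * g B))}" for e
    have x_fin: "finite {k. e \<le> norm (x k)}" if "e > 0" for e using x that by (simp add: c_0_iff)
    have G_fin: "finite (\<G> e)" if "e > 0" for e
    proof -
      have "inj_on (\<lambda>B. 2 * g B) \<W>" using g by (auto simp: inj_on_def)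
      then have "finite ((\<lambda>B. 2 * g B) -` {k. e \<le> norm (x k)} \<inter> \<W>)"
        by (rule finite_vimage_IntI[OF x_fin[OF that]])
      then show ?thesis by (rule rev_finite_subset) (auto simp: \<G>_def)
    qed
    have odd_fin: "finite {n. e \<le> norm (x (2 * n + 1))}" if "e > 0" for e
    proof -
      have "finite ((\<lambda>n. 2 * n + 1) -` {k. e \<le> norm (x k)})"
        by (rule finite_vimageI[OF x_fin[OF that]]) (simp add: inj_on_def)
      then show ?thesis by (rule rev_finite_subset) auto
    qed
    have y_lt: "norm (y x B) < e" if "B \<notin> \<G> e" "e > 0" for B e
      using that by (auto simp: y_def \<G>_def not_le)
    have sum_lt: "norm (x (2 * n + 1) + y x (b n)) < e"
      if "norm (x (2 * n + 1)) < e / 2" "b n \<notin> \<G> (e / 2)" "e > 0" for n e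
      using norm_triangle_ineq[of "x (2 * n + 1)" "y x (b n)"] y_lt[of "b n" "e / 2"] that by simp
    show ?thesis unfolding C0K_def
    proof (intro CollectI conjI ballI allI impI)
      fix A assume A: "A \<in> \<B>"
      show "((\<lambda>n. U x (Inl n)) \<longlongrightarrow> U x (Inr A)) (along A)"
        unfolding tendsto_along_dist
      proof (intro allI impI)
        fix e :: real assume e: "e > 0"
        show "finite {n \<in> A. e \<le> dist (U x (Inl n)) (U x (Inr A))}"
        proof (cases "A \<in> \<W>")
          case True
          have "finite ({n \<in> A. b n \<noteq> A} \<union> {n. e \<le> norm (x (2 * n + 1))})"
            using b_fin1[OF True] odd_fin[OF e] by simp
          then show ?thesis by (rule rev_finite_subset) (auto simp: U_def dist_norm)
        next
          case False
          have "finite {n \<in> A. b n \<in> \<G> (e / 2)}"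
            by (rule b_fin2[OF A]) (use False W(2) G_fin[of "e / 2"] e in \<open>auto simp: \<G>_def\<close>)
          then have "finite ({n \<in> A. b n \<in> \<G> (e / 2)} \<union> {n. e / 2 \<le> norm (x (2 * n + 1))})"
            using odd_fin[of "e / 2"] e by simp
          then show ?thesis
          proof (rule rev_finite_subset)
            have "U x (Inr A) = 0" using False by (simp add: U_def y_def)
            then show "{n \<in> A. e \<le> dist (U x (Inl n)) (U x (Inr A))}
              \<subseteq> {n \<in> A. b n \<in> \<G> (e / 2)} \<union> {n. e / 2 \<le> norm (x (2 * n + 1))}"
              using sum_lt e by (auto simp: U_def not_le[symmetric])
          qed
        qed
      qed
    next
      fix e :: real assume e: "e > 0"
      have e2: "e / 2 > 0" using e by simp
      show "\<exists>\<G>. finite \<G> \<and> \<G> \<subseteq> \<B> \<and> (\<forall>A\<in>\<B>-\<G>. norm (U x (Inr A)) < e) \<and> finite {n. e \<le> norm (U x (Inl n)) \<and> n \<notin> \<Union>\<G>}"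
      proof (intro exI[of _ "\<G> (e / 2)"] conjI ballI)
        show "finite (\<G> (e / 2))" by (rule G_fin[OF e2])
        show GB: "\<G> (e / 2) \<subseteq> \<B>" using W(2) by (auto simp: \<G>_def)
        show "norm (U x (Inr A)) < e" if "A \<in> \<B> - \<G> (e / 2)" for A
          using y_lt[OF _ e2, of A] that e by (simp add: U_def)
        show "finite {n. e \<le> norm (U x (Inl n)) \<and> n \<notin> \<Union>(\<G> (e / 2))}"
        proof (rule finite_subset[OF _ odd_fin[OF e2]], rule subsetI)
          fix n assume n: "n \<in> {n. e \<le> norm (U x (Inl n)) \<and> n \<notin> \<Union>(\<G> (e / 2))}"
          then have "b n \<notin> \<G> (e / 2)" using b_in[of n] GB by blast
          then show "n \<in> {n. e / 2 \<le> norm (x (2 * n + 1))}"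
            using sum_lt[of n e] n e by (auto simp: U_def not_le[symmetric])
        qed
      qed
    next
      fix A assume "A \<notin> \<B>"
      then show "U x (Inr A) = 0" using W(2) by (auto simp: U_def y_def)
    qed
  qed
  have S_lin: "linear_map (C0K \<A>) (C0K \<B>) S" using S by (simp add: bounded_operator_def)
  have SC: "S f \<in> C0K \<B>" if "f \<in> C0K \<A>" for f using S_lin that by (auto simp: linear_map_def)
  obtain K where K: "\<And>f. f \<in> C0K \<A> \<Longrightarrow> sup_norm (S f) \<le> K * sup_norm f"
    using S by (auto simp: bounded_operator_def)
  define V where "V f = \<Phi> (S f)" for f
  have "bounded_operator (C0K \<A>) c_0 V"
    unfolding bounded_operator_def linear_map_def
  proof (intro conjI ballI allI funcsetI exI[of _ "2 * K"])
    show "V f \<in> c_0" if "f \<in> C0K \<A>" for f unfolding V_def using \<Phi>_c_0 SC off that by blast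
    show "V (\<lambda>x. f x + h x) = (\<lambda>k. V f k + V h k)" if "f \<in> C0K \<A>" "h \<in> C0K \<A>" for f h
    proof -
      have "S (\<lambda>x. f x + h x) = (\<lambda>z. S f z + S h z)" using S_lin that by (simp add: linear_map_def)
      then show ?thesis by (auto simp: V_def \<Phi>_def fun_eq_iff)
    qed
    show "V (\<lambda>x. c * f x) = (\<lambda>k. c * V f k)" if "f \<in> C0K \<A>" for f c
    proof -
      have "S (\<lambda>x. c * f x) = (\<lambda>z. c * S f z)" using S_lin that by (simp add: linear_map_def)
      then show ?thesis by (auto simp: V_def \<Phi>_def fun_eq_iff algebra_simps)
    qed
    show "sup_norm (V f) \<le> 2 * K * sup_norm f" if f: "f \<in> C0K \<A>" for f
    proof (rule sup_norm_le)
      fix k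
      have n: "norm (S f z) \<le> sup_norm (S f)" for z by (rule norm_le_sup_norm[OF SC[OF f]])
      have "norm (V f k) \<le> 2 * sup_norm (S f)"
      proof (cases "even k")
        case True
        then show ?thesis using n[of "Inr (w (k div 2))"] sup_norm_nonneg[OF SC[OF f]] by (simp add: V_def \<Phi>_def)
      next
        case False
        then show ?thesis
          using norm_triangle_ineq4[of "S f (Inl (k div 2))" "S f (Inr (b (k div 2)))"] n[of "Inl (k div 2)"] n[of "Inr (b (k div 2))"]
          by (simp add: V_def \<Phi>_def)
      qed
      then show "norm (V f k) \<le> 2 * K * sup_norm f" using K[OF f] by simp
    qed
  qed
  moreover have "bounded_operator c_0 (C0K \<B>) U"
    unfolding bounded_operator_def linear_map_def
  proof (intro conjI ballI allI funcsetI exI[of _ 2])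
    show "U x \<in> C0K \<B>" if "x \<in> c_0" for x by (rule U_C0K[OF that])
    show "U (\<lambda>k. x k + x' k) = (\<lambda>z. U x z + U x' z)" for x x'
      by (auto simp: U_def y_def fun_eq_iff split: sum.splits)
    show "U (\<lambda>k. c * x k) = (\<lambda>z. c * U x z)" for x c
      by (auto simp: U_def y_def fun_eq_iff algebra_simps split: sum.splits)
    show "sup_norm (U x) \<le> 2 * sup_norm x" if x: "x \<in> c_0" for x
    proof (rule sup_norm_le)
      fix z
      have n: "norm (x k) \<le> sup_norm x" for k by (rule c_0_norm_le[OF x])
      have nn: "0 \<le> sup_norm x" by (rule order_trans[OF norm_ge_zero n])
      have ny: "norm (y x B) \<le> sup_norm x" for B using n nn by (simp add: y_def)
      show "norm (U x z) \<le> 2 * sup_norm x"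
      proof (cases z)
        case (Inl m)
        then show ?thesis using norm_triangle_ineq[of "x (2 * m + 1)" "y x (b m)"] n[of "2 * m + 1"] ny[of "b m"]
          by (simp add: U_def)
      next
        case (Inr B)
        then show ?thesis using ny[of B] nn by (simp add: U_def)
      qed
    qed
  qed
  moreover have "S f = U (V f)" if f: "f \<in> C0K \<A>" for f
  proof
    have yV: "y (V f) B = S f (Inr B)" for B
    proof (cases "B \<in> \<W>")
      case True
      then show ?thesis by (simp add: y_def V_def \<Phi>_def wg)
    next
      case False
      then have "S f (Inr B) = 0" using off[OF f, of B] C0K_D(2)[OF SC[OF f], of B] by blast
      then show ?thesis using False by (simp add: y_def)
    qed
    show "S f z = U (V f) z" for z
      by (cases z) (simp_all add: U_def yV, simp add: V_def \<Phi>_def)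
  qed
  ultimately show ?thesis unfolding factors_through_c_0_def by blast
qed

section \<open>Operators and their matrices\<close>

text \<open>The two points may coincide. Having a cluster point forces each member to be infinite,
  and disjoint cluster sets make the family almost disjoint.\<close>

definition two_point_family :: "nat set set \<Rightarrow> bool" where
  "two_point_family \<D> \<longleftrightarrow> (\<forall>B\<in>\<D>. \<exists>p q. clusters B = {p, q}) \<and>
     pairwise (\<lambda>A B. clusters A \<inter> clusters B = {}) \<D>"

lemma two_point_familyE:
  assumes "two_point_family \<D>" "B \<in> \<D>"
  obtains p q where "clusters B = {p, q}"
  using assms by (auto simp: two_point_family_def)

lemma two_point_family_subset: "two_point_family \<D> \<Longrightarrow> \<A> \<subseteq> \<D> \<Longrightarrow> two_point_family \<A>"
  unfolding two_point_family_def by (meson pairwise_subset subsetD)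

lemma two_point_family_almost_disjoint:
  assumes "two_point_family \<D>"
  shows "almost_disjoint \<D>"
  unfolding almost_disjoint_def pairwise_def
proof (intro conjI ballI impI)
  show "infinite B" if "B \<in> \<D>" for B
  proof
    assume "finite B"
    then have "clusters B = {}" by (rule clusters_eq_empty)
    moreover have "\<exists>p q. clusters B = {p, q}" using assms that by (simp add: two_point_family_def)
    ultimately show False by auto
  qed
  show "finite (A \<inter> B)" if "A \<in> \<D>" "B \<in> \<D>" "A \<noteq> B" for A B
    using assms that by (intro finite_Int_if_clusters_disjoint) (simp add: two_point_family_def pairwise_def)
qed

text \<open>Cluster sets of distinct members are disjoint, so choosing for each member a cluster
  point in \<open>Z\<close> is injective. Countable exceptional sets of reals thus become countable
  exceptional families.\<close>

lemma countable_clusters_meet: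
  assumes D: "two_point_family \<D>" and Z: "countable Z"
  shows "countable {B \<in> \<D>. clusters B \<inter> Z \<noteq> {}}"
proof -
  define f where "f B = (SOME z. z \<in> clusters B \<inter> Z)" for B
  have f: "f B \<in> clusters B \<inter> Z" if "B \<in> {B \<in> \<D>. clusters B \<inter> Z \<noteq> {}}" for B
    unfolding f_def by (rule someI_ex) (use that in blast)
  have "inj_on f {B \<in> \<D>. clusters B \<inter> Z \<noteq> {}}"
  proof (rule inj_onI, rule ccontr)
    fix A B assume A: "A \<in> {B \<in> \<D>. clusters B \<inter> Z \<noteq> {}}" and B: "B \<in> {B \<in> \<D>. clusters B \<inter> Z \<noteq> {}}"
      and eq: "f A = f B" "A \<noteq> B"
    have "clusters A \<inter> clusters B = {}"
      using D A B eq(2) by (simp add: two_point_family_def pairwise_def)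
    then show False using f[OF A] f[OF B] eq(1) by auto
  qed
  moreover have "countable (f ` {B \<in> \<D>. clusters B \<inter> Z \<noteq> {}})"
    by (rule countable_subset[OF _ Z]) (use f in blast)
  ultimately show ?thesis by (rule countable_image_inj_on[rotated])
qed

lemma C0K_countable_support:
  assumes "f \<in> C0K \<A>"
  shows "countable {B. f (Inr B) \<noteq> 0}"
proof -
  have "\<exists>\<G>. finite \<G> \<and> (\<forall>A. A \<notin> \<G> \<longrightarrow> norm (f (Inr A)) < inverse (real (Suc j)))" for j
    by (rule C0K_finite[OF assms, of "inverse (real (Suc j))"]) (simp, blast)
  then obtain \<G> where G: "\<And>j. finite (\<G> j)" "\<And>j A. A \<notin> \<G> j \<Longrightarrow> norm (f (Inr A)) < inverse (real (Suc j))"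
    by metis
  have "{B. f (Inr B) \<noteq> 0} \<subseteq> (\<Union>j. \<G> j)"
  proof
    fix B assume "B \<in> {B. f (Inr B) \<noteq> 0}"
    then have "norm (f (Inr B)) > 0" by simp
    then obtain j where "inverse (real (Suc j)) < norm (f (Inr B))" using reals_Archimedean by blast
    then have "B \<in> \<G> j" using G(2)[of B j] by fastforce
    then show "B \<in> (\<Union>j. \<G> j)" by blast
  qed
  moreover have "countable (\<Union>j. \<G> j)" using G(1) by (intro countable_UN) (auto intro: countable_finite)
  ultimately show ?thesis by (rule countable_subset)
qed

lemma operator_functional:
  assumes "bounded_operator (C0K \<A>) (C0K \<B>) T"
  obtains C where "\<And>z. bounded_functional \<A> C (\<lambda>f. T f z)"
proof -
  obtain K where K: "\<And>f. f \<in> C0K \<A> \<Longrightarrow> sup_norm (T f) \<le> K * sup_norm f"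
    and lin: "linear_map (C0K \<A>) (C0K \<B>) T" using assms by (auto simp: bounded_operator_def)
  have "bounded_functional \<A> (max 0 K) (\<lambda>f. T f z)" for z
    unfolding bounded_functional_def
  proof (intro conjI ballI allI)
    show "norm (T f z) \<le> max 0 K * sup_norm f" if f: "f \<in> C0K \<A>" for f
    proof -
      have "T f \<in> C0K \<B>" using lin f by (auto simp: linear_map_def)
      then have "norm (T f z) \<le> sup_norm (T f)" by (rule norm_le_sup_norm)
      also have "\<dots> \<le> K * sup_norm f" by (rule K[OF f])
      also have "\<dots> \<le> max 0 K * sup_norm f" using sup_norm_nonneg[OF f] by (intro mult_right_mono) auto
      finally show ?thesis .
    qed
  qed (use lin in \<open>auto simp: linear_map_def\<close>)
  then show ?thesis by (rule that)
qed

definition matrix_of :: "((nat + nat set \<Rightarrow> 'k) \<Rightarrow> (nat + nat set \<Rightarrow> 'k)) \<Rightarrow> nat \<Rightarrow> nat \<Rightarrow> 'k::real_normed_field" where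
  "matrix_of T n m = T (unit_at m) (Inl n)"

lemma clusters_Union_finite: "finite \<G> \<Longrightarrow> clusters (\<Union>\<G>) = (\<Union>A\<in>\<G>. clusters A)"
  by (induction \<G> rule: finite_induct) (simp_all add: clusters_Un clusters_eq_empty)

lemma matrix_of_admissible:
  fixes T :: "(nat + nat set \<Rightarrow> 'k) \<Rightarrow> (nat + nat set \<Rightarrow> 'k::{real_normed_field, banach})"
  assumes T: "bounded_operator (C0K \<A>) (C0K \<B>) T" and B: "two_point_family \<B>"
  shows "admissible (matrix_of T)"
  unfolding admissible_def
proof (intro conjI allI)
  obtain C where C: "\<And>z. bounded_functional \<A> C (\<lambda>f. T f z)" using operator_functional[OF T] by blast
  show "matrix_of T n abs_summable_on UNIV" for n
    using functional_units_summable[OF C[of "Inl n"]] by (simp add: matrix_of_def[abs_def])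
  show "\<exists>R. \<forall>n. norm (matrix_of T n n) \<le> R"
  proof (intro exI[of _ C] allI)
    fix n
    have "sup_norm (unit_at n :: nat + nat set \<Rightarrow> 'k) \<le> 1" by (rule sup_norm_le) (simp add: unit_at_def)
    then have "C * sup_norm (unit_at n :: nat + nat set \<Rightarrow> 'k) \<le> C * 1"
      by (rule mult_left_mono) (rule bounded_functionalD(1)[OF C])
    then show "norm (matrix_of T n n) \<le> C"
      using bounded_functionalD(4)[OF C[of "Inl n"] unit_at_C0K[of n]] by (simp add: matrix_of_def)
  qed
  have "countable (clusters {n. inverse (real (Suc j)) \<le> norm (matrix_of T n m)})" for m j
  proof -
    have "T (unit_at m) \<in> C0K \<B>" using T unit_at_C0K by (auto simp: bounded_operator_def linear_map_def)
    then obtain \<G> where G: "finite \<G>" "\<G> \<subseteq> \<B>" "\<And>A. A \<notin> \<G> \<Longrightarrow> norm (T (unit_at m) (Inr A)) < inverse (real (Suc j))"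
      "finite {n. inverse (real (Suc j)) \<le> norm (T (unit_at m) (Inl n)) \<and> n \<notin> \<Union>\<G>}" (is "finite ?S")
      by (rule C0K_finite[where e = "inverse (real (Suc j))"]) (simp, blast)
    \<comment> \<open>The large entries of a column lie in finitely many members up to a finite set,
      so their cluster points are among the at most two points of each of these members.\<close>
    have "{n. inverse (real (Suc j)) \<le> norm (matrix_of T n m)} \<subseteq> \<Union>\<G> \<union> ?S"
      by (auto simp: matrix_of_def)
    then have "clusters {n. inverse (real (Suc j)) \<le> norm (matrix_of T n m)} \<subseteq> clusters (\<Union>\<G> \<union> ?S)"
      by (rule clusters_mono)
    also have "clusters (\<Union>\<G> \<union> ?S) = (\<Union>A\<in>\<G>. clusters A)"
      by (simp only: clusters_Un clusters_eq_empty[OF G(4)] clusters_Union_finite[OF G(1)] Un_empty_right)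
    finally have sub: "clusters {n. inverse (real (Suc j)) \<le> norm (matrix_of T n m)} \<subseteq> (\<Union>A\<in>\<G>. clusters A)" .
    have "finite (clusters A)" if "A \<in> \<G>" for A
    proof -
      have "A \<in> \<B>" using that G(2) by blast
      then show ?thesis by (rule two_point_familyE[OF B]) simp
    qed
    then have "finite (\<Union>A\<in>\<G>. clusters A)" using G(1) by (intro finite_UN_I)
    then show ?thesis using sub countable_finite countable_subset by blast
  qed
  then show "countable (column_clusters (matrix_of T))"
    unfolding column_clusters_def by (intro countable_UN) auto
qed

lemma matrix_of_chi:
  fixes T :: "(nat + nat set \<Rightarrow> 'k) \<Rightarrow> (nat + nat set \<Rightarrow> 'k::{real_normed_field, banach})"
  assumes ad: "almost_disjoint \<A>" and T: "bounded_operator (C0K \<A>) (C0K \<B>) T"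
  shows "countable {A \<in> \<A>. \<exists>n. T (chi A) (Inl n) \<noteq> infsum (matrix_of T n) A}"
proof -
  obtain C where C: "\<And>z. bounded_functional \<A> C (\<lambda>f. T f z)" using operator_functional[OF T] by blast
  have "countable (\<Union>n. {A \<in> \<A>. T (chi A) (Inl n) \<noteq> infsum (\<lambda>m. T (unit_at m) (Inl n)) A})"
    by (intro countable_UN functional_chi[OF ad C]) simp
  then show ?thesis
    by (rule countable_subset[rotated]) (auto simp: matrix_of_def[abs_def])
qed

lemma operator_minus_scalar:
  fixes T :: "(nat + nat set \<Rightarrow> 'k) \<Rightarrow> (nat + nat set \<Rightarrow> 'k::real_normed_field)"
  assumes T: "bounded_operator (C0K \<A>) (C0K \<B>) T"
    and C0: "\<And>f. f \<in> C0K \<A> \<Longrightarrow> (\<lambda>x. T f x - l * f x) \<in> C0K \<B>"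
  shows "bounded_operator (C0K \<A>) (C0K \<B>) (\<lambda>f x. T f x - l * f x)"
proof -
  obtain K where K: "\<And>f. f \<in> C0K \<A> \<Longrightarrow> sup_norm (T f) \<le> K * sup_norm f"
    and lin: "linear_map (C0K \<A>) (C0K \<B>) T" using T by (auto simp: bounded_operator_def)
  show ?thesis
    unfolding bounded_operator_def linear_map_def
  proof (intro conjI ballI allI funcsetI exI[of _ "K + norm l"])
    show "(\<lambda>x. T f x - l * f x) \<in> C0K \<B>" if "f \<in> C0K \<A>" for f by (rule C0[OF that])
    show "(\<lambda>x. T (\<lambda>x. f x + g x) x - l * (f x + g x)) = (\<lambda>y. (T f y - l * f y) + (T g y - l * g y))"
      if "f \<in> C0K \<A>" "g \<in> C0K \<A>" for f g
      using lin that by (simp add: linear_map_def algebra_simps)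
    show "(\<lambda>x. T (\<lambda>x. c * f x) x - l * (c * f x)) = (\<lambda>y. c * (T f y - l * f y))" if "f \<in> C0K \<A>" for f c
      using lin that by (simp add: linear_map_def algebra_simps)
    show "sup_norm (\<lambda>x. T f x - l * f x) \<le> (K + norm l) * sup_norm f" if f: "f \<in> C0K \<A>" for f
    proof (rule sup_norm_le)
      fix x
      have "T f \<in> C0K \<B>" using lin f by (auto simp: linear_map_def)
      then have "norm (T f x) \<le> sup_norm (T f)" by (rule norm_le_sup_norm)
      moreover have "norm (l * f x) \<le> norm l * sup_norm f"
        unfolding norm_mult by (intro mult_left_mono norm_le_sup_norm[OF f]) simp
      ultimately show "norm (T f x - l * f x) \<le> (K + norm l) * sup_norm f"
        using K[OF f] norm_triangle_ineq4[of "T f x" "l * f x"] by (simp add: distrib_right)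
    qed
  qed
qed

text \<open>By density it suffices to find a countable \<open>\<W>\<close> such that the images of
  all \<open>unit_at m\<close> and \<open>chi A\<close> vanish at the limit points of members
  outside \<open>\<W>\<close>. For \<open>chi A\<close> with \<open>A\<close> generic this holds
  because, by \<open>survivor_tendsto\<close>, its image tends to 0 along every \<open>B\<close>
  that avoids the exceptional points, and by continuity the limit is the value at
  \<open>Inr B\<close>.\<close>

lemma survivor_factors:
  fixes T :: "(nat + nat set \<Rightarrow> 'k) \<Rightarrow> (nat + nat set \<Rightarrow> 'k::{real_normed_field, banach})"
  assumes A: "two_point_family \<A>" and B: "two_point_family \<B>"
    and T: "bounded_operator (C0K \<A>) (C0K \<B>) T"
    and l: "survivor (matrix_of T) l"
    and C0: "\<And>f. f \<in> C0K \<A> \<Longrightarrow> (\<lambda>x. T f x - l * f x) \<in> C0K \<B>"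
  shows "factors_through_c_0 (C0K \<A>) (C0K \<B>) (\<lambda>f x. T f x - l * f x)"
proof -
  let ?M = "matrix_of T" and ?S = "\<lambda>f x. T f x - l * f x"
  note adA = two_point_family_almost_disjoint[OF A]
  note adB = two_point_family_almost_disjoint[OF B]
  have adm: "admissible ?M" by (rule matrix_of_admissible[OF T B])
  then have sm: "?M n abs_summable_on UNIV" for n by (simp add: admissible_def)
  define Z where "Z = column_clusters ?M \<union> offdiag_set ?M \<union> diag_clusters ?M l"
  have Z: "countable Z" using adm l by (simp add: Z_def admissible_def survivor_def)
  define X where "X = {A \<in> \<A>. \<exists>n. T (chi A) (Inl n) \<noteq> infsum (?M n) A} \<union> {A \<in> \<A>. clusters A \<inter> Z \<noteq> {}}"
  have X: "countable X" unfolding X_def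
    using matrix_of_chi[OF adA T] countable_clusters_meet[OF A Z] by simp
  \<comment> \<open>Three countable contributions: members with an exceptional cluster point,
    supports of the images of the units, and supports of the images of \<open>chi A\<close> for the
    countably many non-generic \<open>A\<close>.\<close>
  define \<W> where "\<W> = {B \<in> \<B>. clusters B \<inter> Z \<noteq> {}} \<union> (\<B> \<inter> (\<Union>m. {B. ?S (unit_at m) (Inr B) \<noteq> 0}))
    \<union> (\<B> \<inter> (\<Union>A\<in>X. {B. ?S (chi A) (Inr B) \<noteq> 0}))"
  have XA: "X \<subseteq> \<A>" by (auto simp: X_def)
  have W: "countable \<W>"
  proof -
    have "countable (\<Union>m. {B. ?S (unit_at m) (Inr B) \<noteq> 0})"
      by (intro countable_UN C0K_countable_support[OF C0] unit_at_C0K) simp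
    moreover have "countable (\<Union>A\<in>X. {B. ?S (chi A) (Inr B) \<noteq> 0})"
      using XA by (intro countable_UN X C0K_countable_support[OF C0] chi_C0K[OF adA]) auto
    ultimately show ?thesis
      unfolding \<W>_def using countable_clusters_meet[OF B Z] by (intro countable_Un countable_Int2) auto
  qed
  have S: "bounded_operator (C0K \<A>) (C0K \<B>) ?S" by (rule operator_minus_scalar[OF T C0])
  obtain C where C: "\<And>z. bounded_functional \<A> C (\<lambda>f. ?S f z)" using operator_functional[OF S] by blast
  show ?thesis
  proof (rule c_0_factorization[OF adB W _ S])
    show "\<W> \<subseteq> \<B>" by (auto simp: \<W>_def)
    fix f :: "nat + nat set \<Rightarrow> 'k" and B assume f: "f \<in> C0K \<A>" and B': "B \<in> \<B> - \<W>"
    show "?S f (Inr B) = 0"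
    proof (rule functional_eq_zero[OF adA C _ _ f])
      show "?S (unit_at m) (Inr B) = 0" for m using B' unfolding \<W>_def by blast
      show "?S (chi A') (Inr B) = 0" if A': "A' \<in> \<A>" for A'
      proof (cases "A' \<in> X")
        case True
        then show ?thesis using B' unfolding \<W>_def by blast
      next
        case False
        then have eq: "\<And>n. T (chi A') (Inl n) = infsum (?M n) A'" and cA: "clusters A' \<inter> Z = {}"
          using A' unfolding X_def by blast+
        have cB: "clusters B \<inter> Z = {}" using B' unfolding \<W>_def by blast
        obtain p q where pq: "clusters A' = {p, q}" using A A' by (rule two_point_familyE)
        have "((\<lambda>n. infsum (?M n) A' - (if n \<in> A' then l else 0)) \<longlongrightarrow> 0) (along B)"
          using cA cB pq by (intro survivor_tendsto[where p = p and q = q] sm) (auto simp: Z_def)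
        moreover have "infsum (?M n) A' - (if n \<in> A' then l else 0) = ?S (chi A') (Inl n)" for n
          by (simp add: eq)
        ultimately have "((\<lambda>n. ?S (chi A') (Inl n)) \<longlongrightarrow> 0) (along B)" by simp
        moreover have "((\<lambda>n. ?S (chi A') (Inl n)) \<longlongrightarrow> ?S (chi A') (Inr B)) (along B)"
          using C0K_D(1)[OF C0[OF chi_C0K[OF adA A']], of B] B' by blast
        moreover have "along B \<noteq> bot" using almost_disjointD(1)[OF adB] B' by (auto simp: along_eq_bot_iff)
        ultimately show ?thesis using tendsto_unique by blast
      qed
    qed
  qed
qed

text \<open>Uncountably many members of \<open>\<A>\<close> are missing from \<open>\<B>\<close>, so
  a generic one \<open>A'\<close> exists. The image of \<open>chi A'\<close> tends to 0 along
  \<open>A'\<close>, which is almost disjoint from all of \<open>\<B>\<close>, whereas the matrix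
  makes it tend to \<open>l\<close> there.\<close>

lemma survivor_scalar_eq_zero:
  fixes T :: "(nat + nat set \<Rightarrow> 'k) \<Rightarrow> (nat + nat set \<Rightarrow> 'k::{real_normed_field, banach})"
  assumes D: "two_point_family \<D>" "\<A> \<subseteq> \<D>" "\<B> \<subseteq> \<D>"
    and T: "bounded_operator (C0K \<A>) (C0K \<B>) T"
    and l: "survivor (matrix_of T) l"
    and unc: "uncountable (\<A> - \<B>)"
  shows "l = 0"
proof -
  let ?M = "matrix_of T"
  note A = two_point_family_subset[OF D(1,2)]
  note B = two_point_family_subset[OF D(1,3)]
  note adD = two_point_family_almost_disjoint[OF D(1)]
  note adA = two_point_family_almost_disjoint[OF A]
  have adm: "admissible ?M" by (rule matrix_of_admissible[OF T B])
  then have sm: "?M n abs_summable_on UNIV" for n by (simp add: admissible_def)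
  define Z where "Z = column_clusters ?M \<union> offdiag_set ?M \<union> diag_clusters ?M l"
  have Z: "countable Z" using adm l by (simp add: Z_def admissible_def survivor_def)
  have "countable ({A \<in> \<A>. \<exists>n. T (chi A) (Inl n) \<noteq> infsum (?M n) A} \<union> {A \<in> \<A>. clusters A \<inter> Z \<noteq> {}})"
    using matrix_of_chi[OF adA T] countable_clusters_meet[OF A Z] by simp
  then have "\<not> \<A> - \<B> \<subseteq> {A \<in> \<A>. \<exists>n. T (chi A) (Inl n) \<noteq> infsum (?M n) A} \<union> {A \<in> \<A>. clusters A \<inter> Z \<noteq> {}}"
    using unc countable_subset by blast
  then obtain A' where A': "A' \<in> \<A>" "A' \<notin> \<B>" "\<And>n. T (chi A') (Inl n) = infsum (?M n) A'" "clusters A' \<inter> Z = {}"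
    by blast
  obtain p q where pq: "clusters A' = {p, q}" using A A'(1) by (rule two_point_familyE)
  have "((\<lambda>n. infsum (?M n) A' - (if n \<in> A' then l else 0)) \<longlongrightarrow> 0) (along A')"
    using A'(4) pq by (intro survivor_tendsto[where p = p and q = q] sm) (auto simp: Z_def)
  moreover have "((\<lambda>n. infsum (?M n) A') \<longlongrightarrow> 0) (along A')"
  proof -
    have "T (chi A') \<in> C0K \<B>" using T chi_C0K[OF adA A'(1)] by (auto simp: bounded_operator_def linear_map_def)
    then have "((\<lambda>n. T (chi A') (Inl n)) \<longlongrightarrow> 0) (along A')"
    proof (rule C0K_tendsto_zero)
      show "finite (A' \<inter> B)" if "B \<in> \<B>" for B
        by (rule almost_disjointD(2)[OF adD]) (use that A' D in auto)
    qed
    then show ?thesis by (simp add: A'(3))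
  qed
  ultimately have "((\<lambda>n. infsum (?M n) A' - (infsum (?M n) A' - (if n \<in> A' then l else 0))) \<longlongrightarrow> 0 - 0) (along A')"
    by (intro tendsto_diff)
  then have "((\<lambda>n. if n \<in> A' then l else 0) \<longlongrightarrow> 0) (along A')" by simp
  moreover have "\<forall>\<^sub>F n in along A'. (if n \<in> A' then l else 0) = l" by (simp add: eventually_along)
  ultimately have "((\<lambda>n. l) \<longlongrightarrow> 0) (along A')" by (rule Lim_transform_eventually)
  moreover have "along A' \<noteq> bot" using almost_disjointD(1)[OF adA A'(1)] by (simp add: along_eq_bot_iff)
  ultimately show ?thesis using tendsto_const_iff by blast
qed

text \<open>Along a member, \<open>h\<close> tends to its value at the limit point or, if the member
  is not in \<open>\<B>\<close>, to 0; along a set almost disjoint from all members it tends to 0.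
  As \<open>\<B>\<close> is an arbitrary subfamily, one recursion serves all target spaces.\<close>

lemma killed_contradiction:
  assumes ad: "almost_disjoint (range A)" and B: "\<B> \<subseteq> range A" and h: "h \<in> C0K \<B>"
    and nc: "\<nexists>l. ((\<lambda>n. h (Inl n)) \<longlongrightarrow> l) (along E)"
    and E: "(\<exists>j. E \<subseteq> A j) \<or> (\<forall>j. finite (E \<inter> A j))"
  shows False
  using E
proof
  assume "\<exists>j. E \<subseteq> A j"
  then obtain j where j: "E \<subseteq> A j" ..
  have "\<exists>l. ((\<lambda>n. h (Inl n)) \<longlongrightarrow> l) (along (A j))"
  proof (cases "A j \<in> \<B>")
    case True
    then show ?thesis using C0K_D(1)[OF h] by blast
  next
    case False
    have "finite (A j \<inter> B)" if "B \<in> \<B>" for B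
      by (rule almost_disjointD(2)[OF ad]) (use that False assms(2) in auto)
    then show ?thesis using C0K_tendsto_zero[OF h] by blast
  qed
  then show False using nc j tendsto_along_mono by blast
next
  assume "\<forall>j. finite (E \<inter> A j)"
  then have "((\<lambda>n. h (Inl n)) \<longlongrightarrow> 0) (along E)" using B by (intro C0K_tendsto_zero[OF h]) blast
  then show False using nc by blast
qed

lemma clusters_pair:
  assumes "infinite B" "clusters B \<subseteq> {p, q}"
  shows "\<exists>p q. clusters B = {p, q}"
proof -
  obtain H z where H: "infinite H" "H \<subseteq> B" "(rho \<longlongrightarrow> z) (along H)" using assms(1) by (rule infinite_along_rho)
  have "z \<in> clusters B" using clusters_tendsto[OF H(1,3)] clusters_mono[OF H(2)] by blast
  then have "clusters B = {p} \<or> clusters B = {q} \<or> clusters B = {p, q}" using assms(2) by auto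
  then show ?thesis by (metis insert_absorb2)
qed

section \<open>Coding of the stages and assembly of the system\<close>

definition pack :: "(nat \<Rightarrow> nat set) \<Rightarrow> nat set" where
  "pack X = prod_encode ` (SIGMA n:UNIV. X n)"

lemma pack_eq_iff: "pack X = pack Y \<longleftrightarrow> X = Y"
proof
  assume eq: "pack X = pack Y"
  have "k \<in> Z n \<longleftrightarrow> prod_encode (n, k) \<in> pack Z" for Z n k
    by (auto simp: pack_def dest!: injD[OF inj_prod_encode])
  then show "X = Y" using eq by (auto simp: fun_eq_iff)
qed simp

lemma uncountable_UNIV_nat_set: "uncountable (UNIV :: nat set set)"
proof
  assume "countable (UNIV :: nat set set)"
  then obtain f :: "nat \<Rightarrow> nat set" where "range f = UNIV"
    using uncountable_def[of "UNIV :: nat set set"] by auto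
  then show False using Cantors_theorem[of "UNIV :: nat set"] by auto
qed

text \<open>A general scalar field treats the real and the complex case together. At most continuum
  many scalars allow matrices to be coded by sets of natural numbers; \<open>heine_borel\<close>
  provides convergent subsequences of the diagonal.\<close>

lemma rigid_system:
  fixes P :: "'p set" and r :: "'p rel"
  assumes po: "partial_order_on P r" and P: "P \<lesssim> (UNIV :: nat set set)"
    and k: "(UNIV :: 'k::{real_normed_field, banach, heine_borel} set) \<lesssim> (UNIV :: nat set set)"
  shows
   "\<exists>(\<A> :: 'p \<Rightarrow> nat set set)
       (\<iota> :: 'p \<Rightarrow> 'p \<Rightarrow> ((nat + nat set) \<Rightarrow> 'k) \<Rightarrow> ((nat + nat set) \<Rightarrow> 'k)).
       (\<forall>t\<in>P. almost_disjoint (\<A> t) \<and> uncountable (\<A> t))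
     \<and> (\<forall>s\<in>P. \<forall>t\<in>P. (s, t) \<in> r \<longrightarrow>
          isometric_algebra_hom (C_0 (K_space (\<A> s))) (C_0 (K_space (\<A> t))) (\<iota> s t))
     \<and> (\<forall>s\<in>P. \<forall>f\<in>C_0 (K_space (\<A> s)). \<iota> s s f = f)
     \<and> (\<forall>q\<in>P. \<forall>s\<in>P. \<forall>t\<in>P. (q, s) \<in> r \<and> (s, t) \<in> r \<longrightarrow>
          (\<forall>f\<in>C_0 (K_space (\<A> q)). \<iota> s t (\<iota> q s f) = \<iota> q t f))
     \<and> (\<forall>s\<in>P. \<forall>t\<in>P. \<forall>T.
          bounded_operator (C_0 (K_space (\<A> s))) (C_0 (K_space (\<A> t))) T \<longrightarrow>
            ((s, t) \<in> r \<longrightarrow>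
               (\<exists>(c :: 'k) S.
                   bounded_operator (C_0 (K_space (\<A> s))) (C_0 (K_space (\<A> t))) S
                 \<and> factors_through_c_0 (C_0 (K_space (\<A> s))) (C_0 (K_space (\<A> t))) S
                 \<and> (\<forall>f\<in>C_0 (K_space (\<A> s)). T f = (\<lambda>x. c * \<iota> s t f x + S f x))))
          \<and> ((s, t) \<notin> r \<longrightarrow>
               factors_through_c_0 (C_0 (K_space (\<A> s))) (C_0 (K_space (\<A> t))) T))"
proof -
  obtain e :: "'k \<Rightarrow> nat set" where e: "inj e" using k by (auto simp: lepoll_def)
  obtain c :: "'p \<Rightarrow> nat set" where c: "inj_on c P" using P by (auto simp: lepoll_def)
  \<comment> \<open>A stage codes a matrix, a class \<open>u\<close> and a free parameter
    \<open>\<xi>\<close>, so that each matrix is handled uncountably often within each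
    class.\<close>
  define code :: "(nat \<Rightarrow> nat \<Rightarrow> 'k) \<Rightarrow> 'p \<Rightarrow> nat set \<Rightarrow> nat set" where
    "code M u \<xi> = pack (\<lambda>n. if n = 0 then pack (\<lambda>n. pack (\<lambda>m. e (M n m))) else if n = 1 then c u else \<xi>)" for M u \<xi>
  have code: "M = N \<and> u = v \<and> \<xi> = \<eta>" if "code M u \<xi> = code N v \<eta>" "u \<in> P" "v \<in> P" for M N u v \<xi> \<eta>
  proof -
    have eq: "(if n = 0 then pack (\<lambda>n. pack (\<lambda>m. e (M n m))) else if n = 1 then c u else \<xi>) =
      (if n = 0 then pack (\<lambda>n. pack (\<lambda>m. e (N n m))) else if n = 1 then c v else \<eta>)" for n :: nat
      using that(1) unfolding code_def pack_eq_iff by (rule fun_cong)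
    have "M = N" using eq[of 0] by (auto simp: pack_eq_iff fun_eq_iff inj_eq[OF e])
    moreover have "u = v" using eq[of 1] inj_onD[OF c] that by simp
    moreover have "\<xi> = \<eta>" using eq[of 2] by simp
    ultimately show ?thesis by blast
  qed
  define task where "task i = (SOME M. \<exists>u\<in>P. \<exists>\<xi>. i = code M u \<xi>)" for i
  have task: "task (code M u \<xi>) = M" if "u \<in> P" for M u \<xi>
    unfolding task_def by (rule some_equality) (use that code in blast)+
  obtain A :: "nat set \<Rightarrow> nat set" and p q :: "nat set \<Rightarrow> real" where
    A: "\<And>i. infinite (A i)" and cl: "\<And>i. clusters (A i) \<subseteq> {p i, q i}"
    and disj: "\<And>i j. i \<noteq> j \<Longrightarrow> {p i, q i} \<inter> {p j, q j} = {}"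
    and kill: "\<And>i. admissible (task i) \<Longrightarrow> \<nexists>l. survivor (task i) l \<Longrightarrow>
      \<exists>E. (\<nexists>l. ((\<lambda>n. infsum (task i n) (A i)) \<longlongrightarrow> l) (along E)) \<and> ((\<exists>j. E \<subseteq> A j) \<or> (\<forall>j. finite (E \<inter> A j)))"
    by (rule rigid_family[of task]) blast
  have cl_disj: "clusters (A i) \<inter> clusters (A j) = {}" if "i \<noteq> j" for i j
    using disj[OF that] cl[of i] cl[of j] by blast
  have D: "two_point_family (range A)"
    unfolding two_point_family_def
  proof (intro conjI ballI)
    show "\<exists>p q. clusters B = {p, q}" if "B \<in> range A" for B using that clusters_pair[OF A cl] by blast
    show "pairwise (\<lambda>A B. clusters A \<inter> clusters B = {}) (range A)"
      unfolding pairwise_def using cl_disj by (metis imageE)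
  qed
  have adD: "almost_disjoint (range A)" by (rule two_point_family_almost_disjoint[OF D])
  have injA: "inj A"
  proof (rule injI, rule ccontr)
    fix i j assume "A i = A j" "i \<noteq> j"
    moreover obtain x y where "clusters (A i) = {x, y}" using clusters_pair[OF A cl] by blast
    ultimately show False using cl_disj[of i j] by simp
  qed
  have unc: "uncountable (range (\<lambda>\<xi>. A (code M u \<xi>)))" if "u \<in> P" for M u
  proof
    assume "countable (range (\<lambda>\<xi>. A (code M u \<xi>)))"
    moreover have "inj (\<lambda>\<xi>. A (code M u \<xi>))"
      using code[OF _ that that] injD[OF injA] by (intro injI) blast
    ultimately show False using countable_image_inj_on uncountable_UNIV_nat_set by blast
  qed
  \<comment> \<open>Members at stages that code nothing, where \<open>task\<close> is an arbitrary
    matrix, belong to no \<open>\<A> t\<close>; they remain in \<open>range A\<close>.\<close>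
  define \<A> where "\<A> t = {A (code M u \<xi>) | M u \<xi>. u \<in> P \<and> (u, t) \<in> r}" for t
  have \<A>D: "\<A> t \<subseteq> range A" for t by (auto simp: \<A>_def)
  have tp: "two_point_family (\<A> t)" for t by (rule two_point_family_subset[OF D \<A>D])
  have ad: "almost_disjoint (\<A> t)" for t by (rule two_point_family_almost_disjoint[OF tp])
  have refl: "(t, t) \<in> r" if "t \<in> P" for t using po that by (auto simp: partial_order_on_def preorder_on_def refl_on_def)
  have trans: "trans r" using po by (simp add: partial_order_on_def preorder_on_def)
  have class_sub: "range (\<lambda>\<xi>. A (code M t \<xi>)) \<subseteq> \<A> t" if "t \<in> P" for M t
    using refl[OF that] that by (auto simp: \<A>_def)
  have class_disj: "range (\<lambda>\<xi>. A (code M s \<xi>)) \<inter> \<A> t = {}" if s: "s \<in> P" "(s, t) \<notin> r" for M s t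
  proof -
    have False if "A (code M s \<xi>) = A (code N u \<eta>)" "u \<in> P" "(u, t) \<in> r" for \<xi> N u \<eta>
    proof -
      have "code M s \<xi> = code N u \<eta>" using that(1) by (rule injD[OF injA])
      then have "s = u" using code s(1) that(2) by blast
      then show False using s(2) that(3) by blast
    qed
    then show ?thesis unfolding \<A>_def by blast
  qed
  have mono: "\<A> s \<subseteq> \<A> t" if "(s, t) \<in> r" for s t
    unfolding \<A>_def using transD[OF trans _ that] by blast
  have surv: "\<exists>l. survivor (matrix_of T) l"
    if s: "s \<in> P" and T: "bounded_operator (C0K (\<A> s)) (C0K (\<A> t)) T" for s t and T :: "(nat + nat set \<Rightarrow> 'k) \<Rightarrow> nat + nat set \<Rightarrow> 'k"
  proof (rule ccontr)
    assume ns: "\<nexists>l. survivor (matrix_of T) l"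
    let ?M = "matrix_of T"
    \<comment> \<open>Uncountably many members of \<open>\<A> s\<close> were built with this matrix
      as their task, and only countably many members violate the matrix formula. So some stage
      handles the matrix at a member for which the formula is valid.\<close>
    have "\<not> range (\<lambda>\<xi>. A (code ?M s \<xi>)) \<subseteq> {A \<in> \<A> s. \<exists>n. T (chi A) (Inl n) \<noteq> infsum (?M n) A}"
      using unc[OF s] matrix_of_chi[OF ad T] countable_subset by blast
    then obtain \<xi> where \<xi>: "A (code ?M s \<xi>) \<notin> {A \<in> \<A> s. \<exists>n. T (chi A) (Inl n) \<noteq> infsum (?M n) A}" by blast
    define i where "i = code ?M s \<xi>"
    have Ai: "A i \<in> \<A> s" using class_sub[OF s] by (auto simp: i_def)
    then have eq: "T (chi (A i)) (Inl n) = infsum (?M n) (A i)" for n using \<xi> by (auto simp: i_def)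
    have "task i = ?M" unfolding i_def by (rule task[OF s])
    then obtain E where E: "\<nexists>l. ((\<lambda>n. infsum (?M n) (A i)) \<longlongrightarrow> l) (along E)"
      "(\<exists>j. E \<subseteq> A j) \<or> (\<forall>j. finite (E \<inter> A j))"
      using kill[of i] matrix_of_admissible[OF T tp] ns by auto
    have "T (chi (A i)) \<in> C0K (\<A> t)"
      using T chi_C0K[OF ad Ai] by (auto simp: bounded_operator_def linear_map_def)
    then show False
      by (rule killed_contradiction[OF adD \<A>D _ _ E(2)]) (use E(1) in \<open>simp add: eq\<close>)
  qed
  have main1: "\<exists>(c :: 'k) S. bounded_operator (C0K (\<A> s)) (C0K (\<A> t)) S
      \<and> factors_through_c_0 (C0K (\<A> s)) (C0K (\<A> t)) S
      \<and> (\<forall>f\<in>C0K (\<A> s). T f = (\<lambda>x. c * f x + S f x))"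
    if s: "s \<in> P" "(s, t) \<in> r" and T: "bounded_operator (C0K (\<A> s)) (C0K (\<A> t)) T" for s t and T :: "(nat + nat set \<Rightarrow> 'k) \<Rightarrow> nat + nat set \<Rightarrow> 'k"
  proof -
    obtain l where l: "survivor (matrix_of T) l" using surv[OF s(1) T] by blast
    have C0: "(\<lambda>x. T f x - l * f x) \<in> C0K (\<A> t)" if f: "f \<in> C0K (\<A> s)" for f
    proof -
      have "T f \<in> C0K (\<A> t)" using T f by (auto simp: bounded_operator_def linear_map_def)
      then have "(\<lambda>x. T f x + (- l) * f x) \<in> C0K (\<A> t)"
        by (intro C0K_add C0K_scale C0K_mono[OF ad mono[OF s(2)] f])
      then show ?thesis by simp
    qed
    show ?thesis
    proof (intro exI[of _ l] exI[of _ "\<lambda>f x. T f x - l * f x"] conjI)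
      show "bounded_operator (C0K (\<A> s)) (C0K (\<A> t)) (\<lambda>f x. T f x - l * f x)"
        by (rule operator_minus_scalar[OF T C0])
      show "factors_through_c_0 (C0K (\<A> s)) (C0K (\<A> t)) (\<lambda>f x. T f x - l * f x)"
        by (rule survivor_factors[OF tp tp T l C0])
    qed simp
  qed
  have main2: "factors_through_c_0 (C0K (\<A> s)) (C0K (\<A> t)) T"
    if s: "s \<in> P" "(s, t) \<notin> r" and T: "bounded_operator (C0K (\<A> s)) (C0K (\<A> t)) T" for s t and T :: "(nat + nat set \<Rightarrow> 'k) \<Rightarrow> nat + nat set \<Rightarrow> 'k"
  proof -
    obtain l where l: "survivor (matrix_of T) l" using surv[OF s(1) T] by blast
    have "uncountable (\<A> s - \<A> t)"
    proof
      assume "countable (\<A> s - \<A> t)"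
      \<comment> \<open>The class of \<open>s\<close> is part of \<open>\<A> s\<close> by
        reflexivity and disjoint from \<open>\<A> t\<close>. Its members at the zero matrix, chosen
        as a sample, already form an uncountable set.\<close>
      moreover have "range (\<lambda>\<xi>. A (code (\<lambda>_ _. 0) s \<xi>)) \<subseteq> \<A> s - \<A> t"
        using class_sub[OF s(1)] class_disj[OF s] by blast
      ultimately show False using unc[OF s(1)] countable_subset by blast
    qed
    then have "l = 0" by (rule survivor_scalar_eq_zero[OF D \<A>D \<A>D T l])
    have "T f \<in> C0K (\<A> t)" if "f \<in> C0K (\<A> s)" for f
      using T that by (auto simp: bounded_operator_def linear_map_def)
    then show ?thesis using survivor_factors[OF tp tp T l] \<open>l = 0\<close> by simp
  qed
  show ?thesis
    unfolding C_0_K_space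
  \<comment> \<open>On representatives that vanish off the space, extension by zero is the identity
    function, so the compatibility conditions hold by reflexivity.\<close>
  proof (intro exI[of _ \<A>] exI[of _ "\<lambda>s t f. f"] conjI ballI allI impI)
    show "uncountable (\<A> t)" if "t \<in> P" for t
      using unc[OF that] class_sub[OF that] countable_subset by blast
    show "isometric_algebra_hom (C0K (\<A> s)) (C0K (\<A> t)) (\<lambda>f :: nat + nat set \<Rightarrow> 'k. f)" if "(s, t) \<in> r" for s t
      unfolding isometric_algebra_hom_def linear_map_def using C0K_mono[OF ad mono[OF that]] by auto
    show "factors_through_c_0 (C0K (\<A> s)) (C0K (\<A> t)) T"
      if "s \<in> P" "bounded_operator (C0K (\<A> s)) (C0K (\<A> t)) T" "(s, t) \<notin> r" for s t and T :: "(nat + nat set \<Rightarrow> 'k) \<Rightarrow> nat + nat set \<Rightarrow> 'k"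
      by (rule main2[OF that(1,3,2)])
    show "\<exists>(c :: 'k) S. bounded_operator (C0K (\<A> s)) (C0K (\<A> t)) S
      \<and> factors_through_c_0 (C0K (\<A> s)) (C0K (\<A> t)) S
      \<and> (\<forall>f\<in>C0K (\<A> s). T f = (\<lambda>x. c * f x + S f x))"
      if "s \<in> P" "bounded_operator (C0K (\<A> s)) (C0K (\<A> t)) T" "(s, t) \<in> r" for s t and T :: "(nat + nat set \<Rightarrow> 'k) \<Rightarrow> nat + nat set \<Rightarrow> 'k"
      by (rule main1[OF that(1,3,2)])
  qed (rule ad HOL.refl)+
qed

lemma real_lepoll: "(UNIV :: real set) \<lesssim> (UNIV :: nat set set)"
  using nat_sets_eqpoll_reals eqpoll_imp_lepoll eqpoll_sym by blast

lemma complex_lepoll: "(UNIV :: complex set) \<lesssim> (UNIV :: nat set set)"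
proof -
  obtain e :: "real \<Rightarrow> nat set" where e: "inj e" using real_lepoll by (auto simp: lepoll_def)
  have "inj (\<lambda>z. pack (\<lambda>n. if n = 0 then e (Re z) else e (Im z)))"
  proof (rule injI)
    fix w z :: complex
    assume "pack (\<lambda>n. if n = 0 then e (Re w) else e (Im w)) = pack (\<lambda>n. if n = 0 then e (Re z) else e (Im z))"
    then have "(if n = 0 then e (Re w) else e (Im w)) = (if n = 0 then e (Re z) else e (Im z))" for n :: nat
      unfolding pack_eq_iff by (rule fun_cong)
    from this[of 0] this[of 1] show "w = z" by (simp add: inj_eq[OF e] complex_eq_iff)
  qed
  then show ?thesis by (auto simp: lepoll_def)
qed

theorem theorem1p1:
  fixes P :: "'p set" and r :: "'p rel"
  assumes "partial_order_on P r"
    and "P \<lesssim> (UNIV :: nat set set)"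
  shows
   "(\<exists>(\<A> :: 'p \<Rightarrow> nat set set)
       (\<iota> :: 'p \<Rightarrow> 'p \<Rightarrow> ((nat + nat set) \<Rightarrow> real) \<Rightarrow> ((nat + nat set) \<Rightarrow> real)).
       (\<forall>t\<in>P. almost_disjoint (\<A> t) \<and> uncountable (\<A> t))
     \<and> (\<forall>s\<in>P. \<forall>t\<in>P. (s, t) \<in> r \<longrightarrow>
          isometric_algebra_hom (C_0 (K_space (\<A> s))) (C_0 (K_space (\<A> t))) (\<iota> s t))
     \<and> (\<forall>s\<in>P. \<forall>f\<in>C_0 (K_space (\<A> s)). \<iota> s s f = f)
     \<and> (\<forall>q\<in>P. \<forall>s\<in>P. \<forall>t\<in>P. (q, s) \<in> r \<and> (s, t) \<in> r \<longrightarrow>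
          (\<forall>f\<in>C_0 (K_space (\<A> q)). \<iota> s t (\<iota> q s f) = \<iota> q t f))
     \<and> (\<forall>s\<in>P. \<forall>t\<in>P. \<forall>T.
          bounded_operator (C_0 (K_space (\<A> s))) (C_0 (K_space (\<A> t))) T \<longrightarrow>
            ((s, t) \<in> r \<longrightarrow>
               (\<exists>(c :: real) S.
                   bounded_operator (C_0 (K_space (\<A> s))) (C_0 (K_space (\<A> t))) S
                 \<and> factors_through_c_0 (C_0 (K_space (\<A> s))) (C_0 (K_space (\<A> t))) S
                 \<and> (\<forall>f\<in>C_0 (K_space (\<A> s)). T f = (\<lambda>x. c * \<iota> s t f x + S f x))))
          \<and> ((s, t) \<notin> r \<longrightarrow>
               factors_through_c_0 (C_0 (K_space (\<A> s))) (C_0 (K_space (\<A> t))) T)))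
    \<and>
    (\<exists>(\<A> :: 'p \<Rightarrow> nat set set)
       (\<iota> :: 'p \<Rightarrow> 'p \<Rightarrow> ((nat + nat set) \<Rightarrow> complex) \<Rightarrow> ((nat + nat set) \<Rightarrow> complex)).
       (\<forall>t\<in>P. almost_disjoint (\<A> t) \<and> uncountable (\<A> t))
     \<and> (\<forall>s\<in>P. \<forall>t\<in>P. (s, t) \<in> r \<longrightarrow>
          isometric_algebra_hom (C_0 (K_space (\<A> s))) (C_0 (K_space (\<A> t))) (\<iota> s t))
     \<and> (\<forall>s\<in>P. \<forall>f\<in>C_0 (K_space (\<A> s)). \<iota> s s f = f)
     \<and> (\<forall>q\<in>P. \<forall>s\<in>P. \<forall>t\<in>P. (q, s) \<in> r \<and> (s, t) \<in> r \<longrightarrow>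
          (\<forall>f\<in>C_0 (K_space (\<A> q)). \<iota> s t (\<iota> q s f) = \<iota> q t f))
     \<and> (\<forall>s\<in>P. \<forall>t\<in>P. \<forall>T.
          bounded_operator (C_0 (K_space (\<A> s))) (C_0 (K_space (\<A> t))) T \<longrightarrow>
            ((s, t) \<in> r \<longrightarrow>
               (\<exists>(c :: complex) S.
                   bounded_operator (C_0 (K_space (\<A> s))) (C_0 (K_space (\<A> t))) S
                 \<and> factors_through_c_0 (C_0 (K_space (\<A> s))) (C_0 (K_space (\<A> t))) S
                 \<and> (\<forall>f\<in>C_0 (K_space (\<A> s)). T f = (\<lambda>x. c * \<iota> s t f x + S f x))))
          \<and> ((s, t) \<notin> r \<longrightarrow>
               factors_through_c_0 (C_0 (K_space (\<A> s))) (C_0 (K_space (\<A> t))) T)))"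
  by (intro conjI rigid_system[OF assms real_lepoll] rigid_system[OF assms complex_lepoll])

end
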